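(* Let $d\in\mathbb{N}$, let $\mathfrak{L}^-$ be a finite set, and let $\mathcal{M}_{\mathcal{R}}$ be the vector space spanned by all populated SPDE multi-indices, equipped with the products $\triangleright_{\mathbf{n}}$, $\mathbf{n}\in\mathbb{N}^{d+1}$, given by $z^{\gamma}\triangleright_{\mathbf{n}}z^{\gamma'}=z^{\gamma}D^{(\mathbf{n})}(z^{\gamma'})$. Then the $\mathbb{N}^{d+1}$-multi-Novikov algebra $\mathcal{M}_{\mathcal{R}}$ is isomorphic to the free $\mathbb{N}^{d+1}$-multi-Novikov algebra generated by the set $\mathbb{N}^{d+1}\times\mathfrak{L}^-$.
   Context: Vector spaces are over a fixed field of characteristic zero. $\mathbb{N}=\{0,1,2,\dots\}$; $e_0,\dots,e_d$ are the standard basis vectors of $\mathbb{N}^{d+1}$. For a set $A$, an $A$-multi-Novikov algebra is a vector space with bilinear products $x,y\mapsto x\triangleright_a y$, $a\in A$, satisfying for all $a,b\in A$ and all $x,y,z$: (1) $(x\triangleright_a y)\triangleright_b z-x\triangleright_a(y\triangleright_b z)=(y\triangleright_a x)\triangleright_b z-y\triangleright_a(x\triangleright_b z)$; (2) $(x\triangleright_a y)\triangleright_b z-x\triangleright_a(y\triangleright_b z)=(x\triangleright_b y)\triangleright_a z-x\triangleright_b(y\triangleright_a z)$; (3) $(x\triangleright_a y)\triangleright_b z=(x\triangleright_b z)\triangleright_a y$. Morphisms are linear maps commuting with all products; free algebras are meant in this category. Let $\mathcal{A}$ be the unital associative algebra generated by letters $\mathbf{n}\in\mathbb{N}^{d+1}$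 and letters $d_i$, $0\le i\le d$, subject to the relations $d_id_j=d_jd_i$, $\mathbf{n}\mathbf{m}=\mathbf{m}\mathbf{n}$, and $d_i\mathbf{n}=n_i(\mathbf{n}-e_i)+\mathbf{n}d_i$. Here juxtaposition is the product in $\mathcal{A}$, $n_i$ is the $i$-th component of $\mathbf{n}$, $(\mathbf{n}-e_i)$ is regarded as a single letter, and that term is absent if $n_i=0$. These relations are homogeneous for the grading $\ell$ of $\mathcal{A}$ that counts the number of letters from $\mathbb{N}^{d+1}$ (so $\ell(\mathbf{n})=1$, $\ell(d_i)=0$). Introduce commuting formal variables $z_{(\mathfrak{l},\alpha)}$, $\mathfrak{l}\in\mathfrak{L}^-$, $\alpha\in\mathcal{A}$, linear in $\alpha$: $z_{(\mathfrak{l},c_1\alpha_1+c_2\alpha_2)}=c_1z_{(\mathfrak{l},\alpha_1)}+c_2z_{(\mathfrak{l},\alpha_2)}$. The space of SPDE multi-indices is the span of all monomials $z^\beta=\prod z_{(\mathfrak{l},\alpha)}^{\beta(\mathfrak{l},\alpha)}$ ($\beta$ finitely supported with values in $\mathbb{N}$) in these variables, i.e. the symmetric algebra of the vector space $\mathrm{Vect}(\mathfrak{L}^-)\otimes\mathcal{A}$. A monomial $z^\beta$ in variables with $\ell$-homogeneous $\alpha$'s is populated if $\sum_{(\mathfrak{l},\alpha)}(1-\ell(\alpha))\beta(\mathfrak{l},\alpha)=1$; $\mathcal{M}_{\mathcal{R}}$ is the span of all populated monomials. For $\mathbf{n}\in\mathbb{N}^{d+1}$, $D^{(\mathbf{n})}$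 is the unique derivation of the symmetric algebra with $D^{(\mathbf{n})}(z_{(\mathfrak{l},\alpha)})=z_{(\mathfrak{l},\mathbf{n}\alpha)}$ for all $\mathfrak{l},\alpha$. These derivations commute, and the products $\triangleright_{\mathbf{n}}$ preserve $\mathcal{M}_{\mathcal{R}}$ and make it an $\mathbb{N}^{d+1}$-multi-Novikov algebra. *)

theory Defs
  imports Complex_Main "HOL-Library.Poly_Mapping"
begin

section \<open>Finitely supported functions as free vector spaces\<close>

definition pscale :: "'k::field \<Rightarrow> ('a \<Rightarrow>\<^sub>0 'k) \<Rightarrow> ('a \<Rightarrow>\<^sub>0 'k)" where
  "pscale c p = Poly_Mapping.map ((*) c) p"

lemma lookup_pscale [simp]: "Poly_Mapping.lookup (pscale c p) a = c * Poly_Mapping.lookup p a"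
  by (simp add: pscale_def map.rep_eq when_def)

lemma pscale_single [simp]: "pscale c (Poly_Mapping.single a b) = Poly_Mapping.single a (c * b)"
  by (rule poly_mapping_eqI) (simp add: lookup_single when_def)

lemma pscale_mult: "pscale c p = Poly_Mapping.single 0 c * (p :: 'a::monoid_add \<Rightarrow>\<^sub>0 'k::field)"
  by (simp add: pscale_def mult_map_scale_conv_mult)

lemma pscale_add: "pscale c (p + q) = pscale c p + pscale c q"
  by (rule poly_mapping_eqI) (simp add: lookup_add distrib_left)

lemma vector_space_pscale: "vector_space (pscale :: 'k::field \<Rightarrow> ('a \<Rightarrow>\<^sub>0 'k) \<Rightarrow> _)"
  by unfold_locales (auto intro!: poly_mapping_eqI simp: lookup_add algebra_simps)

interpretation pm: vector_space "pscale :: 'k::field \<Rightarrow> ('a \<Rightarrow>\<^sub>0 'k) \<Rightarrow> _"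
  by (rule vector_space_pscale)

lemma poly_mapping_expand: "p = (\<Sum>k\<in>Poly_Mapping.keys p. Poly_Mapping.single k (Poly_Mapping.lookup p k))"
  by (rule poly_mapping_eqI) (auto simp: lookup_sum lookup_single when_def in_keys_iff)

lemma poly_mapping_single_induct [case_names zero monom add]:
  assumes "P 0" "\<And>k v. P (Poly_Mapping.single k v)" "\<And>p q. P p \<Longrightarrow> P q \<Longrightarrow> P (p + q)"
  shows "P (p :: 'a \<Rightarrow>\<^sub>0 'b::comm_monoid_add)"
proof -
  have "P (\<Sum>k\<in>A. Poly_Mapping.single k (Poly_Mapping.lookup p k))" if "finite A" for A
    using that by (induction rule: finite_induct) (auto intro: assms)
  moreover have "p = (\<Sum>k\<in>Poly_Mapping.keys p. Poly_Mapping.single k (Poly_Mapping.lookup p k))"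
    by (rule poly_mapping_eqI) (auto simp: lookup_sum lookup_single when_def in_keys_iff)
  ultimately show ?thesis by (metis finite_keys)
qed

lemma pscale_mult_right: "p * pscale c q = pscale c (p * q)"
  for p q :: "'a::monoid_add \<Rightarrow>\<^sub>0 'k::field"
proof (induction p rule: poly_mapping_single_induct)
  case (monom k v)
  show ?case
    by (induction q rule: poly_mapping_single_induct)
       (simp_all add: mult_single pscale_add distrib_left ac_simps pm.scale_zero_right)
qed (simp_all add: pscale_add distrib_right pm.scale_zero_right)

definition lin_ext :: "('k::field \<Rightarrow> 'v \<Rightarrow> 'v::ab_group_add) \<Rightarrow> ('a \<Rightarrow> 'v) \<Rightarrow> ('a \<Rightarrow>\<^sub>0 'k) \<Rightarrow> 'v" where
  "lin_ext scale f p = (\<Sum>a\<in>Poly_Mapping.keys p. scale (Poly_Mapping.lookup p a) (f a))"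

context vector_space
begin

lemma lin_ext_add: "lin_ext scale f (p + q) = lin_ext scale f p + lin_ext scale f q"
  unfolding lin_ext_def
  by (rule setsum_keys_plus_distrib) (auto simp: scale_left_distrib)

lemma lin_ext_single [simp]: "lin_ext scale f (Poly_Mapping.single a c) = scale c (f a)"
  by (simp add: lin_ext_def)

lemma lin_ext_0 [simp]: "lin_ext scale f 0 = 0"
  by (simp add: lin_ext_def)

lemma lin_ext_pscale: "lin_ext scale f (pscale c p) = scale c (lin_ext scale f p)"
  by (induction p rule: poly_mapping_single_induct)
     (simp_all add: lin_ext_add scale_right_distrib pm.scale_right_distrib)

lemma lin_ext_uminus: "lin_ext scale f (- p) = - lin_ext scale f p"
  using lin_ext_add [of f p "- p"] by (simp add: eq_neg_iff_add_eq_0 add.commute)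

lemma lin_ext_diff: "lin_ext scale f (p - q) = lin_ext scale f p - lin_ext scale f q"
  using lin_ext_add [of f p "- q"] by (simp add: lin_ext_uminus)

end

lemma lookup_mult_0:
  fixes p q :: "'a::monoid_add \<Rightarrow>\<^sub>0 'k::field"
  assumes "\<And>a b :: 'a. a + b = 0 \<Longrightarrow> a = 0 \<and> b = 0"
  shows "Poly_Mapping.lookup (p * q) 0 = Poly_Mapping.lookup p 0 * Poly_Mapping.lookup q 0"
proof (induction p rule: poly_mapping_single_induct)
  case (monom k v)
  show ?case
  proof (induction q rule: poly_mapping_single_induct)
    case (monom k' v')
    then show ?case using assms [of k k'] by (auto simp: mult_single lookup_single when_def)
  qed (auto simp: algebra_simps lookup_add)
qed (auto simp: algebra_simps lookup_add)


section \<open>Two-sided ideals generated by a set\<close>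

inductive_set ring_ideal :: "'a::ring_1 set \<Rightarrow> 'a set" for R where
  zero: "0 \<in> ring_ideal R"
| gen: "r \<in> R \<Longrightarrow> a * r * b \<in> ring_ideal R"
| add: "x \<in> ring_ideal R \<Longrightarrow> y \<in> ring_ideal R \<Longrightarrow> x + y \<in> ring_ideal R"

lemma ring_ideal_mult_left: "x \<in> ring_ideal R \<Longrightarrow> c * x \<in> ring_ideal R"
  by (induction rule: ring_ideal.induct)
     (auto simp: algebra_simps intro: ring_ideal.intros
        dest: ring_ideal.gen [where a = "c * _"] simp flip: mult.assoc)

lemma ring_ideal_mult_right: "x \<in> ring_ideal R \<Longrightarrow> x * c \<in> ring_ideal R"
proof (induction rule: ring_ideal.induct)
  case (gen r a b)
  then show ?case using ring_ideal.gen [of r R a "b * c"] by (simp add: mult.assoc)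
qed (auto simp: algebra_simps intro: ring_ideal.intros)

lemma ring_ideal_uminus: "x \<in> ring_ideal R \<Longrightarrow> - x \<in> ring_ideal R"
  using ring_ideal_mult_left [of x R "-1"] by simp

lemma ring_ideal_diff: "x \<in> ring_ideal R \<Longrightarrow> y \<in> ring_ideal R \<Longrightarrow> x - y \<in> ring_ideal R"
  using ring_ideal.add [of x R "- y"] ring_ideal_uminus by fastforce

lemma ring_ideal_base: "r \<in> R \<Longrightarrow> r \<in> ring_ideal R"
  using ring_ideal.gen [of r R 1 1] by simp

lemma ring_ideal_pscale:
  "x \<in> ring_ideal R \<Longrightarrow> pscale c x \<in> ring_ideal (R :: ('a::monoid_add \<Rightarrow>\<^sub>0 'k::field) set)"
  by (simp add: pscale_mult ring_ideal_mult_left)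

lemma ring_ideal_diff_commute: "x - y \<in> ring_ideal R \<Longrightarrow> y - x \<in> ring_ideal R"
  using ring_ideal_uminus by fastforce

lemma ring_ideal_equivp: "equivp (\<lambda>x y. x - y \<in> ring_ideal R)"
proof (rule equivpI)
  show "reflp (\<lambda>x y. x - y \<in> ring_ideal R)" by (rule reflpI) (simp add: ring_ideal.zero)
  show "symp (\<lambda>x y. x - y \<in> ring_ideal R)" by (rule sympI) (rule ring_ideal_diff_commute)
  show "transp (\<lambda>x y. x - y \<in> ring_ideal R)"
    by (rule transpI) (use ring_ideal.add in fastforce)
qed

lemma ring_ideal_add_cong:
  assumes "x - x' \<in> ring_ideal R" "y - y' \<in> ring_ideal R"
  shows "(x + y) - (x' + y') \<in> ring_ideal R"
  using ring_ideal.add [OF assms] by (simp add: add_diff_add)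

lemma ring_ideal_diff_cong:
  assumes "x - x' \<in> ring_ideal R" "y - y' \<in> ring_ideal R"
  shows "(x - y) - (x' - y') \<in> ring_ideal R"
proof -
  have "(x - y) - (x' - y') = (x - x') - (y - y')" by simp
  then show ?thesis using ring_ideal_diff [OF assms] by (simp only:)
qed

lemma ring_ideal_mult_cong:
  assumes "x - x' \<in> ring_ideal R" "y - y' \<in> ring_ideal R"
  shows "x * y - x' * y' \<in> ring_ideal R"
proof -
  have "x * y - x' * y' = (x - x') * y + x' * (y - y')" by (simp add: algebra_simps)
  then show ?thesis
    using assms by (auto intro: ring_ideal.add ring_ideal_mult_left ring_ideal_mult_right)
qed

lemma ring_ideal_lookup_0:
  fixes R :: "('a::monoid_add \<Rightarrow>\<^sub>0 'k::field) set"
  assumes "\<And>a b :: 'a. a + b = 0 \<Longrightarrow> a = 0 \<and> b = 0"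
    and "\<And>r. r \<in> R \<Longrightarrow> Poly_Mapping.lookup r 0 = 0" and "x \<in> ring_ideal R"
  shows "Poly_Mapping.lookup x 0 = 0"
  using assms(3)
  by (induction rule: ring_ideal.induct)
     (auto simp: lookup_add lookup_mult_0 [OF assms(1)] assms(2))


section \<open>The algebra generated by multi-indices and derivatives\<close>

text \<open>Words form the free monoid, written additively because the monoid algebra structure of
  \<^typ>\<open>'a \<Rightarrow>\<^sub>0 'b\<close> expects an additive monoid of exponents.\<close>

datatype 'x word = Word (letters: "'x list")

instantiation word :: (type) monoid_add
begin
definition "0 = Word []"
definition "v + w = Word (letters v @ letters w)"
instance by standard (auto simp: zero_word_def plus_word_def)
end

lemma word_add_eq_0: "v + w = 0 \<Longrightarrow> v = 0 \<and> w = (0 :: 'x word)"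
  by (cases v; cases w) (auto simp: zero_word_def plus_word_def)

text \<open>The index type \<^typ>\<open>'i\<close>, always of class \<^class>\<open>finite\<close> below, plays the role of the set
  of the \<open>d + 1\<close> coordinates: types are nonempty, so its instances cover exactly all \<open>d \<ge> 0\<close>.
  The multi-index \<open>0\<close> is a letter like any other and is not the unit of the algebra.\<close>

type_synonym 'i mindex = "'i \<Rightarrow> nat"

datatype 'i letter = Index "'i mindex" | Partial 'i

abbreviation free_letter :: "'i letter \<Rightarrow> 'i letter word \<Rightarrow>\<^sub>0 'k::field" where
  "free_letter x \<equiv> Poly_Mapping.single (Word [x]) 1"

inductive_set op_relations :: "('i::finite letter word \<Rightarrow>\<^sub>0 'k::field_char_0) set" where
  "free_letter (Partial i) * free_letter (Partial j)
     - free_letter (Partial j) * free_letter (Partial i) \<in> op_relations"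
| "free_letter (Index n) * free_letter (Index m)
     - free_letter (Index m) * free_letter (Index n) \<in> op_relations"
| "free_letter (Partial i) * free_letter (Index n)
     - (pscale (of_nat (n i)) (free_letter (Index (n(i := n i - 1))))
        + free_letter (Index n) * free_letter (Partial i)) \<in> op_relations"

quotient_type (overloaded) ('i, 'k) op_alg =
  "'i::finite letter word \<Rightarrow>\<^sub>0 'k::field_char_0" / "\<lambda>x y. x - y \<in> ring_ideal op_relations"
  by (rule ring_ideal_equivp)

lemma op_relations_lookup_0: "r \<in> op_relations \<Longrightarrow> Poly_Mapping.lookup r 0 = 0"
  by (erule op_relations.cases)
     (auto simp: lookup_minus lookup_add mult_single lookup_single when_def plus_word_def zero_word_def)

instantiation op_alg :: (finite, field_char_0) ring_1
begin
lift_definition zero_op_alg :: "('a, 'b) op_alg" is 0 .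
lift_definition one_op_alg :: "('a, 'b) op_alg" is 1 .
lift_definition plus_op_alg :: "('a, 'b) op_alg \<Rightarrow> ('a, 'b) op_alg \<Rightarrow> ('a, 'b) op_alg" is "(+)"
  by (rule ring_ideal_add_cong)
lift_definition uminus_op_alg :: "('a, 'b) op_alg \<Rightarrow> ('a, 'b) op_alg" is "uminus"
  by (simp add: ring_ideal_diff_commute)
lift_definition minus_op_alg :: "('a, 'b) op_alg \<Rightarrow> ('a, 'b) op_alg \<Rightarrow> ('a, 'b) op_alg" is "(-)"
  by (rule ring_ideal_diff_cong)
lift_definition times_op_alg :: "('a, 'b) op_alg \<Rightarrow> ('a, 'b) op_alg \<Rightarrow> ('a, 'b) op_alg" is "(*)"
  by (rule ring_ideal_mult_cong)
instance
proof
  show "(0 :: ('a, 'b) op_alg) \<noteq> 1"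
  proof (transfer, rule notI)
    assume "0 - 1 \<in> ring_ideal (op_relations :: ('a letter word \<Rightarrow>\<^sub>0 'b) set)"
    from ring_ideal_lookup_0 [OF word_add_eq_0 op_relations_lookup_0 this] show False
      by simp
  qed
qed (transfer, simp add: algebra_simps ring_ideal.zero)+
end

lift_definition op_scale :: "'k::field_char_0 \<Rightarrow> ('i::finite, 'k) op_alg \<Rightarrow> ('i, 'k) op_alg"
  is pscale
  by (simp add: ring_ideal_pscale flip: pm.scale_right_diff_distrib)

interpretation op: vector_space op_scale
  by unfold_locales
     (transfer, simp add: algebra_simps ring_ideal.zero pm.scale_right_distrib pm.scale_left_distrib)+

lemma op_scale_mult_right: "\<alpha> * op_scale c \<beta> = op_scale c (\<alpha> * \<beta>)"
  by transfer (simp add: pscale_mult_right ring_ideal.zero)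

lift_definition op_word :: "'i::finite letter word \<Rightarrow> ('i, 'k::field_char_0) op_alg"
  is "\<lambda>w. Poly_Mapping.single w 1" .

abbreviation op_index :: "'i::finite mindex \<Rightarrow> ('i, 'k::field_char_0) op_alg" where
  "op_index n \<equiv> op_word (Word [Index n])"

definition index_count :: "'i letter word \<Rightarrow> nat" where
  "index_count w = length (filter (\<lambda>x. \<exists>n. x = Index n) (letters w))"

definition op_graded :: "nat \<Rightarrow> ('i::finite, 'k::field_char_0) op_alg set" where
  "op_graded k = op.span (op_word ` {w. index_count w = k})"

text \<open>For nonzero homogeneous \<open>\<alpha>\<close> the degree is unique, see \<open>ell_eq\<close> below; otherwise \<open>ell \<alpha>\<close> is
  unspecified.\<close>

definition ell :: "('i::finite, 'k::field_char_0) op_alg \<Rightarrow> nat" where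
  "ell \<alpha> = (THE k. \<alpha> \<in> op_graded k)"

definition homog :: "nat \<Rightarrow> ('i letter word \<Rightarrow>\<^sub>0 'k::field) set" where
  "homog k = {p. \<forall>w\<in>Poly_Mapping.keys p. index_count w = k}"

lemma index_count_add: "index_count (v + w) = index_count v + index_count w"
  by (simp add: index_count_def plus_word_def)

lemma homog_mult: "p \<in> homog i \<Longrightarrow> q \<in> homog j \<Longrightarrow> p * q \<in> homog (i + j)"
  using keys_mult [of p q] by (fastforce simp: homog_def index_count_add)

lemma homog_add: "p \<in> homog i \<Longrightarrow> q \<in> homog i \<Longrightarrow> p + q \<in> homog i"
  using keys_add [of p q] by (fastforce simp: homog_def)

lemma homog_pscale: "p \<in> homog i \<Longrightarrow> pscale c p \<in> homog i"
  by (auto simp: homog_def in_keys_iff)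

lemma homog_diff: "p \<in> homog i \<Longrightarrow> q \<in> homog i \<Longrightarrow> p - q \<in> homog i"
  by (force simp: homog_def in_keys_iff lookup_minus)

lemma homog_single: "index_count w = k \<Longrightarrow> Poly_Mapping.single w c \<in> homog k"
  by (simp add: homog_def)

lemma homog_zero: "0 \<in> homog k"
  by (simp add: homog_def)

lemma op_relations_homog: "r \<in> op_relations \<Longrightarrow> \<exists>j. r \<in> homog j"
proof (induction rule: op_relations.induct)
  case (1 i j)
  show ?case
    by (intro exI [of _ 0] homog_diff homog_mult [where i = 0 and j = 0, simplified] homog_single)
      (simp_all add: index_count_def)
next
  case (2 n m)
  show ?case
    by (intro exI [of _ "1 + 1"] homog_diff homog_mult homog_single) (simp_all add: index_count_def)
next
  case (3 i n)
  have "free_letter (Partial i) * free_letter (Index n) \<in> homog (0 + 1)"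
    "free_letter (Index n) * free_letter (Partial i) \<in> homog (1 + 0)"
    by (intro homog_mult homog_single; simp add: index_count_def)+
  then show ?case
    by (intro exI [of _ 1] homog_diff homog_add homog_pscale homog_single)
      (simp_all add: index_count_def)
qed

definition homog_part :: "nat \<Rightarrow> ('i letter word \<Rightarrow>\<^sub>0 'k::field) \<Rightarrow> ('i letter word \<Rightarrow>\<^sub>0 'k)" where
  "homog_part k p = Poly_Mapping.mapp (\<lambda>w c. if index_count w = k then c else 0) p"

lemma lookup_homog_part:
  "Poly_Mapping.lookup (homog_part k p) w = (if index_count w = k then Poly_Mapping.lookup p w else 0)"
  by (simp add: homog_part_def lookup_mapp in_keys_iff when_def)

lemma homog_part_add: "homog_part k (p + q) = homog_part k p + homog_part k q"
  by (rule poly_mapping_eqI) (simp add: lookup_homog_part lookup_add)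

lemma homog_part_diff: "homog_part k (p - q) = homog_part k p - homog_part k q"
  by (rule poly_mapping_eqI) (simp add: lookup_homog_part lookup_minus)

lemma homog_part_0 [simp]: "homog_part k 0 = 0"
  by (rule poly_mapping_eqI) (simp add: lookup_homog_part)

lemma homog_part_homog: "p \<in> homog j \<Longrightarrow> homog_part k p = (if j = k then p else 0)"
  by (rule poly_mapping_eqI) (auto simp: lookup_homog_part homog_def in_keys_iff)

lemma homog_part_ideal:
  "p \<in> ring_ideal op_relations \<Longrightarrow> homog_part k p \<in> ring_ideal op_relations"
proof (induction rule: ring_ideal.induct)
  case (gen r a b)
  obtain j where j: "r \<in> homog j" using op_relations_homog gen by blast
  show ?case
  proof (induction a rule: poly_mapping_single_induct)
    case (monom v c)
    show ?case
    proof (induction b rule: poly_mapping_single_induct)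
      case (monom w d)
      have "Poly_Mapping.single v c * r * Poly_Mapping.single w d
          \<in> homog (index_count v + j + index_count w)"
        by (intro homog_mult homog_single j refl)
      then show ?case using gen
        by (auto simp: homog_part_homog intro: ring_ideal.intros)
    qed (simp_all add: homog_part_add ring_ideal.zero ring_ideal.add distrib_left)
  qed (simp_all add: homog_part_add ring_ideal.zero ring_ideal.add distrib_right)
qed (simp_all add: homog_part_add ring_ideal.intros)

lemma op_graded_abs:
  assumes "\<alpha> \<in> op_graded k" shows "\<exists>p\<in>homog k. \<alpha> = abs_op_alg p"
  using assms unfolding op_graded_def
proof (induction rule: op.span_induct_alt)
  case base
  show ?case by (rule bexI [of _ 0]) (simp_all add: zero_op_alg.abs_eq homog_zero)
next
  case (step c x y)
  then obtain w p where "x = op_word w" "index_count w = k" "p \<in> homog k" "y = abs_op_alg p"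
    by auto
  then show ?case
    by (intro bexI [of _ "pscale c (Poly_Mapping.single w 1) + p"])
       (simp_all add: op_word.abs_eq op_scale.abs_eq plus_op_alg.abs_eq homog_add homog_single)
qed

lemma ell_eq:
  assumes "\<alpha> \<noteq> 0" "\<alpha> \<in> op_graded k" shows "ell \<alpha> = k"
  unfolding ell_def
proof (rule the_equality)
  show "\<alpha> \<in> op_graded k" by fact
  fix j assume "\<alpha> \<in> op_graded j"
  then obtain q where q: "q \<in> homog j" "\<alpha> = abs_op_alg q" using op_graded_abs by blast
  obtain p where p: "p \<in> homog k" "\<alpha> = abs_op_alg p" using op_graded_abs assms by blast
  have "p - q \<in> ring_ideal op_relations" using p q op_alg.abs_eq_iff by metis
  from homog_part_ideal [OF this, of k] show "j = k"
    using assms(1) p q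
    by (auto simp: homog_part_diff homog_part_homog zero_op_alg.abs_eq op_alg.abs_eq_iff split: if_splits)
qed


section \<open>The symmetric algebra of SPDE multi-indices\<close>

text \<open>The variables are indexed by all of \<^typ>\<open>'l\<close>; the set of noise types in use enters only
  through \<open>populated\<close> below, which restricts to the variables \<open>z (l, \<alpha>)\<close> with \<open>l\<close> in that set.\<close>

abbreviation free_var :: "'v \<Rightarrow> ('v \<Rightarrow>\<^sub>0 nat) \<Rightarrow>\<^sub>0 'k::field" where
  "free_var v \<equiv> Poly_Mapping.single (Poly_Mapping.single v 1) 1"

inductive_set sym_relations ::
  "(('l \<times> ('i::finite, 'k::field_char_0) op_alg \<Rightarrow>\<^sub>0 nat) \<Rightarrow>\<^sub>0 'k) set" where
  "free_var (l, op_scale c1 \<alpha>1 + op_scale c2 \<alpha>2)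
     - (pscale c1 (free_var (l, \<alpha>1)) + pscale c2 (free_var (l, \<alpha>2))) \<in> sym_relations"

quotient_type (overloaded) ('l, 'i, 'k) sym_alg =
  "('l \<times> ('i::finite, 'k::field_char_0) op_alg \<Rightarrow>\<^sub>0 nat) \<Rightarrow>\<^sub>0 'k" /
  "\<lambda>x y. x - y \<in> ring_ideal sym_relations"
  by (rule ring_ideal_equivp)

lemma single_eq_0_iff: "Poly_Mapping.single a b = 0 \<longleftrightarrow> b = 0"
  by (metis lookup_single_eq lookup_zero single_zero)

lemma sym_relations_lookup_0: "r \<in> sym_relations \<Longrightarrow> Poly_Mapping.lookup r 0 = 0"
  by (erule sym_relations.cases)
     (auto simp: lookup_minus lookup_add lookup_single when_def single_eq_0_iff)

lemma exponent_add_eq_0: "p + q = 0 \<Longrightarrow> p = 0 \<and> q = (0 :: 'a \<Rightarrow>\<^sub>0 nat)"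
  by (auto simp: poly_mapping_eq_iff fun_eq_iff lookup_add)

instantiation sym_alg :: (type, finite, field_char_0) comm_ring_1
begin
lift_definition zero_sym_alg :: "('a, 'b, 'c) sym_alg" is 0 .
lift_definition one_sym_alg :: "('a, 'b, 'c) sym_alg" is 1 .
lift_definition plus_sym_alg :: "('a, 'b, 'c) sym_alg \<Rightarrow> ('a, 'b, 'c) sym_alg \<Rightarrow> ('a, 'b, 'c) sym_alg" is "(+)"
  by (rule ring_ideal_add_cong)
lift_definition uminus_sym_alg :: "('a, 'b, 'c) sym_alg \<Rightarrow> ('a, 'b, 'c) sym_alg" is "uminus"
  by (simp add: ring_ideal_diff_commute)
lift_definition minus_sym_alg :: "('a, 'b, 'c) sym_alg \<Rightarrow> ('a, 'b, 'c) sym_alg \<Rightarrow> ('a, 'b, 'c) sym_alg" is "(-)"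
  by (rule ring_ideal_diff_cong)
lift_definition times_sym_alg :: "('a, 'b, 'c) sym_alg \<Rightarrow> ('a, 'b, 'c) sym_alg \<Rightarrow> ('a, 'b, 'c) sym_alg" is "(*)"
  by (rule ring_ideal_mult_cong)
instance
proof
  show "(0 :: ('a, 'b, 'c) sym_alg) \<noteq> 1"
  proof (transfer, rule notI)
    assume "0 - 1 \<in> ring_ideal (sym_relations :: (('a \<times> ('b, 'c) op_alg \<Rightarrow>\<^sub>0 nat) \<Rightarrow>\<^sub>0 'c) set)"
    from ring_ideal_lookup_0 [OF exponent_add_eq_0 sym_relations_lookup_0 this] show False
      by simp
  qed
qed (transfer, simp add: algebra_simps ring_ideal.zero)+
end

lift_definition sym_scale :: "'k::field_char_0 \<Rightarrow> ('l, 'i::finite, 'k) sym_alg \<Rightarrow> ('l, 'i, 'k) sym_alg"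
  is pscale
  by (simp add: ring_ideal_pscale flip: pm.scale_right_diff_distrib)

interpretation sym: vector_space sym_scale
  by unfold_locales
     (transfer, simp add: algebra_simps ring_ideal.zero pm.scale_right_distrib pm.scale_left_distrib)+

definition zvar :: "'l \<times> ('i::finite, 'k::field_char_0) op_alg \<Rightarrow> ('l, 'i, 'k) sym_alg" where
  "zvar v = abs_sym_alg (free_var v)"

definition zmonom :: "('l \<times> ('i::finite, 'k::field_char_0) op_alg \<Rightarrow>\<^sub>0 nat) \<Rightarrow> ('l, 'i, 'k) sym_alg" where
  "zmonom \<beta> = (\<Prod>v\<in>Poly_Mapping.keys \<beta>. zvar v ^ Poly_Mapping.lookup \<beta> v)"

text \<open>The zero element is homogeneous of every degree, but \<open>zvar (l, 0) = 0\<close>, so the condition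
  \<open>\<alpha> \<noteq> 0\<close> only discards monomials that vanish.\<close>

definition populated :: "'l set \<Rightarrow> ('l \<times> ('i::finite, 'k::field_char_0) op_alg \<Rightarrow>\<^sub>0 nat) \<Rightarrow> bool" where
  "populated L \<beta> \<longleftrightarrow>
     (\<forall>(l, \<alpha>) \<in> Poly_Mapping.keys \<beta>. l \<in> L \<and> \<alpha> \<noteq> 0 \<and> (\<exists>k. \<alpha> \<in> op_graded k)) \<and>
     (\<Sum>(l, \<alpha>) \<in> Poly_Mapping.keys \<beta>. (1 - int (ell \<alpha>)) * int (Poly_Mapping.lookup \<beta> (l, \<alpha>))) = 1"

definition populated_space :: "'l set \<Rightarrow> ('l, 'i::finite, 'k::field_char_0) sym_alg set" where
  "populated_space L = sym.span (zmonom ` Collect (populated L))"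

definition derivation :: "(('l, 'i::finite, 'k::field_char_0) sym_alg \<Rightarrow> ('l, 'i, 'k) sym_alg) \<Rightarrow> bool" where
  "derivation D \<longleftrightarrow> Vector_Spaces.linear sym_scale sym_scale D \<and>
     (\<forall>x y. D (x * y) = D x * y + x * D y)"

text \<open>Existence and uniqueness: \<open>sym_D\<close>, \<open>derivation_unique\<close> below.\<close>

definition sym_D :: "'i::finite mindex \<Rightarrow> ('l, 'i, 'k::field_char_0) sym_alg \<Rightarrow> ('l, 'i, 'k) sym_alg" where
  "sym_D n = (THE D. derivation D \<and> (\<forall>l \<alpha>. D (zvar (l, \<alpha>)) = zvar (l, op_index n * \<alpha>)))"

lemma sym_scale_mult_left: "sym_scale c x * y = sym_scale c (x * y)"
  by transfer (simp add: pscale_mult mult.assoc ring_ideal.zero)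

lemma sym_scale_mult_right: "x * sym_scale c y = sym_scale c (x * y)"
  by (metis sym_scale_mult_left mult.commute)

lemma free_var_power: "free_var v ^ n = Poly_Mapping.single (Poly_Mapping.single v n) (1 :: 'k::field)"
  by (induction n) (simp_all add: mult_single flip: single_add)

lemma single_sum_exponent:
  "finite A \<Longrightarrow> (\<Prod>v\<in>A. Poly_Mapping.single (f v) (1 :: 'k::field)) =
     Poly_Mapping.single (\<Sum>v\<in>A. f v :: 'a::comm_monoid_add) 1"
  by (induction rule: finite_induct) (simp_all add: mult_single)

lemma abs_sym_power: "abs_sym_alg p ^ n = abs_sym_alg (p ^ n)"
  by (induction n) (simp_all add: one_sym_alg.abs_eq times_sym_alg.abs_eq)

lemma abs_sym_prod: "finite A \<Longrightarrow> (\<Prod>v\<in>A. abs_sym_alg (f v)) = abs_sym_alg (\<Prod>v\<in>A. f v)"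
  by (induction rule: finite_induct) (simp_all add: one_sym_alg.abs_eq times_sym_alg.abs_eq)

lemma zmonom_abs: "zmonom \<beta> = abs_sym_alg (Poly_Mapping.single \<beta> 1)"
  by (simp add: zmonom_def zvar_def abs_sym_power abs_sym_prod free_var_power single_sum_exponent
      del: One_nat_def flip: poly_mapping_expand)

lemma abs_sym_lin_ext: "abs_sym_alg p = lin_ext sym_scale zmonom p"
  by (induction p rule: poly_mapping_single_induct)
     (simp_all add: sym.lin_ext_add zmonom_abs sym_scale.abs_eq
       flip: zero_sym_alg.abs_eq plus_sym_alg.abs_eq)

lemma sym_alg_cases: obtains p where "x = abs_sym_alg p"
  by (rule that, rule Quotient3_abs_rep [OF Quotient3_sym_alg, symmetric])

lemma zvar_linear:
  "zvar (l, op_scale c1 \<alpha>1 + op_scale c2 \<alpha>2) = sym_scale c1 (zvar (l, \<alpha>1)) + sym_scale c2 (zvar (l, \<alpha>2))"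
  unfolding zvar_def sym_scale.abs_eq plus_sym_alg.abs_eq sym_alg.abs_eq_iff
  by (intro ring_ideal_base sym_relations.intros)

lemma zmonom_add: "zmonom (\<beta> + \<gamma>) = zmonom \<beta> * zmonom \<gamma>"
  by (simp add: zmonom_abs times_sym_alg.abs_eq mult_single)

definition zmonom_deriv ::
  "('l \<times> ('i, 'k) op_alg \<Rightarrow> ('l, 'i, 'k) sym_alg) \<Rightarrow>
   ('l \<times> ('i::finite, 'k::field_char_0) op_alg \<Rightarrow>\<^sub>0 nat) \<Rightarrow> ('l, 'i, 'k) sym_alg" where
  "zmonom_deriv g \<beta> = (\<Sum>v\<in>Poly_Mapping.keys \<beta>.
     of_nat (Poly_Mapping.lookup \<beta> v) * zvar v ^ (Poly_Mapping.lookup \<beta> v - 1) * g v *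
     (\<Prod>w\<in>Poly_Mapping.keys \<beta> - {v}. zvar w ^ Poly_Mapping.lookup \<beta> w))"

lemma zmonom_superset:
  assumes "finite K" "Poly_Mapping.keys \<beta> \<subseteq> K"
  shows "zmonom \<beta> = (\<Prod>v\<in>K. zvar v ^ Poly_Mapping.lookup \<beta> v)"
  unfolding zmonom_def using assms
  by (intro prod.mono_neutral_left ballI) (auto simp del: split_paired_All simp: not_in_keys_iff_lookup_eq_zero)

lemma zmonom_deriv_superset:
  assumes "finite K" "Poly_Mapping.keys \<beta> \<subseteq> K"
  shows "zmonom_deriv g \<beta> = (\<Sum>v\<in>K.
     of_nat (Poly_Mapping.lookup \<beta> v) * zvar v ^ (Poly_Mapping.lookup \<beta> v - 1) * g v *
     (\<Prod>w\<in>K - {v}. zvar w ^ Poly_Mapping.lookup \<beta> w))"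
proof -
  have "(\<Prod>w\<in>Poly_Mapping.keys \<beta> - {v}. zvar w ^ Poly_Mapping.lookup \<beta> w) =
    (\<Prod>w\<in>K - {v}. zvar w ^ Poly_Mapping.lookup \<beta> w)" for v
    using assms
    by (intro prod.mono_neutral_left ballI) (auto simp: not_in_keys_iff_lookup_eq_zero)
  then show ?thesis
    unfolding zmonom_deriv_def using assms
    by (simp only:, intro sum.mono_neutral_left ballI) (auto simp: not_in_keys_iff_lookup_eq_zero)
qed

lemma power_deriv_add:
  "of_nat (a + b) * x ^ (a + b - 1) =
    (of_nat a * x ^ (a - 1)) * x ^ b + x ^ a * (of_nat b * x ^ (b - 1))"
  for x :: "'a::comm_ring_1"
  by (cases a; cases b) (simp_all add: algebra_simps power_add)

lemma zmonom_deriv_add: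
  "zmonom_deriv g (\<beta> + \<gamma>) = zmonom_deriv g \<beta> * zmonom \<gamma> + zmonom \<beta> * zmonom_deriv g \<gamma>"
proof -
  define K where "K = Poly_Mapping.keys \<beta> \<union> Poly_Mapping.keys \<gamma>"
  have K: "finite K" "Poly_Mapping.keys \<beta> \<subseteq> K" "Poly_Mapping.keys \<gamma> \<subseteq> K"
      "Poly_Mapping.keys (\<beta> + \<gamma>) \<subseteq> K"
    using keys_add [of \<beta> \<gamma>] by (auto simp: K_def)
  let ?P = "\<lambda>\<beta> v. \<Prod>w\<in>K - {v}. zvar w ^ Poly_Mapping.lookup \<beta> w"
  let ?d = "\<lambda>\<beta> v. of_nat (Poly_Mapping.lookup \<beta> v) * zvar v ^ (Poly_Mapping.lookup \<beta> v - 1)"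
  have m: "zmonom \<beta> = zvar v ^ Poly_Mapping.lookup \<beta> v * ?P \<beta> v"
    if "v \<in> K" "Poly_Mapping.keys \<beta> \<subseteq> K" for v \<beta>
    unfolding zmonom_superset [OF K(1) that(2)] by (rule prod.remove [OF K(1) that(1)])
  have "?d (\<beta> + \<gamma>) v * g v * ?P (\<beta> + \<gamma>) v =
      (?d \<beta> v * g v * ?P \<beta> v) * zmonom \<gamma> + zmonom \<beta> * (?d \<gamma> v * g v * ?P \<gamma> v)"
    if v: "v \<in> K" for v
    unfolding m [OF v K(2)] m [OF v K(3)]
    by (simp only: lookup_add power_add prod.distrib power_deriv_add) (simp add: algebra_simps)
  then show ?thesis
    by (simp add: zmonom_deriv_superset [OF K(1) K(2)] zmonom_deriv_superset [OF K(1) K(3)]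
        zmonom_deriv_superset [OF K(1) K(4)] sum.distrib sum_distrib_left sum_distrib_right)
qed

lemma lin_ext_zmonom_deriv_mult:
  "lin_ext sym_scale (zmonom_deriv g) (p * q) =
     lin_ext sym_scale (zmonom_deriv g) p * abs_sym_alg q +
     abs_sym_alg p * lin_ext sym_scale (zmonom_deriv g) q"
proof (induction p rule: poly_mapping_single_induct)
  case (monom k c)
  show ?case
  proof (induction q rule: poly_mapping_single_induct)
    case (monom k' d)
    then show ?case
      by (simp add: abs_sym_lin_ext mult_single zmonom_deriv_add sym_scale_mult_left
          sym_scale_mult_right sym.scale_right_distrib mult.commute)
  qed (simp_all add: abs_sym_lin_ext sym.lin_ext_add algebra_simps)
qed (simp_all add: abs_sym_lin_ext sym.lin_ext_add algebra_simps)

lemma zmonom_deriv_var: "zmonom_deriv g (Poly_Mapping.single v 1) = g v"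
  by (simp add: zmonom_deriv_def)

lemma derivation_exists: "\<exists>D. derivation D \<and> (\<forall>l \<alpha>. D (zvar (l, \<alpha>)) = zvar (l, op_index n * \<alpha>))"
proof -
  define g :: "'a \<times> ('b, 'c) op_alg \<Rightarrow> ('a, 'b, 'c) sym_alg"
    where "g = (\<lambda>(l, \<alpha>). zvar (l, op_index n * \<alpha>))"
  define d where "d = lin_ext sym_scale (zmonom_deriv g)"
  have "d x = 0" if "x \<in> ring_ideal sym_relations" for x
    using that
  proof (induction rule: ring_ideal.induct)
    case (gen r a b)
    have "abs_sym_alg r = 0"
      unfolding zero_sym_alg.abs_eq sym_alg.abs_eq_iff using gen by (simp add: ring_ideal_base)
    moreover have "d r = 0"
      using gen
    proof (induction rule: sym_relations.induct)
      case (1 l c1 \<alpha>1 c2 \<alpha>2)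
      have "op_index n * (op_scale c1 \<alpha>1 + op_scale c2 \<alpha>2) =
          op_scale c1 (op_index n * \<alpha>1) + op_scale c2 (op_index n * \<alpha>2)"
        by (simp add: distrib_left op_scale_mult_right)
      then show ?case
        by (simp add: d_def g_def sym.lin_ext_diff sym.lin_ext_add zmonom_deriv_var zvar_linear
            del: One_nat_def)
    qed
    ultimately show ?case
      by (simp add: d_def lin_ext_zmonom_deriv_mult flip: times_sym_alg.abs_eq)
  qed (simp_all add: d_def sym.lin_ext_add)
  note d_ideal = this
  have d_eq: "d p = d q" if "abs_sym_alg p = abs_sym_alg q" for p q
    using d_ideal [OF that [unfolded sym_alg.abs_eq_iff]] by (simp add: d_def sym.lin_ext_diff)
  define D where "D x = d (rep_sym_alg x)" for x
  have D: "D (abs_sym_alg p) = d p" for p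
    unfolding D_def by (rule d_eq) (rule Quotient3_abs_rep [OF Quotient3_sym_alg])
  have "derivation D"
    unfolding derivation_def Vector_Spaces.linear_iff
  proof (intro conjI allI sym.vector_space_axioms)
    fix x y :: "('a, 'b, 'c) sym_alg" and c
    obtain p where p: "x = abs_sym_alg p" by (rule sym_alg_cases)
    obtain q where q: "y = abs_sym_alg q" by (rule sym_alg_cases)
    show "D (x + y) = D x + D y" "D (sym_scale c x) = sym_scale c (D x)"
      "D (x * y) = D x * y + x * D y"
      by (simp_all add: p q D plus_sym_alg.abs_eq times_sym_alg.abs_eq sym_scale.abs_eq d_def
          sym.lin_ext_add sym.lin_ext_pscale lin_ext_zmonom_deriv_mult)
  qed
  moreover have "D (zvar (l, \<alpha>)) = zvar (l, op_index n * \<alpha>)" for l \<alpha>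
  proof -
    have "D (zvar (l, \<alpha>)) = d (free_var (l, \<alpha>))" by (simp add: zvar_def D)
    then show ?thesis by (simp add: d_def zmonom_deriv_var g_def del: One_nat_def)
  qed
  ultimately show ?thesis by blast
qed

lemma derivation_unique:
  assumes "derivation D" "derivation E" "\<And>v. D (zvar v) = E (zvar v)"
  shows "D = E"
proof
  have add: "F (x + y) = F x + F y" and sc: "F (sym_scale c x) = sym_scale c (F x)"
    and mu: "F (x * y) = F x * y + x * F y" if "derivation F" for F x y c
    using that by (auto simp: derivation_def Vector_Spaces.linear_iff)
  have one: "F 1 = 0" if "derivation F" for F
    using mu [OF that, of 1 1] by simp
  have zero: "F 0 = 0" if "derivation F" for F
    using add [OF that, of 0 0] by simp
  note DE = add [OF assms(1)] add [OF assms(2)] sc [OF assms(1)] sc [OF assms(2)]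
    mu [OF assms(1)] mu [OF assms(2)] one [OF assms(1)] one [OF assms(2)]
    zero [OF assms(1)] zero [OF assms(2)]
  have pow: "D (zvar v ^ n) = E (zvar v ^ n)" for v n
    by (induction n) (simp_all add: DE assms(3))
  have "D (\<Prod>v\<in>A. zvar v ^ f v) = E (\<Prod>v\<in>A. zvar v ^ f v)" if "finite A" for A f
    using that by (induction rule: finite_induct) (simp_all add: DE pow)
  then have mon: "D (zmonom \<beta>) = E (zmonom \<beta>)" for \<beta> by (simp add: zmonom_def)
  have "D (abs_sym_alg p) = E (abs_sym_alg p)" for p
    by (induction p rule: poly_mapping_single_induct)
       (simp_all add: abs_sym_lin_ext sym.lin_ext_add DE mon)
  then show "D x = E x" for x by (cases x rule: sym_alg_cases) simp
qed

lemma sym_D: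
  fixes n :: "'i::finite mindex" and \<alpha> :: "('i, 'k::field_char_0) op_alg" and l :: 'l
  shows "derivation (sym_D n :: ('l, 'i, 'k) sym_alg \<Rightarrow> _)"
    and "sym_D n (zvar (l, \<alpha>)) = zvar (l, op_index n * \<alpha>)"
proof -
  have "\<exists>!D :: ('l, 'i, 'k) sym_alg \<Rightarrow> _. derivation D \<and> (\<forall>l \<alpha>. D (zvar (l, \<alpha>)) = zvar (l, op_index n * \<alpha>))"
  proof (rule ex_ex1I)
    fix D E :: "('l, 'i, 'k) sym_alg \<Rightarrow> ('l, 'i, 'k) sym_alg"
    assume *: "derivation D \<and> (\<forall>l \<alpha>. D (zvar (l, \<alpha>)) = zvar (l, op_index n * \<alpha>))"
      "derivation E \<and> (\<forall>l \<alpha>. E (zvar (l, \<alpha>)) = zvar (l, op_index n * \<alpha>))"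
    show "D = E"
    proof (rule derivation_unique)
      fix v :: "'l \<times> ('i, 'k) op_alg"
      show "D (zvar v) = E (zvar v)" using * by (cases v) simp
    qed (use * in blast)+
  qed (rule derivation_exists)
  from theI' [OF this] show "derivation (sym_D n :: ('l, 'i, 'k) sym_alg \<Rightarrow> _)"
    "sym_D n (zvar (l, \<alpha>)) = zvar (l, op_index n * \<alpha>)"
    unfolding sym_D_def by blast+
qed

definition sym_prod :: "'i::finite mindex \<Rightarrow>
    ('l, 'i, 'k::field_char_0) sym_alg \<Rightarrow> ('l, 'i, 'k) sym_alg \<Rightarrow> ('l, 'i, 'k) sym_alg" where
  "sym_prod n x y = x * sym_D n y"


section \<open>Multi-Novikov algebras\<close>

text \<open>The carrier \<open>V\<close> is a subspace of the ambient vector space; the index set of the products is the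
  whole type \<^typ>\<open>'a\<close>, and nothing is assumed about \<open>pr\<close> outside \<open>V\<close>.\<close>

locale multi_novikov_algebra = vector_space scale
  for scale :: "'k::field \<Rightarrow> 'v::ab_group_add \<Rightarrow> 'v" +
  fixes V :: "'v set" and pr :: "'a \<Rightarrow> 'v \<Rightarrow> 'v \<Rightarrow> 'v"
  assumes subspace: "subspace V"
    and closed: "x \<in> V \<Longrightarrow> y \<in> V \<Longrightarrow> pr a x y \<in> V"
    and add_left: "x \<in> V \<Longrightarrow> y \<in> V \<Longrightarrow> z \<in> V \<Longrightarrow> pr a (x + y) z = pr a x z + pr a y z"
    and add_right: "x \<in> V \<Longrightarrow> y \<in> V \<Longrightarrow> z \<in> V \<Longrightarrow> pr a x (y + z) = pr a x y + pr a x z"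
    and scale_left: "x \<in> V \<Longrightarrow> y \<in> V \<Longrightarrow> pr a (scale c x) y = scale c (pr a x y)"
    and scale_right: "x \<in> V \<Longrightarrow> y \<in> V \<Longrightarrow> pr a x (scale c y) = scale c (pr a x y)"
    and left_symmetric: "x \<in> V \<Longrightarrow> y \<in> V \<Longrightarrow> z \<in> V \<Longrightarrow>
      pr b (pr a x y) z - pr a x (pr b y z) = pr b (pr a y x) z - pr a y (pr b x z)"
    and index_symmetric: "x \<in> V \<Longrightarrow> y \<in> V \<Longrightarrow> z \<in> V \<Longrightarrow>
      pr b (pr a x y) z - pr a x (pr b y z) = pr a (pr b x y) z - pr b x (pr a y z)"
    and right_commutative: "x \<in> V \<Longrightarrow> y \<in> V \<Longrightarrow> z \<in> V \<Longrightarrow>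
      pr b (pr a x y) z = pr a (pr b x z) y"

definition mn_hom where
  "mn_hom scale V pr scale' V' pr' \<phi> \<longleftrightarrow>
     (\<forall>x\<in>V. \<phi> x \<in> V') \<and>
     (\<forall>x\<in>V. \<forall>y\<in>V. \<phi> (x + y) = \<phi> x + \<phi> y) \<and>
     (\<forall>c. \<forall>x\<in>V. \<phi> (scale c x) = scale' c (\<phi> x)) \<and>
     (\<forall>a. \<forall>x\<in>V. \<forall>y\<in>V. \<phi> (pr a x y) = pr' a (\<phi> x) (\<phi> y))"

definition mn_isomorphic where
  "mn_isomorphic scale V pr scale' V' pr' \<longleftrightarrow>
     multi_novikov_algebra scale V pr \<and> multi_novikov_algebra scale' V' pr' \<and>
     (\<exists>\<phi>. mn_hom scale V pr scale' V' pr' \<phi> \<and> bij_betw \<phi> V V')"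


section \<open>The free multi-Novikov algebra\<close>

datatype ('a, gens: 'g) mterm = Gen 'g | Prod 'a "('a, 'g) mterm" "('a, 'g) mterm"

definition free_prod :: "'a \<Rightarrow> (('a, 'g) mterm \<Rightarrow>\<^sub>0 'k::field) \<Rightarrow> (('a, 'g) mterm \<Rightarrow>\<^sub>0 'k) \<Rightarrow> (('a, 'g) mterm \<Rightarrow>\<^sub>0 'k)" where
  "free_prod a p q =
     lin_ext pscale (\<lambda>s. lin_ext pscale (\<lambda>t. Poly_Mapping.single (Prod a s t) 1) q) p"

inductive_set novikov_ideal :: "(('a, 'g) mterm \<Rightarrow>\<^sub>0 'k::field) set" where
  zero: "0 \<in> novikov_ideal"
| add: "x \<in> novikov_ideal \<Longrightarrow> y \<in> novikov_ideal \<Longrightarrow> x + y \<in> novikov_ideal"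
| scale: "x \<in> novikov_ideal \<Longrightarrow> pscale c x \<in> novikov_ideal"
| prod_left: "x \<in> novikov_ideal \<Longrightarrow> free_prod a y x \<in> novikov_ideal"
| prod_right: "x \<in> novikov_ideal \<Longrightarrow> free_prod a x y \<in> novikov_ideal"
| left_symmetric:
    "(free_prod b (free_prod a x y) z - free_prod a x (free_prod b y z))
       - (free_prod b (free_prod a y x) z - free_prod a y (free_prod b x z)) \<in> novikov_ideal"
| index_symmetric:
    "(free_prod b (free_prod a x y) z - free_prod a x (free_prod b y z))
       - (free_prod a (free_prod b x y) z - free_prod b x (free_prod a y z)) \<in> novikov_ideal"
| right_commutative:
    "free_prod b (free_prod a x y) z - free_prod a (free_prod b x z) y \<in> novikov_ideal"

lemma free_prod_single [simp]:
  "free_prod a (Poly_Mapping.single s c) (Poly_Mapping.single t d) = Poly_Mapping.single (Prod a s t) (c * d)"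
  by (simp add: free_prod_def)

lemma free_prod_add_left: "free_prod a (x + y) z = free_prod a x z + free_prod a y z"
  by (simp add: free_prod_def pm.lin_ext_add)

lemma free_prod_0_left [simp]: "free_prod a 0 z = 0"
  by (simp add: free_prod_def)

lemma free_prod_0_right [simp]: "free_prod a x 0 = 0"
  by (simp add: free_prod_def lin_ext_def)

lemma free_prod_add_right: "free_prod a x (y + z) = free_prod a x y + free_prod a x z"
  by (induction x rule: poly_mapping_single_induct)
     (simp_all add: free_prod_add_left, simp add: free_prod_def pm.lin_ext_add pm.scale_right_distrib)

lemma free_prod_scale_left: "free_prod a (pscale c x) y = pscale c (free_prod a x y)"
  by (simp add: free_prod_def pm.lin_ext_pscale)

lemma free_prod_scale_right: "free_prod a x (pscale c y) = pscale c (free_prod a x y)"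
  by (induction x rule: poly_mapping_single_induct)
     (simp_all add: free_prod_add_left pm.scale_right_distrib,
      simp add: free_prod_def pm.lin_ext_pscale pm.scale_left_commute)

lemma free_prod_diff_left: "free_prod a (x - y) z = free_prod a x z - free_prod a y z"
  by (simp add: free_prod_def pm.lin_ext_diff)

lemma free_prod_diff_right: "free_prod a x (y - z) = free_prod a x y - free_prod a x z"
  using free_prod_add_right [of a x "y - z" z] by simp

lemma novikov_ideal_uminus: "x \<in> novikov_ideal \<Longrightarrow> - x \<in> novikov_ideal"
  using novikov_ideal.scale [of x "-1"] by simp

lemma novikov_ideal_diff: "x \<in> novikov_ideal \<Longrightarrow> y \<in> novikov_ideal \<Longrightarrow> x - y \<in> novikov_ideal"
  using novikov_ideal.add [of x "- y"] novikov_ideal_uminus by fastforce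

lemma novikov_ideal_diff_commute: "x - y \<in> novikov_ideal \<Longrightarrow> y - x \<in> novikov_ideal"
  using novikov_ideal_uminus by fastforce

lemma novikov_ideal_add_cong:
  assumes "x - x' \<in> novikov_ideal" "y - y' \<in> novikov_ideal"
  shows "(x + y) - (x' + y') \<in> novikov_ideal"
  using novikov_ideal.add [OF assms] by (simp add: add_diff_add)

lemma novikov_ideal_diff_cong:
  assumes "x - x' \<in> novikov_ideal" "y - y' \<in> novikov_ideal"
  shows "(x - y) - (x' - y') \<in> novikov_ideal"
proof -
  have "(x - y) - (x' - y') = (x - x') - (y - y')" by simp
  then show ?thesis using novikov_ideal_diff [OF assms] by (simp only:)
qed

quotient_type (overloaded) ('a, 'g, 'k) free_novikov =
  "('a, 'g) mterm \<Rightarrow>\<^sub>0 'k::field" / "\<lambda>x y. x - y \<in> novikov_ideal"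
proof (rule equivpI)
  show "reflp (\<lambda>x y :: ('a, 'g) mterm \<Rightarrow>\<^sub>0 'k. x - y \<in> novikov_ideal)"
    by (rule reflpI) (simp add: novikov_ideal.zero)
  show "symp (\<lambda>x y :: ('a, 'g) mterm \<Rightarrow>\<^sub>0 'k. x - y \<in> novikov_ideal)"
    by (rule sympI) (rule novikov_ideal_diff_commute)
  show "transp (\<lambda>x y :: ('a, 'g) mterm \<Rightarrow>\<^sub>0 'k. x - y \<in> novikov_ideal)"
    by (rule transpI) (use novikov_ideal.add in fastforce)
qed

instantiation free_novikov :: (type, type, field) ab_group_add
begin
lift_definition zero_free_novikov :: "('a, 'b, 'c) free_novikov" is 0 .
lift_definition plus_free_novikov :: "('a, 'b, 'c) free_novikov \<Rightarrow> ('a, 'b, 'c) free_novikov \<Rightarrow> ('a, 'b, 'c) free_novikov" is "(+)"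
  by (rule novikov_ideal_add_cong)
lift_definition uminus_free_novikov :: "('a, 'b, 'c) free_novikov \<Rightarrow> ('a, 'b, 'c) free_novikov" is "uminus"
  by (simp add: novikov_ideal_diff_commute)
lift_definition minus_free_novikov :: "('a, 'b, 'c) free_novikov \<Rightarrow> ('a, 'b, 'c) free_novikov \<Rightarrow> ('a, 'b, 'c) free_novikov" is "(-)"
  by (rule novikov_ideal_diff_cong)
instance
  by standard (transfer, simp add: algebra_simps novikov_ideal.zero)+
end

lift_definition fn_scale :: "'k::field \<Rightarrow> ('a, 'g, 'k) free_novikov \<Rightarrow> ('a, 'g, 'k) free_novikov"
  is pscale
  by (simp add: novikov_ideal.scale flip: pm.scale_right_diff_distrib)

lift_definition fn_prod ::
  "'a \<Rightarrow> ('a, 'g, 'k::field) free_novikov \<Rightarrow> ('a, 'g, 'k) free_novikov \<Rightarrow> ('a, 'g, 'k) free_novikov"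
  is free_prod
proof -
  fix a :: 'a and x x' y y' :: "('a, 'g) mterm \<Rightarrow>\<^sub>0 'k"
  assume *: "x - x' \<in> novikov_ideal" "y - y' \<in> novikov_ideal"
  have "free_prod a x y - free_prod a x' y' = free_prod a (x - x') y + free_prod a x' (y - y')"
    by (simp add: free_prod_diff_left free_prod_diff_right)
  then show "free_prod a x y - free_prod a x' y' \<in> novikov_ideal"
    using * by (auto intro: novikov_ideal.intros)
qed

interpretation fn: vector_space fn_scale
  by unfold_locales
     (transfer, simp add: algebra_simps novikov_ideal.zero pm.scale_right_distrib pm.scale_left_distrib)+

lift_definition fn_term :: "('a, 'g) mterm \<Rightarrow> ('a, 'g, 'k::field) free_novikov"
  is "\<lambda>t. Poly_Mapping.single t 1" .

text \<open>\<^typ>\<open>('a, 'g, 'k) free_novikov\<close> has all of \<^typ>\<open>'g\<close> as generators. For a set \<open>G\<close> of generators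
  its subspace spanned by the products of elements of \<open>G\<close> is the free algebra generated by \<open>G\<close>: the
  universal property, with an arbitrary multi-Novikov algebra as target, is
  \<open>free_novikov_universal\<close> below.\<close>

definition free_novikov_on :: "'g set \<Rightarrow> ('a, 'g, 'k::field) free_novikov set" where
  "free_novikov_on G = fn.span (fn_term ` {t. gens t \<subseteq> G})"

lemma free_novikov_on_subspace: "fn.subspace (free_novikov_on G)"
  by (simp add: free_novikov_on_def)

lemma fn_term_in: "gens t \<subseteq> G \<Longrightarrow> fn_term t \<in> free_novikov_on G"
  unfolding free_novikov_on_def by (rule fn.span_base) simp

lemma free_novikov_on_induct [consumes 1, case_names zero step]:
  assumes "x \<in> free_novikov_on G" "P 0"
    and "\<And>c t y. gens t \<subseteq> G \<Longrightarrow> y \<in> free_novikov_on G \<Longrightarrow> P y \<Longrightarrow> P (fn_scale c (fn_term t) + y)"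
  shows "P x"
proof -
  have "x \<in> fn.span (fn_term ` {t. gens t \<subseteq> G})"
    using assms(1) by (simp add: free_novikov_on_def)
  then have "x \<in> free_novikov_on G \<and> P x"
  proof (induction rule: fn.span_induct_alt)
    case base
    show ?case using assms(2) fn.subspace_0 [OF free_novikov_on_subspace] by blast
  next
    case (step c x y)
    then obtain t where t: "x = fn_term t" "gens t \<subseteq> G" by auto
    have "fn_scale c x + y \<in> free_novikov_on G"
      using step t fn_term_in [OF t(2)]
      by (intro fn.subspace_add [OF free_novikov_on_subspace]
          fn.subspace_scale [OF free_novikov_on_subspace]) auto
    then show ?case using step t assms(3) by blast
  qed
  then show ?thesis ..
qed

lemma fn_term_Prod: "fn_prod a (fn_term s) (fn_term t) = fn_term (Prod a s t)"
  by transfer (simp add: novikov_ideal.zero)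

lemma multi_novikov_UNIV:
  "multi_novikov_algebra fn_scale (UNIV :: ('a, 'g, 'k::field) free_novikov set) fn_prod"
proof (unfold_locales, goal_cases)
  case 1 show ?case by (rule fn.subspace_UNIV)
next
  case 3 show ?case by transfer (simp add: free_prod_add_left novikov_ideal.zero)
next
  case 4 show ?case by transfer (simp add: free_prod_add_right novikov_ideal.zero)
next
  case 5 show ?case by transfer (simp add: free_prod_scale_left novikov_ideal.zero)
next
  case 6 show ?case by transfer (simp add: free_prod_scale_right novikov_ideal.zero)
next
  case 7 show ?case by transfer (rule novikov_ideal.left_symmetric)
next
  case 8 show ?case by transfer (rule novikov_ideal.index_symmetric)
next
  case 9 show ?case by transfer (rule novikov_ideal.right_commutative)
qed simp

interpretation fnu: multi_novikov_algebra fn_scale "UNIV :: ('a, 'g, 'k::field) free_novikov set" fn_prod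
  by (rule multi_novikov_UNIV)

lemma fn_prod_0 [simp]: "fn_prod a 0 x = 0" "fn_prod a x 0 = 0"
  using fnu.add_left [of 0 0 x a] fnu.add_right [of x 0 0 a] by simp_all

lemma free_novikov_on_closed:
  assumes "x \<in> free_novikov_on G" "y \<in> free_novikov_on G"
  shows "fn_prod a x y \<in> free_novikov_on G"
proof -
  note sub = fn.subspace_add [OF free_novikov_on_subspace]
    fn.subspace_scale [OF free_novikov_on_subspace] fn.subspace_0 [OF free_novikov_on_subspace]
  have 1: "fn_prod a (fn_term s) y \<in> free_novikov_on G" if "gens s \<subseteq> G" for s
    using assms(2)
  proof (induction rule: free_novikov_on_induct)
    case zero then show ?case by (simp add: sub)
  next
    case (step c t y)
    have "fn_scale c (fn_term (Prod a s t)) \<in> free_novikov_on G"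
      using that step by (intro sub fn_term_in) simp
    then show ?case using step
      by (simp add: fnu.add_right fnu.scale_right fn_term_Prod sub)
  qed
  show ?thesis
    using assms(1)
  proof (induction rule: free_novikov_on_induct)
    case zero then show ?case by (simp add: sub)
  next
    case (step c t y)
    then show ?case using 1 by (simp add: fnu.add_left fnu.scale_left sub)
  qed
qed

lemma multi_novikov_free_novikov_on:
  "multi_novikov_algebra fn_scale (free_novikov_on G :: ('a, 'g, 'k::field) free_novikov set) fn_prod"
proof (unfold_locales, goal_cases)
  case 1 show ?case by (simp add: free_novikov_on_def)
next
  case 2 then show ?case by (rule free_novikov_on_closed)
qed (rule fnu.add_left fnu.add_right fnu.scale_left fnu.scale_right
  fnu.left_symmetric fnu.index_symmetric fnu.right_commutative UNIV_I)+

primrec mterm_eval :: "('a \<Rightarrow> 'v \<Rightarrow> 'v \<Rightarrow> 'v) \<Rightarrow> ('g \<Rightarrow> 'v) \<Rightarrow> ('a, 'g) mterm \<Rightarrow> 'v" where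
  "mterm_eval pr f (Gen g) = f g"
| "mterm_eval pr f (Prod a s t) = pr a (mterm_eval pr f s) (mterm_eval pr f t)"

context multi_novikov_algebra
begin

lemmas ax_left_symmetric = left_symmetric
lemmas ax_index_symmetric = index_symmetric
lemmas ax_right_commutative = right_commutative

lemma mterm_eval_closed: "(\<And>g. f g \<in> V) \<Longrightarrow> mterm_eval pr f t \<in> V"
  by (induction t) (auto intro: closed)

lemma lin_ext_closed: "(\<And>g. f g \<in> V) \<Longrightarrow> lin_ext scale (mterm_eval pr f) p \<in> V"
  unfolding lin_ext_def
  by (intro subspace_sum subspace subspace_scale mterm_eval_closed) 

lemma pr_0_left: "x \<in> V \<Longrightarrow> pr a 0 x = 0"
  using add_left [of 0 0 x a] subspace by (simp add: subspace_0)

lemma pr_0_right: "x \<in> V \<Longrightarrow> pr a x 0 = 0"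
  using add_right [of x 0 0 a] subspace by (simp add: subspace_0)

lemma lin_ext_prod:
  assumes f: "\<And>g. f g \<in> V"
  shows "lin_ext scale (mterm_eval pr f) (free_prod a p q) =
    pr a (lin_ext scale (mterm_eval pr f) p) (lin_ext scale (mterm_eval pr f) q)"
proof (induction p rule: poly_mapping_single_induct)
  case zero then show ?case by (simp add: pr_0_left lin_ext_closed f)
next
  case (add p p') then show ?case
    by (simp add: free_prod_add_left lin_ext_add add_left lin_ext_closed f)
next
  case (monom s c)
  show ?case
  proof (induction q rule: poly_mapping_single_induct)
    case zero then show ?case 
      using pr_0_right [of "scale c (mterm_eval pr f s)"] subspace
      by (simp add: mterm_eval_closed f subspace_scale)
  next
    case (add q q') then show ?case
      using lin_ext_closed [of f "Poly_Mapping.single s c"] f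
      by (simp add: free_prod_add_right lin_ext_add add_right lin_ext_closed)
  next
    case (monom t d)
    then show ?case using subspace
      by (simp add: scale_left scale_right mterm_eval_closed f subspace_scale)
  qed
qed

lemma lin_ext_novikov_ideal:
  assumes f: "\<And>g. f g \<in> V" and "p \<in> novikov_ideal"
  shows "lin_ext scale (mterm_eval pr f) p = 0"
  using assms(2)
proof (induction rule: novikov_ideal.induct)
  case (left_symmetric b a x y z)
  show ?case using ax_left_symmetric [of "lin_ext scale (mterm_eval pr f) x" "lin_ext scale (mterm_eval pr f) y" "lin_ext scale (mterm_eval pr f) z" b a]
    by (simp add: lin_ext_diff lin_ext_prod lin_ext_closed f)
next
  case (index_symmetric b a x y z)
  show ?case using ax_index_symmetric [of "lin_ext scale (mterm_eval pr f) x" "lin_ext scale (mterm_eval pr f) y" "lin_ext scale (mterm_eval pr f) z" b a]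
    by (simp add: lin_ext_diff lin_ext_prod lin_ext_closed f)
next
  case (right_commutative b a x y z)
  show ?case using ax_right_commutative [of "lin_ext scale (mterm_eval pr f) x" "lin_ext scale (mterm_eval pr f) y" "lin_ext scale (mterm_eval pr f) z" b a]
    by (simp add: lin_ext_diff lin_ext_prod lin_ext_closed f)
qed (simp_all add: lin_ext_add lin_ext_pscale lin_ext_prod f pr_0_left pr_0_right lin_ext_closed)

lemma free_novikov_exists:
  fixes G :: "'g set"
  assumes "\<And>g. g \<in> G \<Longrightarrow> f g \<in> V"
  shows "\<exists>\<phi>. mn_hom fn_scale (free_novikov_on G) fn_prod scale V pr \<phi> \<and>
    (\<forall>g\<in>G. \<phi> (fn_term (Gen g)) = f g)"
proof -
  define h where "h g = (if g \<in> G then f g else 0)" for g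
  have h: "h g \<in> V" for g using assms subspace by (auto simp: h_def subspace_0)
  define \<phi> where "\<phi> x = lin_ext scale (mterm_eval pr h) (rep_free_novikov x)"
    for x :: "('a, 'g, 'k) free_novikov"
  have \<phi>: "\<phi> (abs_free_novikov p) = lin_ext scale (mterm_eval pr h) p" for p
  proof -
    have "rep_free_novikov (abs_free_novikov p) - p \<in> novikov_ideal"
      using Quotient3_abs_rep [OF Quotient3_free_novikov, of "abs_free_novikov p"]
      unfolding free_novikov.abs_eq_iff .
    from lin_ext_novikov_ideal [OF h this] show ?thesis by (simp add: \<phi>_def lin_ext_diff)
  qed
  have abs: "\<exists>p. x = abs_free_novikov p" for x :: "('a, 'g, 'k) free_novikov"
    by (rule exI, rule Quotient3_abs_rep [OF Quotient3_free_novikov, symmetric])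
  have "\<phi> (x + y) = \<phi> x + \<phi> y" for x y
  proof -
    obtain p q where "x = abs_free_novikov p" "y = abs_free_novikov q" using abs by metis
    then show ?thesis by (simp add: \<phi> plus_free_novikov.abs_eq lin_ext_add)
  qed
  moreover have "\<phi> (fn_scale c x) = scale c (\<phi> x)" for c x
  proof -
    obtain p where "x = abs_free_novikov p" using abs by metis
    then show ?thesis by (simp add: \<phi> fn_scale.abs_eq lin_ext_pscale)
  qed
  moreover have "\<phi> (fn_prod a x y) = pr a (\<phi> x) (\<phi> y)" for a x y
  proof -
    obtain p q where "x = abs_free_novikov p" "y = abs_free_novikov q" using abs by metis
    then show ?thesis by (simp add: \<phi> fn_prod.abs_eq lin_ext_prod h)
  qed
  moreover have "\<phi> x \<in> V" for x by (simp add: \<phi>_def lin_ext_closed h)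
  moreover have "\<phi> (fn_term (Gen g)) = h g" for g
    by (simp add: fn_term.abs_eq \<phi>)
  ultimately show ?thesis by (intro exI [of _ \<phi>]) (auto simp: mn_hom_def h_def)
qed

lemma mn_hom_zero:
  fixes \<phi> :: "('a, 'g, 'k) free_novikov \<Rightarrow> 'v"
  assumes "mn_hom fn_scale (free_novikov_on G) fn_prod scale V pr \<phi>"
  shows "\<phi> 0 = 0"
proof -
  have "\<phi> (fn_scale 0 0) = scale 0 (\<phi> 0)"
    using assms fn.subspace_0 [OF free_novikov_on_subspace [of G]] unfolding mn_hom_def by blast
  then show ?thesis by simp
qed

lemma free_novikov_unique:
  fixes G :: "'g set"
  assumes "mn_hom fn_scale (free_novikov_on G) fn_prod scale V pr \<phi>"
    and "mn_hom fn_scale (free_novikov_on G) fn_prod scale V pr \<psi>"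
    and "\<forall>g\<in>G. \<phi> (fn_term (Gen g)) = \<psi> (fn_term (Gen g))"
    and "x \<in> free_novikov_on G"
  shows "\<phi> x = \<psi> x"
proof -
  have 1: "gens t \<subseteq> G \<Longrightarrow> \<phi> (fn_term t) = \<psi> (fn_term t)" for t :: "('a, 'g) mterm"
  proof (induction t)
    case (Gen g) then show ?case using assms(3) by simp
  next
    case (Prod a s t)
    then have st: "fn_term s \<in> free_novikov_on G" "fn_term t \<in> free_novikov_on G"
      by (auto intro: fn_term_in)
    have "\<phi> (fn_prod a (fn_term s) (fn_term t)) = pr a (\<phi> (fn_term s)) (\<phi> (fn_term t))"
      "\<psi> (fn_prod a (fn_term s) (fn_term t)) = pr a (\<psi> (fn_term s)) (\<psi> (fn_term t))"
      using assms(1,2) st unfolding mn_hom_def by blast+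
    then show ?case using Prod by (simp add: fn_term_Prod)
  qed
  have *: "\<phi> (fn_scale c y + z) = scale c (\<phi> y) + \<phi> z"
    if "mn_hom fn_scale (free_novikov_on G) fn_prod scale V pr \<phi>"
      "y \<in> free_novikov_on G" "z \<in> free_novikov_on G" for \<phi> c y z
    using that fn.subspace_scale [OF free_novikov_on_subspace that(2)]
    unfolding mn_hom_def by metis
  from assms(4) show ?thesis
  proof (induction rule: free_novikov_on_induct)
    case zero
    show ?case using mn_hom_zero [OF assms(1)] mn_hom_zero [OF assms(2)] by simp
  next
    case (step c t y)
    then show ?case
      using * [OF assms(1) fn_term_in [OF step(1)] step(2)]
        * [OF assms(2) fn_term_in [OF step(1)] step(2)] 1 [OF step(1)] by simp
  qed
qed

theorem free_novikov_universal:
  assumes "\<And>g. g \<in> G \<Longrightarrow> f g \<in> V"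
  shows "\<exists>\<phi>. mn_hom fn_scale (free_novikov_on G) fn_prod scale V pr \<phi> \<and>
      (\<forall>g\<in>G. \<phi> (fn_term (Gen g)) = f g) \<and>
      (\<forall>\<psi>. mn_hom fn_scale (free_novikov_on G) fn_prod scale V pr \<psi> \<and>
        (\<forall>g\<in>G. \<psi> (fn_term (Gen g)) = f g) \<longrightarrow> (\<forall>x\<in>free_novikov_on G. \<psi> x = \<phi> x))"
proof -
  from free_novikov_exists [of G f, OF assms]
  obtain \<phi> where \<phi>: "mn_hom fn_scale (free_novikov_on G) fn_prod scale V pr \<phi>"
    "\<forall>g\<in>G. \<phi> (fn_term (Gen g)) = f g" by blast
  have "\<psi> x = \<phi> x"
    if "mn_hom fn_scale (free_novikov_on G) fn_prod scale V pr \<psi>"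
      "\<forall>g\<in>G. \<psi> (fn_term (Gen g)) = f g" "x \<in> free_novikov_on G" for \<psi> x
    using free_novikov_unique [OF that(1) \<phi>(1) _ that(3)] \<phi>(2) that(2) by auto
  with \<phi> show ?thesis by blast
qed

end

end

theory Submission
  imports Defs "HOL-Library.Multiset"
begin

text \<open>In a multi-Novikov algebra the right multiplications commute, and monomials
  \<open>u\<^sub>1 \<cdots> u\<^sub>k D\<^sup>A z\<close> with \<open>|A| = k\<close> can be imitated by a brace defined recursively through the
  Leibniz rule. The axioms force this brace to be symmetric in \<open>u\<close> and in \<open>A\<close> and to be linear over
  the commutative algebra \<open>C\<close> generated by the right multiplications; moreover \<open>x \<mapsto> x u\<^sub>2 \<cdots> u\<^sub>k D\<^sup>A z\<close>
  itself belongs to \<open>C\<close>. Hence every populated monomial in the variables \<open>D\<^sup>M g\<close>, with \<open>g\<close> a generator,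
  has a value in the algebra that does not depend on how the monomial is arranged into nested braces, and
  these values span the subalgebra generated by the generators. The canonical morphism from the free
  algebra to multi-indices sends the value of a monomial to that monomial. It is therefore
  surjective onto populated multi-indices, and it is injective because distinct monomials are linearly
  independent. The last point rests on the fact that the words consisting of indices followed by
  derivatives form a basis of the algebra of letters.\<close>

text \<open>The generator (q, l) is sent to z_(l, d^q), where d^q is the product of the powers
  d_i^(q_i). Since D^(n) multiplies the second index by n on the left, the iterated derivatives of
  this generator are the variables z_(l, n_1...n_k d^q); this is why a basis of words with all
  indices in front is wanted. The obstacle is that neither D^M g nor a product of two elements
  exists in an abstract multi-Novikov algebra: D^M g has weight 1 - |M|, and only weight 1 is
  visible. Monomials of weight 0 are therefore represented by operators, and a monomial of weight 1
  by such an operator applied to a root, which is a generator without derivatives. The choice of the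
  root, and of the underived generators grouped with a given D^M g, is arbitrary. Independence of
  these choices is the heart of the argument and reduces to trading two generators through the
  symmetry of the brace. Injectivity comes from a left inverse: expand a multi-index in monomials in
  the D^M g and replace each monomial by its value. All noise types are treated at once; the set of
  those in use matters only for the image.\<close>

text \<open>If the heads \<open>u\<close> and \<open>v\<close> differ, permuting tails brings the
  lists to the forms \<open>u # v # zs\<close> and \<open>v # u # zs\<close>. In the applications
  \<open>tail\<close> is an induction hypothesis, so only one swap has to be computed.\<close>

lemma mset_invariantI:
  assumes swap: "\<And>x y zs. length zs + 2 = n \<Longrightarrow> f (x # y # zs) = f (y # x # zs)"
    and tail: "\<And>x ys zs. length ys + 1 = n \<Longrightarrow> mset ys = mset zs \<Longrightarrow> f (x # ys) = f (x # zs)"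
    and "mset us = mset vs" "length us = n"
  shows "f us = f vs"
proof (cases us)
  case Nil then show ?thesis using assms by simp
next
  case us: (Cons u us')
  then obtain v vs' where vs: "vs = v # vs'" using assms by (cases vs) auto
  show ?thesis
  proof (cases "u = v")
    case True
    then show ?thesis using tail us vs assms(3,4) by simp
  next
    case False
    have "add_mset u (mset us') = add_mset v (mset vs')" using us vs assms by simp
    then obtain M where M: "mset us' = add_mset v M" "mset vs' = add_mset u M"
      using False by (auto simp: add_eq_conv_ex)
    obtain zs where zs: "mset zs = M" using ex_mset by blast
    have len: "length us' = length zs + 1" "length vs' = length zs + 1"
      using M zs by (metis size_add_mset size_mset Suc_eq_plus1)+
    have "f us = f (u # v # zs)" using tail us M zs assms(4) by simp
    also have "\<dots> = f (v # u # zs)" using swap us assms(4) len by simp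
    also have "\<dots> = f vs" using tail vs M zs us len assms(4) by simp
    finally show ?thesis .
  qed
qed

text \<open>Meant for the correction sum in the recursion of the brace: a symmetric \<open>f\<close>
  factors through multisets, and so does the whole sum.\<close>

lemma sum_list_update_mset:
  assumes "\<And>us vs. length us = n \<Longrightarrow> mset us = mset vs \<Longrightarrow> f us = f vs"
    and "mset us = mset vs" "length us = n"
  shows "(\<Sum>i<length us. f (us[i := h (us ! i)])) = (\<Sum>i<length vs. f (vs[i := h (vs ! i)]))"
proof -
  define F where "F M = f (SOME us. mset us = M)" for M
  have F: "f us = F (mset us)" if "length us = n" for us
  proof -
    have "mset (SOME vs. mset vs = mset us) = mset us" by (rule someI [of _ us]) (rule refl)
    then show ?thesis unfolding F_def by (rule assms(1) [OF that sym])
  qed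
  have *: "(\<Sum>i<length us. f (us[i := h (us ! i)])) =
      (\<Sum>x\<in>#mset us. F (add_mset (h x) (mset us - {#x#})))" if "length us = n" for us
  proof -
    have "(\<Sum>i<length us. f (us[i := h (us ! i)])) =
        (\<Sum>i<length us. F (add_mset (h (us ! i)) (mset us - {#us ! i#})))"
      using that by (intro sum.cong refl) (simp add: F mset_update)
    also have "\<dots> = sum_list (map (\<lambda>x. F (add_mset (h x) (mset us - {#x#}))) us)"
      by (simp add: sum_list_sum_nth atLeast0LessThan)
    also have "\<dots> = (\<Sum>x\<in>#mset us. F (add_mset (h x) (mset us - {#x#})))"
      by (simp flip: sum_mset_sum_list)
    finally show ?thesis .
  qed
  have "length vs = n" using mset_eq_length [OF assms(2)] assms(3) by simp
  then show ?thesis using * [of us] * [of vs] assms(2,3) by simp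
qed

section \<open>Braces\<close>

text \<open>The identities hold on the whole symmetric algebra and on the free algebra over a full
  type of generators, so no membership conditions have to be carried along.\<close>

locale total_multi_novikov = multi_novikov_algebra scale UNIV pr
  for scale :: "'k::field \<Rightarrow> 'v::ab_group_add \<Rightarrow> 'v" and pr :: "'a \<Rightarrow> 'v \<Rightarrow> 'v \<Rightarrow> 'v"
begin

lemma pr_add_left: "pr a (x + y) z = pr a x z + pr a y z"
  and pr_add_right: "pr a x (y + z) = pr a x y + pr a x z"
  and pr_scale_left: "pr a (scale c x) y = scale c (pr a x y)"
  and pr_scale_right: "pr a x (scale c y) = scale c (pr a x y)"
  by (auto intro: add_left add_right scale_left scale_right)

lemma pr_zero [simp]: "pr a 0 x = 0" "pr a x 0 = 0"
  by (auto intro: pr_0_left pr_0_right)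

lemma pr_diff_left: "pr a (x - y) z = pr a x z - pr a y z"
  using pr_add_left [of a "x - y" y z] by simp

lemma pr_diff_right: "pr a x (y - z) = pr a x y - pr a x z"
  using pr_add_right [of a x "y - z" z] by simp

lemma pr_sum_left: "pr a (\<Sum>i\<in>I. f i) z = (\<Sum>i\<in>I. pr a (f i) z)"
  by (induction I rule: infinite_finite_induct) (simp_all add: pr_add_left)

lemma pr_sum_right: "pr a x (\<Sum>i\<in>I. f i) = (\<Sum>i\<in>I. pr a x (f i))"
  by (induction I rule: infinite_finite_induct) (simp_all add: pr_add_right)

lemma pr_commute: "pr b (pr a x y) z = pr a (pr b x z) y"
  by (rule right_commutative) auto

text \<open>Models \<open>x * y * D\<^sup>a (D\<^sup>b z)\<close>.\<close>

definition assoc2 :: "'a \<Rightarrow> 'a \<Rightarrow> 'v \<Rightarrow> 'v \<Rightarrow> 'v \<Rightarrow> 'v" where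
  "assoc2 a b z y x = pr a x (pr b y z) - pr b (pr a x y) z"

lemma assoc2_swap_args: "assoc2 a b z y x = assoc2 a b z x y"
  using left_symmetric [of x y z b a] by (simp add: assoc2_def algebra_simps)

lemma assoc2_swap_idx: "assoc2 a b z y x = assoc2 b a z y x"
  using index_symmetric [of x y z b a] by (simp add: assoc2_def algebra_simps)

section \<open>The commutative algebra generated by right multiplications, and maps linear over
  it\<close>

text \<open>In the model \<open>\<lambda>x. pr a x y\<close> is multiplication by D^a y, so these
  operators are multiplications by elements of weight 0.\<close>

inductive_set mult_ops :: "('v \<Rightarrow> 'v) set" where
  ident: "(\<lambda>x. x) \<in> mult_ops"
| right_mult: "(\<lambda>x. pr a x y) \<in> mult_ops"
| zero: "(\<lambda>x. 0) \<in> mult_ops"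
| diff: "f \<in> mult_ops \<Longrightarrow> g \<in> mult_ops \<Longrightarrow> (\<lambda>x. f x - g x) \<in> mult_ops"
| comp: "f \<in> mult_ops \<Longrightarrow> g \<in> mult_ops \<Longrightarrow> (\<lambda>x. f (g x)) \<in> mult_ops"

lemma mult_ops_add: "f \<in> mult_ops \<Longrightarrow> g \<in> mult_ops \<Longrightarrow> (\<lambda>x. f x + g x) \<in> mult_ops"
  using mult_ops.diff [of f "\<lambda>x. 0 - g x"] mult_ops.diff [OF mult_ops.zero, of g] by simp

lemma mult_ops_sum:
  "(\<And>i. i \<in> I \<Longrightarrow> f i \<in> mult_ops) \<Longrightarrow> (\<lambda>x. \<Sum>i\<in>I. f i x) \<in> mult_ops"
  by (induction I rule: infinite_finite_induct) (auto intro: mult_ops.zero mult_ops_add)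

lemma assoc2_in_mult_ops: "assoc2 a b z y \<in> mult_ops"
  unfolding assoc2_def
  by (intro mult_ops.diff mult_ops.right_mult mult_ops.comp [of "\<lambda>x. pr b x z" "\<lambda>x. pr a x y"])

definition mult_linear :: "('v \<Rightarrow> 'v) \<Rightarrow> bool" where
  "mult_linear f \<longleftrightarrow> (\<forall>x y. f (x + y) = f x + f y) \<and> (\<forall>c x. f (scale c x) = scale c (f x)) \<and>
     (\<forall>a x y. f (pr a x y) = pr a (f x) y)"

lemma mult_linearD:
  assumes "mult_linear f"
  shows "f (x + y) = f x + f y" "f (scale c x) = scale c (f x)" "f (pr a x y) = pr a (f x) y"
    "f 0 = 0" "f (x - y) = f x - f y"
proof -
  show *: "f (x + y) = f x + f y" "f (scale c x) = scale c (f x)" "f (pr a x y) = pr a (f x) y" for x y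
    using assms by (auto simp: mult_linear_def)
  show "f 0 = 0" using * (1) [of 0 0] by simp
  show "f (x - y) = f x - f y" using * (1) [of "x - y" y] by simp
qed

lemma mult_linear_commute:
  assumes "mult_linear f" "c \<in> mult_ops"
  shows "f (c x) = c (f x)"
  using assms(2) by (induction arbitrary: x rule: mult_ops.induct) (simp_all add: mult_linearD [OF assms(1)])

lemma mult_linear_mult_ops: "c \<in> mult_ops \<Longrightarrow> mult_linear c"
  by (induction rule: mult_ops.induct)
     (auto simp: mult_linear_def pr_add_left pr_scale_left pr_commute pr_diff_left scale_right_diff_distrib)

lemma mult_linear_diff: "mult_linear f \<Longrightarrow> mult_linear g \<Longrightarrow> mult_linear (\<lambda>x. f x - g x)"
  by (auto simp: mult_linear_def pr_diff_left scale_right_diff_distrib)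

lemma mult_linear_sum:
  "(\<And>i. i \<in> I \<Longrightarrow> mult_linear (f i)) \<Longrightarrow> mult_linear (\<lambda>x. \<Sum>i\<in>I. f i x)"
  by (simp add: mult_linear_def sum.distrib scale_sum_right pr_sum_left)

lemma mult_linear_comp: "mult_linear f \<Longrightarrow> mult_linear g \<Longrightarrow> mult_linear (\<lambda>x. f (g x))"
  by (auto simp: mult_linear_def)

text \<open>The Leibniz rule u D^a(y D^b w) = u (D^a y) D^b w + u y D^a D^b w. The arguments of
  \<open>assoc2\<close> are swapped so that the last term is an operator from
  \<open>mult_ops\<close> applied to \<open>y\<close>.\<close>

lemma pr_pr_right: "pr a u (pr b y w) = pr b (pr a u y) w + assoc2 a b w u y"
  by (subst assoc2_swap_args) (simp add: assoc2_def)

text \<open>Left multiplication by \<open>u\<close> is a derivation over \<open>mult_ops\<close>,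
  not a linear map. In its commutator with \<open>f\<close> the two \<open>assoc2\<close> terms
  produced by the Leibniz rule cancel, because \<open>f\<close> commutes with
  \<open>assoc2 a b w u\<close>.\<close>

lemma mult_linear_deriv:
  assumes "mult_linear f"
  shows "mult_linear (\<lambda>x. pr a u (f x) - f (pr a u x))"
  unfolding mult_linear_def
  by (simp add: mult_linearD [OF assms] pr_add_right pr_scale_right scale_right_diff_distrib pr_pr_right
      mult_linear_commute [OF assms assoc2_in_mult_ops] pr_diff_left)

text \<open>Models \<open>u\<^sub>1 * \<dots> * u\<^sub>k * D\<^sup>A z\<close>; only meaningful if the two lists have the same length.\<close>

fun brace :: "'a list \<Rightarrow> 'v \<Rightarrow> 'v list \<Rightarrow> 'v" where
  "brace (a # A) z (u # us) =
     pr a u (brace A z us) - (\<Sum>i<length us. brace A z (us[i := pr a u (us ! i)]))"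
| "brace A z us = z"

section \<open>Symmetry of the brace\<close>

text \<open>Isolates the one summand in which the variable entry \<open>x\<close> itself is
  differentiated; in all others \<open>x\<close> merely sits in slot \<open>k\<close>.\<close>

lemma sum_update_split:
  assumes "k < length us"
  shows "(\<Sum>j<length us. f (us[k := x, j := h (us[k := x] ! j)])) =
    f (us[k := h x]) + (\<Sum>j\<in>{..<length us} - {k}. f (us[j := h (us ! j), k := x]))"
  using assms by (subst sum.remove [of _ k]) (auto intro!: sum.cong simp: list_update_swap)

lemma brace_mult_linear:
  "length us = length A \<Longrightarrow> i < length us \<Longrightarrow> mult_linear (\<lambda>x. brace A z (us[i := x]))"
proof (induction A arbitrary: us i)
  case (Cons a A)
  then obtain u us' where us: "us = u # us'" by (cases us) auto
  then have len: "length us' = length A" using Cons by simp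
  show ?case
  proof (cases i)
    case 0
    have "mult_linear (\<lambda>x. brace A z (us'[j := pr a x (us' ! j)]))" if "j < length us'" for j
      using mult_linear_comp [OF Cons.IH [OF len that] mult_linear_mult_ops [OF mult_ops.right_mult]] .
    then have "mult_linear (\<lambda>x. pr a x (brace A z us') -
        (\<Sum>j<length us'. brace A z (us'[j := pr a x (us' ! j)])))"
      by (intro mult_linear_diff mult_linear_sum mult_linear_mult_ops [OF mult_ops.right_mult]) auto
    then show ?thesis using us 0 by simp
  next
    case (Suc k)
    then have k: "k < length us'" using Cons us by simp
    \<comment> \<open>Neither of the first two terms is linear over \<open>mult_ops\<close>, but
      their difference is a commutator as in \<open>mult_linear_deriv\<close>.\<close>
    have "mult_linear (\<lambda>x. (pr a u (brace A z (us'[k := x])) - brace A z (us'[k := pr a u x]))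
       - (\<Sum>j\<in>{..<length us'} - {k}. brace A z (us'[j := pr a u (us' ! j), k := x])))"
      by (intro mult_linear_diff mult_linear_sum mult_linear_deriv Cons.IH) (use len k in auto)
    then show ?thesis
      by (simp add: us Suc sum_update_split [OF k, where f = "brace A z"] diff_diff_eq)
  qed
qed simp

definition symmetric_brace :: "'a list \<Rightarrow> 'v \<Rightarrow> bool" where
  "symmetric_brace A z \<longleftrightarrow>
     (\<forall>us vs. length us = length A \<longrightarrow> mset us = mset vs \<longrightarrow> brace A z us = brace A z vs)"

lemma symmetric_braceD:
  "symmetric_brace A z \<Longrightarrow> mset us = mset vs \<Longrightarrow> length us = length A \<Longrightarrow> brace A z us = brace A z vs"
  by (auto simp: symmetric_brace_def)

lemma mset_update2:
  assumes "i < length ws" "k < length ws" "i \<noteq> k"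
  shows "mset (ws[i := v, k := u]) = mset (ws[i := u, k := v])"
  using mset_swap [of i "ws[i := v, k := u]" k] assms
  by (simp add: list_update_swap)

text \<open>In the model \<open>G v\<close> is v W for a fixed W, and both sides are u v D^a W. The
  identity is the symmetry of the longer brace in \<open>u\<close> and \<open>v\<close>, with the
  symmetric terms from the other slots removed.\<close>

lemma brace_slot_symmetric:
  assumes len: "length ws = length A" and i: "i < length ws"
    and A: "symmetric_brace A z" and aA: "symmetric_brace (a # A) z"
  defines "G \<equiv> \<lambda>x. brace A z (ws[i := x])"
  shows "pr a u (G v) - pr a (G u) v = pr a v (G u) - pr a (G v) u"
proof -
  define S where "S u v = (\<Sum>k\<in>{..<length ws} - {i}. brace A z (ws[k := pr a u (ws ! k), i := v]))" for u v
  have G: "mult_linear G" unfolding G_def using len i by (rule brace_mult_linear)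
  have *: "brace (a # A) z (u # ws[i := v]) = pr a u (G v) - pr a (G u) v - S u v" for u v
    by (simp add: sum_update_split [OF i, where f = "brace A z"] S_def diff_diff_eq
        flip: mult_linearD(3) [OF G]) (simp add: G_def)
  have "S u v = S v u"
    unfolding S_def
  proof (rule sum.cong [OF refl])
    fix k assume "k \<in> {..<length ws} - {i}"
    then have k: "k < length ws" "k \<noteq> i" by auto
    \<comment> \<open>Linearity in slot \<open>k\<close> moves the right multiplication by
      \<open>ws ! k\<close> outside, leaving \<open>u\<close> and \<open>v\<close> as plain entries
      of a symmetric brace.\<close>
    have eq: "brace A z (ws[k := pr a u (ws ! k), i := v]) = pr a (brace A z (ws[i := v, k := u])) (ws ! k)" for u v
      using mult_linearD(3) [OF brace_mult_linear [of "ws[i := v]" A k z]] k len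
      by (simp add: list_update_swap)
    show "brace A z (ws[k := pr a u (ws ! k), i := v]) = brace A z (ws[k := pr a v (ws ! k), i := u])"
      unfolding eq using symmetric_braceD [OF A mset_update2 [of i ws k v u]] i k len by simp
  qed
  moreover have "mset (u # ws[i := v]) = mset (v # ws[i := u])"
    using i by (simp add: mset_update)
  then have "brace (a # A) z (u # ws[i := v]) = brace (a # A) z (v # ws[i := u])"
    by (rule symmetric_braceD [OF aA]) (simp add: len)
  then have "pr a u (G v) - pr a (G u) v - S u v = pr a v (G u) - pr a (G v) u - S v u"
    unfolding * .
  ultimately show ?thesis by simp
qed

text \<open>Unfolds the recursion twice and sorts the result into parts whose symmetry is known
  separately: an \<open>assoc2\<close> term, terms of the shape in
  \<open>brace_slot_symmetric\<close>, and a double sum in which \<open>u\<close> and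
  \<open>v\<close> occupy two slots.\<close>

lemma brace2_expand:
  assumes len: "length ws = length A"
  shows "brace (a # b # A) z (u # v # ws) = assoc2 a b (brace A z ws) v u
    - (\<Sum>i<length ws.
        pr b (pr a u (brace A z (ws[i := v])) - pr a (brace A z (ws[i := u])) v) (ws ! i)
      + pr a (pr b v (brace A z (ws[i := u])) - pr b (brace A z (ws[i := v])) u) (ws ! i)
      + assoc2 a b (ws ! i) u (brace A z (ws[i := v])))
    + (\<Sum>k<length ws. \<Sum>i\<in>{..<length ws} - {k}.
        pr a (pr b (brace A z (ws[k := u, i := v])) (ws ! i)) (ws ! k))"
proof -
  let ?g = "brace A z" and ?n = "length ws"
  have lin: "mult_linear (\<lambda>x. ?g (ws[i := x]))" if "i < ?n" for i
    using len that by (rule brace_mult_linear)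
  note linD = mult_linearD [OF lin]
  have regroup: "x - P - ((T - Q) + (R - D)) = (x - T) - ((P - Q) + R) + D" for x P T Q R D :: 'v
    by (simp add: algebra_simps)
  have shift: "(\<Sum>i<Suc n. f i) = f 0 + (\<Sum>i<n. f (Suc i))" for n and f :: "nat \<Rightarrow> 'v"
    by (rule sum.lessThan_Suc_shift)
  have "brace (a # b # A) z (u # v # ws) =
     pr a u (pr b v (?g ws) - (\<Sum>i<?n. ?g (ws[i := pr b v (ws ! i)])))
     - ((pr b (pr a u v) (?g ws) - (\<Sum>i<?n. ?g (ws[i := pr b (pr a u v) (ws ! i)])))
       + (\<Sum>k<?n. brace (b # A) z (v # ws[k := pr a u (ws ! k)])))"
    by (simp add: shift del: sum.lessThan_Suc)
  also have "(\<Sum>k<?n. brace (b # A) z (v # ws[k := pr a u (ws ! k)])) =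
     (\<Sum>k<?n. pr b v (?g (ws[k := pr a u (ws ! k)])) - (?g (ws[k := pr b v (pr a u (ws ! k))])
       + (\<Sum>i\<in>{..<?n} - {k}. ?g (ws[i := pr b v (ws ! i), k := pr a u (ws ! k)]))))"
    by (rule sum.cong [OF refl]) (simp add: sum_update_split [where f = ?g])
  also have "\<dots> = (\<Sum>k<?n. pr b v (?g (ws[k := pr a u (ws ! k)])) - ?g (ws[k := pr b v (pr a u (ws ! k))]))
     - (\<Sum>k<?n. \<Sum>i\<in>{..<?n} - {k}. ?g (ws[i := pr b v (ws ! i), k := pr a u (ws ! k)]))"
    by (simp only: diff_diff_eq flip: sum_subtractf)
  also have "(\<Sum>k<?n. \<Sum>i\<in>{..<?n} - {k}. ?g (ws[i := pr b v (ws ! i), k := pr a u (ws ! k)])) =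
     (\<Sum>k<?n. \<Sum>i\<in>{..<?n} - {k}. pr a (pr b (?g (ws[k := u, i := v])) (ws ! i)) (ws ! k))"
  proof (intro sum.cong refl)
    fix k i assume ki: "k \<in> {..<?n}" "i \<in> {..<?n} - {k}"
    have "?g (ws[i := pr b v (ws ! i), k := pr a u (ws ! k)]) =
        pr a (?g (ws[i := pr b v (ws ! i), k := u])) (ws ! k)"
      using mult_linearD(3) [OF brace_mult_linear [of "ws[i := pr b v (ws ! i)]" A k z]] ki len by simp
    also have "?g (ws[i := pr b v (ws ! i), k := u]) = pr b (?g (ws[k := u, i := v])) (ws ! i)"
      using mult_linearD(3) [OF brace_mult_linear [of "ws[k := u]" A i z]] ki len
      by (simp add: list_update_swap)
    finally show "?g (ws[i := pr b v (ws ! i), k := pr a u (ws ! k)]) =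
        pr a (pr b (?g (ws[k := u, i := v])) (ws ! i)) (ws ! k)" .
  qed
  finally have "brace (a # b # A) z (u # v # ws) = assoc2 a b (?g ws) v u
    - (\<Sum>i<?n. pr a u (?g (ws[i := pr b v (ws ! i)])) - ?g (ws[i := pr b (pr a u v) (ws ! i)])
        + (pr b v (?g (ws[i := pr a u (ws ! i)])) - ?g (ws[i := pr b v (pr a u (ws ! i))])))
    + (\<Sum>k<?n. \<Sum>i\<in>{..<?n} - {k}. pr a (pr b (?g (ws[k := u, i := v])) (ws ! i)) (ws ! k))"
    unfolding assoc2_def pr_diff_right pr_sum_right sum_subtractf sum.distrib regroup .
  \<comment> \<open>Pulling \<open>ws ! i\<close> out of slot \<open>i\<close> and applying the
    Leibniz rule yields three \<open>assoc2\<close> terms; the two with outer index \<open>b\<close>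
    cancel.\<close>
  moreover have "(\<Sum>i<?n. pr a u (?g (ws[i := pr b v (ws ! i)])) - ?g (ws[i := pr b (pr a u v) (ws ! i)])
        + (pr b v (?g (ws[i := pr a u (ws ! i)])) - ?g (ws[i := pr b v (pr a u (ws ! i))]))) =
      (\<Sum>i<?n. pr b (pr a u (?g (ws[i := v])) - pr a (?g (ws[i := u])) v) (ws ! i)
      + pr a (pr b v (?g (ws[i := u])) - pr b (?g (ws[i := v])) u) (ws ! i)
      + assoc2 a b (ws ! i) u (?g (ws[i := v])))"
  proof (rule sum.cong [OF refl])
    fix i assume "i \<in> {..<?n}"
    then have i: "i < ?n" by simp
    show "pr a u (?g (ws[i := pr b v (ws ! i)])) - ?g (ws[i := pr b (pr a u v) (ws ! i)])
        + (pr b v (?g (ws[i := pr a u (ws ! i)])) - ?g (ws[i := pr b v (pr a u (ws ! i))])) =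
      pr b (pr a u (?g (ws[i := v])) - pr a (?g (ws[i := u])) v) (ws ! i)
      + pr a (pr b v (?g (ws[i := u])) - pr b (?g (ws[i := v])) u) (ws ! i)
      + assoc2 a b (ws ! i) u (?g (ws[i := v]))"
      by (simp add: linD [OF i] pr_pr_right pr_diff_left
        mult_linear_commute [OF lin [OF i] assoc2_in_mult_ops])
  qed
  ultimately show ?thesis by (simp only:)
qed

lemma brace_swap_head:
  assumes len: "length ws = length A"
    and A: "symmetric_brace A z" and sym: "\<And>a. symmetric_brace (a # A) z"
  shows "brace (a # b # A) z (u # v # ws) = brace (a # b # A) z (v # u # ws)"
    and "brace (a # b # A) z (u # v # ws) = brace (b # a # A) z (u # v # ws)"
proof -
  let ?g = "brace A z" and ?n = "length ws"
  note slot = brace_slot_symmetric [OF len _ A sym]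
  \<comment> \<open>Both sides are the slot map applied to \<open>assoc2 a b (ws ! i) u v\<close>,
    which is symmetric in its last two arguments.\<close>
  have as: "assoc2 a b (ws ! i) u (?g (ws[i := v])) = assoc2 a b (ws ! i) v (?g (ws[i := u]))"
    if "i < ?n" for u v i
    using mult_linear_commute [OF brace_mult_linear [OF len that] assoc2_in_mult_ops, of z a b "ws ! i"]
    by (metis assoc2_swap_args)
  have g2: "?g (ws[k := u, i := v]) = ?g (ws[k := v, i := u])" if "k < ?n" "i < ?n" "i \<noteq> k" for k i u v
    using that len by (intro symmetric_braceD [OF A] mset_update2) auto
  show "brace (a # b # A) z (u # v # ws) = brace (a # b # A) z (v # u # ws)"
    unfolding brace2_expand [OF len]
    by (intro arg_cong2 [where f = "(+)"] arg_cong2 [where f = "(-)"] sum.cong refl assoc2_swap_args)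
       (use slot in \<open>auto simp: as [of _ u v] g2 [of _ _ u v]\<close>)
  have g2': "pr b (pr a (?g (ws[i := u, k := v])) (ws ! k)) (ws ! i) =
      pr a (pr b (?g (ws[k := u, i := v])) (ws ! i)) (ws ! k)" if "k < ?n" "i < ?n" "i \<noteq> k" for k i
    using g2 [OF that(2,1)] that by (metis pr_commute list_update_swap)
  have "(\<Sum>k<?n. \<Sum>i\<in>{..<?n} - {k}. pr a (pr b (?g (ws[k := u, i := v])) (ws ! i)) (ws ! k)) =
     (\<Sum>(k, i)\<in>(SIGMA k:{..<?n}. {..<?n} - {k}). pr a (pr b (?g (ws[k := u, i := v])) (ws ! i)) (ws ! k))"
    by (simp add: sum.Sigma)
  also have "\<dots> = (\<Sum>(k, i)\<in>(SIGMA k:{..<?n}. {..<?n} - {k}). pr b (pr a (?g (ws[k := u, i := v])) (ws ! i)) (ws ! k))"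
    \<comment> \<open>Exchanging the two slots moves each index to the other slot; commuting right
      multiplications and the symmetry of the brace restore the summand.\<close>
    by (rule sum.reindex_bij_witness [of _ "\<lambda>(k, i). (i, k)" "\<lambda>(k, i). (i, k)"])
       (auto intro: g2')
  also have "\<dots> = (\<Sum>k<?n. \<Sum>i\<in>{..<?n} - {k}. pr b (pr a (?g (ws[k := u, i := v])) (ws ! i)) (ws ! k))"
    by (simp add: sum.Sigma)
  finally have dbl: "(\<Sum>k<?n. \<Sum>i\<in>{..<?n} - {k}. pr a (pr b (?g (ws[k := u, i := v])) (ws ! i)) (ws ! k)) =
     (\<Sum>k<?n. \<Sum>i\<in>{..<?n} - {k}. pr b (pr a (?g (ws[k := u, i := v])) (ws ! i)) (ws ! k))" .
  have "(\<Sum>i<?n.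
        pr b (pr a u (?g (ws[i := v])) - pr a (?g (ws[i := u])) v) (ws ! i)
      + pr a (pr b v (?g (ws[i := u])) - pr b (?g (ws[i := v])) u) (ws ! i)
      + assoc2 a b (ws ! i) u (?g (ws[i := v]))) =
    (\<Sum>i<?n.
        pr a (pr b u (?g (ws[i := v])) - pr b (?g (ws[i := u])) v) (ws ! i)
      + pr b (pr a v (?g (ws[i := u])) - pr a (?g (ws[i := v])) u) (ws ! i)
      + assoc2 b a (ws ! i) u (?g (ws[i := v])))"
  proof (rule sum.cong [OF refl])
    fix i assume "i \<in> {..<?n}"
    then have i: "i < ?n" by simp
    show "pr b (pr a u (?g (ws[i := v])) - pr a (?g (ws[i := u])) v) (ws ! i)
      + pr a (pr b v (?g (ws[i := u])) - pr b (?g (ws[i := v])) u) (ws ! i)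
      + assoc2 a b (ws ! i) u (?g (ws[i := v])) =
        pr a (pr b u (?g (ws[i := v])) - pr b (?g (ws[i := u])) v) (ws ! i)
      + pr b (pr a v (?g (ws[i := u])) - pr a (?g (ws[i := v])) u) (ws ! i)
      + assoc2 b a (ws ! i) u (?g (ws[i := v]))"
      \<comment> \<open>After exchanging \<open>u\<close> and \<open>v\<close> in both bracketed
        differences, the two summands trade places under swapping \<open>a\<close> and
        \<open>b\<close>.\<close>
      unfolding slot [OF i, of a u v] slot [OF i, of b v u] assoc2_swap_idx [of b a]
      by (simp only: add.commute)
  qed
  then show "brace (a # b # A) z (u # v # ws) = brace (b # a # A) z (u # v # ws)"
    unfolding brace2_expand [OF len]
    by (simp only: dbl assoc2_swap_idx [of a b "?g ws"])
qed

text \<open>Swapping the first two entries needs symmetry for the lists shorter by one and by two,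
  hence the induction on length for all index lists at once.\<close>

lemma symmetric_brace: "symmetric_brace A z"
proof (induction A rule: length_induct)
  case (1 A)
  show ?case
    unfolding symmetric_brace_def
  proof (intro allI impI)
    fix us vs :: "'v list" assume us: "length us = length A" "mset us = mset vs"
    show "brace A z us = brace A z vs"
    proof (rule mset_invariantI [of "length A"])
      fix x y and ws :: "'v list" assume ws: "length ws + 2 = length A"
      then obtain a b A' where A: "A = a # b # A'" "length A' = length ws"
        by (auto simp: numeral_2_eq_2 length_Suc_conv dest!: sym [of _ "length A"])
      show "brace A z (x # y # ws) = brace A z (y # x # ws)"
        unfolding A by (rule brace_swap_head) (use 1 A in auto)
    next
      fix x and ys zs :: "'v list" assume ys: "length ys + 1 = length A" "mset ys = mset zs"
      then obtain a A' where A: "A = a # A'" "length A' = length ys"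
        by (cases A) auto
      have *: "brace A' z us = brace A' z vs" if "length us = length ys" "mset us = mset vs" for us vs
        using 1 A that by (auto simp: symmetric_brace_def)
      have "(\<Sum>i<length ys. brace A' z (ys[i := pr a x (ys ! i)])) =
          (\<Sum>i<length zs. brace A' z (zs[i := pr a x (zs ! i)]))"
        by (rule sum_list_update_mset [OF * ys(2) refl])
      then show "brace A z (x # ys) = brace A z (x # zs)"
        using * [OF refl ys(2)] by (simp add: A)
    qed (use us in auto)
  qed
qed

lemma brace_perm: "mset us = mset vs \<Longrightarrow> length us = length A \<Longrightarrow> brace A z us = brace A z vs"
  by (rule symmetric_braceD [OF symmetric_brace])

lemma brace_perm_idx:
  assumes "mset A = mset A'" "length us = length A"
  shows "brace A z us = brace A' z us"
proof -
  have "\<forall>us. length us = length A \<longrightarrow> brace A z us = brace A' z us"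
    if "mset A = mset A'" for A A'
    using that
  proof (induction A arbitrary: A' rule: length_induct)
    case (1 A)
    \<comment> \<open>Making \<open>us\<close> an argument of the value lets
      \<open>mset_invariantI\<close> act on the indices; the default 0 makes functions comparable at
      every length.\<close>
    define f where "f A = (\<lambda>us. if length us = length A then brace A z us else 0)" for A
    have "f A = f A'"
    proof (rule mset_invariantI [OF _ _ 1(2) refl, of f])
      fix a b and B :: "'a list" assume "length B + 2 = length A"
      show "f (a # b # B) = f (b # a # B)"
        unfolding f_def
        by (intro ext) (auto simp: length_Suc_conv simp del: brace.simps
            intro!: brace_swap_head(2) symmetric_brace)
    next
      fix a and B B' :: "'a list" assume B: "length B + 1 = length A" "mset B = mset B'"
      then have "brace B z us = brace B' z us" if "length us = length B" for us
        using 1(1) that by simp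
      moreover have "length B = length B'" using mset_eq_length [OF B(2)] .
      ultimately show "f (a # B) = f (a # B')"
        unfolding f_def by (intro ext) (auto simp: length_Suc_conv)
    qed
    then show ?case using mset_eq_length [OF 1(2)] by (auto simp: f_def fun_eq_iff split: if_splits)
  qed
  then show ?thesis using assms by blast
qed

text \<open>In the correction terms \<open>x\<close> occurs only as \<open>pr a x (us ! i)\<close>
  in slot \<open>i\<close>. Symmetry brings this entry to the front, where the induction hypothesis
  composes with a right multiplication.\<close>

lemma brace_in_mult_ops: "length A = Suc (length us) \<Longrightarrow> (\<lambda>x. brace A z (x # us)) \<in> mult_ops"
proof (induction A arbitrary: us)
  case (Cons a A)
  then have len: "length us = length A" by simp
  have "(\<lambda>x. brace A z (us[i := pr a x (us ! i)])) \<in> mult_ops" if i: "i < length us" for i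
  proof -
    define vs where "vs = take i us @ drop (Suc i) us"
    have vs: "length A = Suc (length vs)" using len i by (simp add: vs_def)
    have "brace A z (us[i := x]) = brace A z (x # vs)" for x
      using i len by (intro brace_perm) (simp_all add: vs_def upd_conv_take_nth_drop)
    then show ?thesis
      using mult_ops.comp [OF Cons.IH [OF vs] mult_ops.right_mult] by simp
  qed
  then show ?case by (auto intro!: mult_ops.diff mult_ops.right_mult mult_ops_sum)
qed simp

end

section \<open>Normal forms\<close>

abbreviation leaf :: "'g \<Rightarrow> 'g \<times> 'a multiset" where
  "leaf h \<equiv> (h, {#})"

abbreviation leaves :: "'g list \<Rightarrow> ('g \<times> 'a multiset) multiset" where
  "leaves hs \<equiv> image_mset leaf (mset hs)"

text \<open>The sum in the populated condition: the letters from \<open>M\<close> are the only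
  multi-indices in the word belonging to D^M g, so its degree is the size of
  \<open>M\<close>.\<close>

definition weight :: "('g \<times> 'a multiset) multiset \<Rightarrow> int" where
  "weight X = (\<Sum>v\<in>#X. 1 - int (size (snd v)))"

lemma weight_simps [simp]:
  "weight {#} = 0" "weight (add_mset v X) = 1 - int (size (snd v)) + weight X"
  "weight (X + Y) = weight X + weight Y"
  by (simp_all add: weight_def)

lemma weight_leaves [simp]: "weight (leaves hs) = int (length hs)"
  by (induction hs) simp_all

context total_multi_novikov
begin

lemma brace_closed:
  assumes "subspace S" "\<And>a x y. x \<in> S \<Longrightarrow> y \<in> S \<Longrightarrow> pr a x y \<in> S"
  shows "z \<in> S \<Longrightarrow> set us \<subseteq> S \<Longrightarrow> brace A z us \<in> S"
proof (induction A arbitrary: us)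
  case (Cons a A)
  show ?case
  proof (cases us)
    case (Cons u us')
    then have u: "u \<in> S" "set us' \<subseteq> S" using Cons.prems by auto
    have "brace A z (us'[i := pr a u (us' ! i)]) \<in> S" if "i < length us'" for i
    proof -
      have "us' ! i \<in> S" using u that nth_mem by blast
      then have "insert (pr a u (us' ! i)) (set us') \<subseteq> S" using u assms(2) by simp
      then show ?thesis
        by (intro Cons.IH Cons.prems order.trans [OF set_update_subset_insert])
    qed
    then show ?thesis
      using Cons.IH [OF Cons.prems(1) u(2)] u by (auto simp: Cons intro!: subspace_diff subspace_sum assms)
  qed (use Cons in simp)
qed simp

section \<open>Operators representing monomials of weight 0, and the independence of their
  arrangement\<close>

text \<open>A weight zero monomial \<open>Y\<close> in the variables \<open>D\<^sup>M g\<close>, where \<open>(g, M)\<close> stands for \<open>D\<^sup>M g\<close>,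
  acts by multiplication as an operator \<open>c\<close> with \<open>composite f Y c\<close>.\<close>

inductive composite :: "('g \<Rightarrow> 'v) \<Rightarrow> ('g \<times> 'a multiset) multiset \<Rightarrow> ('v \<Rightarrow> 'v) \<Rightarrow> bool" for f where
  ident: "composite f {#} (\<lambda>x. x)"
| step: "composite f Y c \<Longrightarrow> length A = Suc (length hs) \<Longrightarrow>
    composite f (add_mset (g, mset A) (Y + leaves hs)) (\<lambda>x. brace A (f g) (c x # map f hs))"

lemma composite_mult_ops: "composite f Y c \<Longrightarrow> c \<in> mult_ops"
  by (induction rule: composite.induct)
     (auto intro!: mult_ops.ident mult_ops.comp [of "\<lambda>x. brace _ _ (x # _)"] brace_in_mult_ops)

lemma mult_ops_commute: "c \<in> mult_ops \<Longrightarrow> d \<in> mult_ops \<Longrightarrow> c (d x) = d (c x)"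
  by (simp add: mult_linear_commute mult_linear_mult_ops)

lemma brace_head_commute:
  "c \<in> mult_ops \<Longrightarrow> length A = Suc (length us) \<Longrightarrow> brace A z (c x # us) = c (brace A z (x # us))"
  using mult_ops_commute [OF _ brace_in_mult_ops] by metis

lemma composite_comp:
  "composite f Y c \<Longrightarrow> composite f Z d \<Longrightarrow> composite f (Y + Z) (\<lambda>x. c (d x))"
proof (induction rule: composite.induct)
  case (step Y c A hs g)
  then show ?case using composite.step [of f "Y + Z" "\<lambda>x. c (d x)" A hs g] by (simp add: ac_simps)
qed simp

lemma composite_brace:
  "length A = Suc (length hs) \<Longrightarrow>
    composite f (add_mset (g, mset A) (leaves hs)) (\<lambda>x. brace A (f g) (x # map f hs))"
  using composite.step [OF composite.ident, of A hs f g] by simp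

text \<open>The root can be traded with any leaf inside the operator. Where that leaf is an argument
  of a brace, the inner operator is pulled out, the two entries are swapped by symmetry, and the
  operators are composed again.\<close>

lemma composite_root_change:
  assumes "composite f Y c" "leaf h \<in># Y"
  obtains c' where "composite f (add_mset (leaf k) (Y - {#leaf h#})) c'" "c (f k) = c' (f h)"
proof -
  have "\<exists>c'. composite f (add_mset (leaf k) (Y - {#leaf h#})) c' \<and> c (f k) = c' (f h)"
    using assms
  proof (induction rule: composite.induct)
    case (step Y c A hs g)
    have A: "mset A \<noteq> {#}" using step(2) by auto
    show ?case
    proof (cases "h \<in> set hs")
      case True
      define hs' where "hs' = remove1 h hs"
      have hs: "mset hs = add_mset h (mset hs')" using True by (simp add: hs'_def)
      have len: "length hs = Suc (length hs')" using mset_eq_length [of hs "h # hs'"] hs by simp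
      have "composite f (Y + add_mset (g, mset A) (leaves (k # hs')))
          (\<lambda>x. c (brace A (f g) (x # map f (k # hs'))))"
        by (intro composite_comp step composite_brace) (simp add: step len)
      moreover have "brace A (f g) (c (f k) # map f hs) = c (brace A (f g) (f h # map f (k # hs')))"
      proof -
        have "brace A (f g) (c (f k) # map f hs) = brace A (f g) (c (f k) # map f (h # hs'))"
          by (rule brace_perm) (simp_all add: hs step len)
        also have "\<dots> = c (brace A (f g) (f k # map f (h # hs')))"
          using composite_mult_ops [OF step(1)] step(2) by (simp add: brace_head_commute len)
        also have "brace A (f g) (f k # map f (h # hs')) = brace A (f g) (f h # map f (k # hs'))"
          by (rule brace_perm) (simp_all add: step len)
        finally show ?thesis .
      qed
      ultimately show ?thesis using A by (intro exI conjI) (auto simp: hs add_mset_commute)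
    next
      case False
      then have h: "leaf h \<in># Y" using step A by auto
      then obtain c' where c': "composite f (add_mset (leaf k) (Y - {#leaf h#})) c'" "c (f k) = c' (f h)"
        using step by auto
      have "add_mset (leaf k) (add_mset (g, mset A) (Y + leaves hs) - {#leaf h#}) =
          add_mset (g, mset A) (add_mset (leaf k) (Y - {#leaf h#}) + leaves hs)"
        using h A by simp
      then show ?thesis using composite.step [OF c'(1) step(2), of g] c'(2)
        by (intro exI conjI) (auto simp: add_mset_commute)
    qed
  qed simp
  then show ?thesis using that by blast
qed

text \<open>Since the operators commute, any factor carrying derivatives can be made the outermost
  one, together with the leaves it was built with.\<close>

lemma composite_split:
  assumes "composite f Y c" "(g, M) \<in># Y" "M \<noteq> {#}"
  obtains A hs Z d where "mset A = M" "length A = Suc (length hs)" "composite f Z d"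
    "Y = add_mset (g, M) (Z + leaves hs)" "\<And>x. c x = brace A (f g) (d x # map f hs)"
proof -
  have "\<exists>A hs Z d. mset A = M \<and> length A = Suc (length hs) \<and> composite f Z d \<and>
      Y = add_mset (g, M) (Z + leaves hs) \<and> (\<forall>x. c x = brace A (f g) (d x # map f hs))"
    using assms
  proof (induction rule: composite.induct)
    case (step Y c A' hs' g')
    show ?case
    proof (cases "(g, M) = (g', mset A')")
      case True
      then show ?thesis
        using step(1,2) by (intro exI [of _ A'] exI [of _ hs'] exI [of _ Y] exI [of _ c]) simp
    next
      case False
      then have "(g, M) \<in># Y" using step by auto
      then obtain A hs Z d where *: "mset A = M" "length A = Suc (length hs)" "composite f Z d"
        "Y = add_mset (g, M) (Z + leaves hs)" "\<forall>x. c x = brace A (f g) (d x # map f hs)"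
        using step by blast
      have "add_mset (g', mset A') (Y + leaves hs') =
          add_mset (g, M) (add_mset (g', mset A') (Z + leaves hs') + leaves hs)"
        using * by (simp add: ac_simps)
      moreover have "brace A' (f g') (c x # map f hs') =
          brace A (f g) (brace A' (f g') (d x # map f hs') # map f hs)" for x
        using * step(2) by (simp add: brace_head_commute [OF brace_in_mult_ops])
      ultimately show ?thesis using *(1,2) composite.step [OF *(3) step(2), of g']
        by (intro exI [of _ A] exI [of _ hs] exI conjI) auto
    qed
  qed simp
  then show ?thesis by (elim exE conjE) (rule that, (assumption | erule spec)+)
qed

text \<open>Two arrangements with the same outermost factor may still give it different leaves. This
  trades leaves between the outer brace and the inner operator, keeping the root, by induction on
  the number of leaves still to be replaced.\<close>

lemma composite_exchange:
  assumes "composite f Z d" "Z + leaves ks = Y + leaves hs" "length ks = length hs"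
    "length A = Suc (length hs)"
  obtains e where "composite f Y e"
    "brace A z (d (f h) # map f ks) = brace A z (e (f h) # map f hs)"
proof -
  have "\<exists>e. composite f Y e \<and> brace A z (d (f h) # map f ks) = brace A z (e (f h) # map f hs)"
    using assms
  proof (induction "size (mset ks - mset hs)" arbitrary: ks Z d)
    case 0
    then have "mset ks \<subseteq># mset hs" by (simp add: Diff_eq_empty_iff_mset)
    then have ks: "mset ks = mset hs"
      using 0 by (metis mset_subset_size nless_le size_mset subset_mset.less_le)
    then have "Z = Y" using 0 by simp
    moreover have "brace A z (d (f h) # map f ks) = brace A z (d (f h) # map f hs)"
      using 0 ks by (intro brace_perm) simp_all
    ultimately show ?case using 0 by blast
  next
    case (Suc n)
    then have "mset ks - mset hs \<noteq> {#}" by auto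
    then obtain k where k: "k \<in># mset ks - mset hs" by blast
    have "mset hs - mset ks \<noteq> {#}"
    proof
      assume "mset hs - mset ks = {#}"
      then have "mset hs \<subseteq># mset ks" by (simp add: Diff_eq_empty_iff_mset)
      then have "mset hs = mset ks"
        using Suc by (metis mset_subset_size nless_le size_mset subset_mset.less_le)
      then show False using k by simp
    qed
    then obtain l where l: "l \<in># mset hs - mset ks" by blast
    have "count (mset ks) l < count (mset hs) l" using l by (simp add: in_diff_count)
    moreover have cl: "count (leaves us) (leaf l) = count (mset us) l" for us :: "'b list"
      by (induction us) auto
    have "count (Z + leaves ks) (leaf l) = count (Y + leaves hs) (leaf l)"
      using Suc by simp
    \<comment> \<open>The wanted leaf \<open>l\<close> is too rare in \<open>ks\<close>, and the
      totals agree, so it must lie in the inner operator.\<close>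
    ultimately have "count Z (leaf l) > 0" by (simp add: cl del: count_greater_zero_iff)
    then have lZ: "leaf l \<in># Z" by simp
    define ks' where "ks' = remove1 k ks"
    have ks: "mset ks = add_mset k (mset ks')" using k by (auto simp: ks'_def dest: in_diffD)
    then have len: "length ks = Suc (length ks')" using mset_eq_length [of ks "k # ks'"] by simp
    \<comment> \<open>The cyclic trade: \<open>l\<close> becomes the root in place of
      \<open>h\<close>, is swapped with \<open>k\<close> by the symmetry of the brace, and finally
      \<open>h\<close> is restored as root with \<open>k\<close> left inside.\<close>
    obtain d1 where d1: "composite f (add_mset (leaf h) (Z - {#leaf l#})) d1" "d (f h) = d1 (f l)"
      using composite_root_change [OF Suc(3) lZ] by blast
    have "leaf h \<in># add_mset (leaf h) (Z - {#leaf l#})" by simp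
    from composite_root_change [OF d1(1) this, of k]
    obtain d2 where d2: "composite f (add_mset (leaf k) (Z - {#leaf l#})) d2" "d1 (f k) = d2 (f h)"
      by auto
    have "brace A z (d (f h) # map f ks) = brace A z (d1 (f l) # map f (k # ks'))"
      unfolding d1(2) using Suc ks by (intro brace_perm) simp_all
    also have "\<dots> = d1 (brace A z (f l # map f (k # ks')))"
      using Suc composite_mult_ops [OF d1(1)] by (simp add: brace_head_commute len)
    also have "brace A z (f l # map f (k # ks')) = brace A z (f k # map f (l # ks'))"
      using Suc len by (intro brace_perm) simp_all
    also have "d1 \<dots> = brace A z (d1 (f k) # map f (l # ks'))"
      using Suc composite_mult_ops [OF d1(1)] by (simp add: brace_head_commute len)
    finally have eq: "brace A z (d (f h) # map f ks) = brace A z (d2 (f h) # map f (l # ks'))"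
      by (simp add: d2)
    have "mset (l # ks') - mset hs = mset ks - mset hs - {#k#}"
    proof (rule multiset_eqI)
      fix x
      show "count (mset (l # ks') - mset hs) x = count (mset ks - mset hs - {#k#}) x"
        using k l by (auto simp: ks in_diff_count split: if_splits)
    qed
    then have "n = size (mset (l # ks') - mset hs)" using Suc(2) size_Diff_singleton [OF k] by simp
    moreover obtain Z' where "Z = add_mset (leaf l) Z'" using lZ by (metis insert_DiffM)
    then have "add_mset (leaf k) (Z - {#leaf l#}) + leaves (l # ks') = Y + leaves hs"
      using Suc(4) by (simp add: ks add_mset_commute)
    ultimately show ?case
      using Suc(1) [OF _ d2(1), of "l # ks'"] Suc(5,6) len eq by simp
  qed
  then show ?thesis using that by blast
qed

text \<open>Peel off the outermost factor of \<open>c\<close>, make the same factor outermost in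
  \<open>d\<close>, align their leaves by \<open>composite_exchange\<close>, and apply induction to
  the inner operators.\<close>

lemma composite_unique_fixed_root:
  "composite f Y c \<Longrightarrow> composite f Y d \<Longrightarrow> c (f h) = d (f h)"
proof (induction "size Y" arbitrary: Y c d rule: less_induct)
  case less
  from less(2) show ?case
  proof cases
    case ident
    with less(3) show ?thesis by (auto elim: composite.cases)
  next
    case (step Y1 c1 A hs g)
    have A: "mset A \<noteq> {#}" using step(4) by auto
    have gY: "(g, mset A) \<in># Y" by (simp add: step(1))
    obtain A' ks Z d1 where Z: "mset A' = mset A" "length A' = Suc (length ks)" "composite f Z d1"
      "Y = add_mset (g, mset A) (Z + leaves ks)" "\<And>x. d x = brace A' (f g) (d1 x # map f ks)"
      by (rule composite_split [OF less(3) gY A]) (rule that)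
    have len: "length ks = length hs" using Z(1,2) step(4) mset_eq_length by fastforce
    have "Z + leaves ks = Y1 + leaves hs" using Z(4) step(1) by simp
    from composite_exchange [OF Z(3) this len step(4), of "f g" h]
    obtain e where e: "composite f Y1 e"
      "brace A (f g) (d1 (f h) # map f ks) = brace A (f g) (e (f h) # map f hs)" by blast
    have "c1 (f h) = e (f h)"
      using less(1) [OF _ step(3) e(1)] step(1) by simp
    then show ?thesis
      using e(2) Z step(2) len by (simp add: brace_perm_idx [OF Z(1)])
  qed
qed

lemma composite_unique:
  assumes "composite f Y c" "composite f Z d" "add_mset (leaf h) Y = add_mset (leaf k) Z"
  shows "c (f h) = d (f k)"
proof (cases "h = k")
  case True
  then show ?thesis using assms composite_unique_fixed_root by auto
next
  case False
  then obtain X where X: "Y = add_mset (leaf k) X" "Z = add_mset (leaf h) X"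
    using assms(3) by (auto simp: add_eq_conv_ex)
  obtain c' where "composite f (add_mset (leaf h) (Y - {#leaf k#})) c'" "c (f h) = c' (f k)"
    using composite_root_change [OF assms(1)] X(1) by (metis union_single_eq_member)
  then show ?thesis using composite_unique_fixed_root [OF assms(2)] X by auto
qed

text \<open>Remove one factor D^M g with nonempty \<open>M\<close> together with |M| - 1 leaves.
  This has weight 0, so the rest again has weight 1.\<close>

lemma composite_exists:
  assumes "weight X = 1"
  obtains h Y c where "X = add_mset (leaf h) Y" "composite f Y c"
proof -
  have "\<exists>h Y c. X = add_mset (leaf h) Y \<and> composite f Y c"
    using assms
  proof (induction "size X" arbitrary: X rule: less_induct)
    case less
    show ?case
    proof (cases "\<exists>g M. (g, M) \<in># X \<and> M \<noteq> {#}")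
      case False
      then have "\<forall>v\<in>#X. size (snd v) = 0" by auto
      then have "weight X = int (size X)"
        by (induction X) simp_all
      then have "size X = 1" using less by simp
      then obtain v where "X = {#v#}" by (meson size_1_singleton_mset)
      then have "X = add_mset (leaf (fst v)) {#}" using False by (cases v) auto
      then show ?thesis using composite.ident by blast
    next
      case True
      then obtain g M where M: "(g, M) \<in># X" "M \<noteq> {#}" by blast
      then obtain X' where X': "X = add_mset (g, M) X'" by (metis insert_DiffM)
      define P where "P = filter_mset (\<lambda>v. snd v = {#}) X'"
      define Q where "Q = filter_mset (\<lambda>v. snd v \<noteq> {#}) X'"
      have PQ: "X' = P + Q" unfolding P_def Q_def by (rule multiset_partition)
      have "weight Q \<le> 0"
      proof -
        have "\<forall>v\<in>#Q. snd v \<noteq> {#}" by (simp add: Q_def)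
        then show ?thesis
        proof (induction Q)
          case (add v Q)
          then have "size (snd v) \<ge> 1" using nonempty_has_size by (metis Suc_leI One_nat_def union_single_eq_member)
          then show ?case using add by simp
        qed simp
      qed
      have "\<forall>v\<in>#P. snd v = {#}" by (simp add: P_def)
      then have "\<exists>ps. P = leaves ps"
      proof (induction P)
        case (add v P)
        then obtain ps where "P = leaves ps" by auto
        then have "add_mset v P = leaves (fst v # ps)" using add by (cases v) auto
        then show ?case by blast
      qed auto
      then obtain ps where ps: "P = leaves ps" by blast
      obtain A where A: "mset A = M" using ex_mset by blast
      then have "length A > 0" using M by auto
      have sM: "size M = length A" using A by auto
      \<comment> \<open>The remaining derived factors have weight at most 0, so total weight 1
        forces enough leaves, with at least one left over.\<close>
      have "int (length ps) \<ge> length A"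
        using less(2) \<open>weight Q \<le> 0\<close> by (simp add: X' PQ ps sM)
      define hs where "hs = take (length A - 1) ps"
      have hs: "length A = Suc (length hs)"
        using \<open>int (length ps) \<ge> length A\<close> \<open>length A > 0\<close> by (simp add: hs_def)
      define X1 where "X1 = leaves (drop (length A - 1) ps) + Q"
      have X1: "X' = X1 + leaves hs"
      proof -
        have "mset ps = mset (take (length A - 1) ps @ drop (length A - 1) ps)" by simp
        then show ?thesis unfolding PQ ps X1_def hs_def mset_append by (simp add: ac_simps)
      qed
      have "weight X1 = 1" using less(2) by (simp add: X' X1 sM hs)
      moreover have "size X1 < size X" by (simp add: X' X1)
      ultimately obtain h Y c where c: "X1 = add_mset (leaf h) Y" "composite f Y c" using less by blast
      then have "X = add_mset (leaf h) (add_mset (g, mset A) (Y + leaves hs))"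
        "composite f (add_mset (g, mset A) (Y + leaves hs)) (\<lambda>x. brace A (f g) (c x # map f hs))"
        using composite.step [OF c(2) hs] by (simp_all add: X' X1 A c(1) add_mset_commute)
      then show ?thesis by blast
    qed
  qed
  then show ?thesis using that by blast
qed

section \<open>The values span a subspace closed under all products\<close>

definition normal_forms :: "('g \<Rightarrow> 'v) \<Rightarrow> 'v set" where
  "normal_forms f = {c (f h) | Y c h. composite f Y c}"

lemma normal_formsI: "composite f Y c \<Longrightarrow> c (f h) \<in> normal_forms f"
  unfolding normal_forms_def by blast

lemma composite_normal_forms:
  "composite f Y c \<Longrightarrow> x \<in> normal_forms f \<Longrightarrow> c x \<in> normal_forms f"
  unfolding normal_forms_def using composite_comp by fast

lemma mult_ops_span:
  assumes "c \<in> mult_ops" "\<And>x. x \<in> S \<Longrightarrow> c x \<in> S" "y \<in> span S"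
  shows "c y \<in> span S"
  using assms(3)
proof (induction rule: span_induct_alt)
  case base
  show ?case using mult_linearD(4) [OF mult_linear_mult_ops [OF assms(1)]] by (simp add: span_zero)
next
  case (step k x y)
  have "c x \<in> span S" by (intro span_base assms(2) step)
  with step have "scale k (c x) + c y \<in> span S" by (intro span_add span_scale)
  then show ?case using mult_linearD [OF mult_linear_mult_ops [OF assms(1)]] by simp
qed

text \<open>The Leibniz rule for \<open>x * D\<^sup>a y\<close>, read off the recursion defining braces.\<close>

lemma pr_brace:
  "pr a x (brace A z us) = brace (a # A) z (x # us) + (\<Sum>i<length us. brace A z (us[i := pr a x (us ! i)]))"
  by simp

text \<open>Distributing the derivative over the outermost brace gives three kinds of terms: it
  falls on D^A g, on the inner value, or on one of the leaves.\<close>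

lemma pr_normal_form:
  assumes "composite f Y c" "x \<in> normal_forms f"
  shows "pr a x (c (f h)) \<in> span (normal_forms f)"
  using assms
proof (induction rule: composite.induct)
  case ident
  have "composite f (add_mset (h, mset [a]) (leaves [])) (\<lambda>x. brace [a] (f h) (x # map f []))"
    by (rule composite_brace) simp
  from composite_normal_forms [OF this ident] show ?case by (simp add: span_base)
next
  case (step Y c A hs g)
  let ?y = "c (f h)"
  obtain d k Z where x: "x = d (f k)" "composite f Z d" using step(4) by (auto simp: normal_forms_def)
  have d: "d \<in> mult_ops" using x(2) by (rule composite_mult_ops)
  have y: "?y \<in> normal_forms f" using step(1) by (rule normal_formsI)
  have E: "composite f (add_mset (g, mset A) (leaves hs)) (\<lambda>x. brace A (f g) (x # map f hs))"
    by (rule composite_brace [OF step(2)])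
  \<comment> \<open>With \<open>d\<close> pulled out, the root \<open>k\<close> of \<open>x\<close>
    serves as an additional leaf beside \<open>hs\<close>, and the value \<open>?y\<close> becomes
    the head.\<close>
  have "brace (a # A) (f g) (x # ?y # map f hs) = d (brace (a # A) (f g) (f k # ?y # map f hs))"
    unfolding x using step(2) d by (intro brace_head_commute) simp_all
  also have "brace (a # A) (f g) (f k # ?y # map f hs) = brace (a # A) (f g) (?y # map f (k # hs))"
    using step(2) by (intro brace_perm) simp_all
  also have "d \<dots> \<in> normal_forms f"
    using step(2) y by (intro composite_normal_forms [OF x(2)] composite_normal_forms [OF composite_brace])
      simp_all
  finally have 1: "brace (a # A) (f g) (x # ?y # map f hs) \<in> span (normal_forms f)"
    by (rule span_base)
  have 2: "brace A (f g) (pr a x ?y # map f hs) \<in> span (normal_forms f)"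
    by (rule mult_ops_span [OF composite_mult_ops [OF E] composite_normal_forms [OF E] step.IH [OF step.prems]])
  \<comment> \<open>By linearity in the slot, multiplication by D^a of the leaf and the operator
    \<open>d\<close> leave the brace, and \<open>k\<close> replaces the differentiated leaf.\<close>
  have 3: "brace A (f g) (?y # (map f hs)[i := pr a x (map f hs ! i)]) \<in> span (normal_forms f)"
    if i: "i < length hs" for i
  proof -
    have lin: "mult_linear (\<lambda>w. brace A (f g) (?y # (map f hs)[i := w]))"
      using brace_mult_linear [of "?y # map f hs" A "Suc i" "f g"] i step(2) by simp
    have "composite f (add_mset (hs ! i, mset [a]) (leaves [])) (\<lambda>x. brace [a] (f (hs ! i)) (x # map f []))"
      by (rule composite_brace) simp
    then have R: "composite f {#(hs ! i, {#a#})#} (\<lambda>x. pr a x (f (hs ! i)))" by simp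
    have "composite f (add_mset (g, mset A) (leaves (hs[i := k])))
        (\<lambda>x. brace A (f g) (x # map f (hs[i := k])))"
      by (rule composite_brace) (simp add: step)
    then have "pr a (d (brace A (f g) (?y # map f (hs[i := k])))) (f (hs ! i)) \<in> normal_forms f"
      by (intro composite_normal_forms [OF R] composite_normal_forms [OF x(2)]
          composite_normal_forms [OF _ y])
    also have "pr a (d (brace A (f g) (?y # map f (hs[i := k])))) (f (hs ! i)) =
        brace A (f g) (?y # (map f hs)[i := pr a x (map f hs ! i)])"
      using i by (simp add: x mult_linearD(3) [OF lin] mult_linear_commute [OF lin d] map_update)
    finally show ?thesis by (rule span_base)
  qed
  have "pr a x (brace A (f g) (?y # map f hs)) = brace (a # A) (f g) (x # ?y # map f hs)
    + (brace A (f g) (pr a x ?y # map f hs)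
      + (\<Sum>i<length hs. brace A (f g) (?y # (map f hs)[i := pr a x (map f hs ! i)])))"
    unfolding pr_brace length_Cons sum.lessThan_Suc_shift by (simp del: brace.simps)
  also have "\<dots> \<in> span (normal_forms f)"
    using 1 2 3 by (intro span_add span_sum) auto
  finally show ?case .
qed

lemma span_normal_forms_closed:
  assumes "x \<in> span (normal_forms f)" "y \<in> span (normal_forms f)"
  shows "pr a x y \<in> span (normal_forms f)"
proof -
  have 1: "pr a x y \<in> span (normal_forms f)" if "x \<in> normal_forms f" for x
    using assms(2)
  proof (induction rule: span_induct_alt)
    case (step c z y)
    then obtain Y d h where "z = d (f h)" "composite f Y d" by (auto simp: normal_forms_def)
    then have "pr a x z \<in> span (normal_forms f)" using pr_normal_form [OF _ that] by simp
    then show ?case using step by (simp add: pr_add_right pr_scale_right span_add span_scale)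
  qed (simp add: span_zero)
  show ?thesis
    using assms(1)
  proof (induction rule: span_induct_alt)
    case (step c z x)
    then show ?case using 1 by (simp add: pr_add_left pr_scale_left span_add span_scale)
  qed (simp add: span_zero)
qed

lemma mterm_eval_normal_forms: "mterm_eval pr f t \<in> span (normal_forms f)"
proof (induction t)
  case (Gen g)
  show ?case using normal_formsI [OF composite.ident, of f g] by (simp add: span_base)
qed (simp add: span_normal_forms_closed)

lemma composite_closed:
  assumes "subspace S" "\<And>a x y. x \<in> S \<Longrightarrow> y \<in> S \<Longrightarrow> pr a x y \<in> S"
  shows "composite f Y c \<Longrightarrow> f ` fst ` set_mset Y \<subseteq> S \<Longrightarrow> x \<in> S \<Longrightarrow> c x \<in> S"
proof (induction rule: composite.induct)
  case (step Y c A hs g)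
  then have "f g \<in> S" "set (map f hs) \<subseteq> S" "c x \<in> S" by force+
  then show ?case by (intro brace_closed assms) simp_all
qed simp

end

section \<open>Coordinates\<close>

text \<open>The pair \<open>(q, M)\<close> stands for the word formed by the indices in \<open>M\<close> followed by \<open>q i\<close> copies
  of each \<open>Partial i\<close>; such words form a basis of the algebra.\<close>

type_synonym 'i op_key = "'i mindex \<times> 'i mindex multiset"

text \<open>Left multiplication by a letter, followed by moving a derivative to the right past all
  indices. A representation on the free space over the keys proves the ordered words independent.
  Where \<open>n i\<close> is 0, the coefficient removes the term with truncated
  subtraction.\<close>

fun letter_basis :: "'i letter \<Rightarrow> 'i op_key \<Rightarrow> ('i op_key \<Rightarrow>\<^sub>0 'k::field_char_0)" where
  "letter_basis (Index n) (q, M) = Poly_Mapping.single (q, add_mset n M) 1"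
| "letter_basis (Partial i) (q, M) = Poly_Mapping.single (q(i := Suc (q i)), M) 1 +
     (\<Sum>n\<in>#M. Poly_Mapping.single (q, add_mset (n(i := n i - 1)) (M - {#n#})) (of_nat (n i)))"

definition letter_act :: "'i letter \<Rightarrow> ('i op_key \<Rightarrow>\<^sub>0 'k::field_char_0) \<Rightarrow> ('i op_key \<Rightarrow>\<^sub>0 'k)" where
  "letter_act x = lin_ext pscale (letter_basis x)"

lemma letter_act_linear:
  "letter_act x 0 = 0" "letter_act x (p + q) = letter_act x p + letter_act x q"
  "letter_act x (pscale c p) = pscale c (letter_act x p)"
  by (simp_all add: letter_act_def pm.lin_ext_add pm.lin_ext_pscale)

lemma letter_act_sum_mset: "letter_act x (\<Sum>n\<in>#M. f n) = (\<Sum>n\<in>#M. letter_act x (f n))"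
  by (induction M) (simp_all add: letter_act_linear)

lemma letter_act_Index:
  "letter_act (Index n) (Poly_Mapping.single (q, M) c) = Poly_Mapping.single (q, add_mset n M) c"
  by (simp add: letter_act_def)

lemma letter_act_Partial:
  "letter_act (Partial i) (Poly_Mapping.single (q, M) 1) = Poly_Mapping.single (q(i := Suc (q i)), M) 1 +
     (\<Sum>n\<in>#M. Poly_Mapping.single (q, add_mset (n(i := n i - 1)) (M - {#n#})) (of_nat (n i)))"
  by (simp add: letter_act_def)

lemma letter_act_Partial_empty:
  "letter_act (Partial i) (Poly_Mapping.single (q, {#}) c) = Poly_Mapping.single (q(i := Suc (q i)), {#}) c"
  by (simp add: letter_act_def)

lemma letter_act_Index_commute:
  "letter_act (Index n) (letter_act (Index m) p) = letter_act (Index m) (letter_act (Index n) p)"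
proof (induction p rule: poly_mapping_single_induct)
  case (monom k c)
  then show ?case by (cases k) (simp add: letter_act_Index add_mset_commute)
qed (simp_all add: letter_act_linear)

lemma letter_act_Partial_Index:
  "letter_act (Partial i) (letter_act (Index n) p) =
    pscale (of_nat (n i)) (letter_act (Index (n(i := n i - 1))) p) + letter_act (Index n) (letter_act (Partial i) p)"
proof (induction p rule: poly_mapping_single_induct)
  case (monom k c)
  obtain q M where k: "k = (q, M)" by (cases k)
  have single: "Poly_Mapping.single k c = pscale c (Poly_Mapping.single (q, M) 1)" by (simp add: k)
  have "(\<Sum>m\<in>#M. Poly_Mapping.single (q, add_mset (m(i := m i - 1)) (add_mset n M - {#m#})) (of_nat (m i)))
      = (\<Sum>m\<in>#M. letter_act (Index n)
          (Poly_Mapping.single (q, add_mset (m(i := m i - 1)) (M - {#m#})) (of_nat (m i) :: 'b)))"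
  proof (intro arg_cong [where f = sum_mset] image_mset_cong)
    fix m assume "m \<in># M"
    then have "add_mset n M - {#m#} = add_mset n (M - {#m#})" by simp
    then show "Poly_Mapping.single (q, add_mset (m(i := m i - 1)) (add_mset n M - {#m#})) (of_nat (m i)) =
        letter_act (Index n)
          (Poly_Mapping.single (q, add_mset (m(i := m i - 1)) (M - {#m#})) (of_nat (m i) :: 'b))"
      by (simp add: letter_act_Index add_mset_commute)
  qed
  then have "letter_act (Partial i) (letter_act (Index n) (Poly_Mapping.single (q, M) 1)) =
    pscale (of_nat (n i)) (letter_act (Index (n(i := n i - 1))) (Poly_Mapping.single (q, M) 1))
      + letter_act (Index n) (letter_act (Partial i) (Poly_Mapping.single (q, M) (1 :: 'b)))"
    by (simp add: letter_act_Index letter_act_Partial letter_act_linear letter_act_sum_mset)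
  then show ?case
    by (simp only: single letter_act_linear pm.scale_right_distrib pm.scale_left_commute)
qed (simp_all add: letter_act_linear pm.scale_right_distrib)

text \<open>Induction on \<open>M\<close> through the relation between \<open>Partial\<close> and
  \<open>Index\<close>: the first order terms are exchanged by swapping \<open>i\<close> and
  \<open>j\<close>, and the second order coefficient is symmetric.\<close>

lemma letter_act_Partial_commute_basis:
  "letter_act (Partial i) (letter_act (Partial j) (Poly_Mapping.single (q, M) c)) =
    letter_act (Partial j) (letter_act (Partial i) (Poly_Mapping.single (q, M) c))"
proof (induction M)
  case empty
  show ?case by (cases "i = j") (simp_all add: letter_act_Partial_empty fun_upd_twist)
next
  case (add n M)
  have "pscale (of_nat (n i)) (pscale (of_nat ((n(i := n i - 1)) j)) (letter_act (Index (n(i := n i - 1, j := (n(i := n i - 1)) j - 1))) p)) =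
    pscale (of_nat (n j)) (pscale (of_nat ((n(j := n j - 1)) i)) (letter_act (Index (n(j := n j - 1, i := (n(j := n j - 1)) i - 1))) p))"
    for p :: "'a op_key \<Rightarrow>\<^sub>0 'b"
    by (cases "i = j") (simp_all add: fun_upd_twist pm.scale_left_commute)
  then show ?case
    using add
    by (simp only: letter_act_Index [of n q M, symmetric] letter_act_Partial_Index letter_act_linear
        pm.scale_right_distrib) (simp only: add.assoc add.left_commute add.commute)
qed

lemma letter_act_Partial_commute:
  "letter_act (Partial i) (letter_act (Partial j) p) = letter_act (Partial j) (letter_act (Partial i) p)"
proof (induction p rule: poly_mapping_single_induct)
  case (monom k c)
  then show ?case by (cases k) (simp add: letter_act_Partial_commute_basis)
qed (simp_all add: letter_act_linear)

definition word_act :: "'i letter word \<Rightarrow> ('i op_key \<Rightarrow>\<^sub>0 'k::field_char_0) \<Rightarrow> ('i op_key \<Rightarrow>\<^sub>0 'k)" where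
  "word_act w = foldr letter_act (letters w)"

lemma word_act_linear:
  "word_act w 0 = 0" "word_act w (p + q) = word_act w p + word_act w q"
  "word_act w (pscale c p) = pscale c (word_act w p)"
proof -
  have "foldr letter_act xs 0 = 0" "foldr letter_act xs (p + q) = foldr letter_act xs p + foldr letter_act xs q"
    "foldr letter_act xs (pscale c p) = pscale c (foldr letter_act xs p)" for xs
    by (induction xs) (simp_all add: letter_act_linear)
  then show "word_act w 0 = 0" "word_act w (p + q) = word_act w p + word_act w q"
    "word_act w (pscale c p) = pscale c (word_act w p)"
    by (simp_all add: word_act_def)
qed

lemma word_act_add: "word_act (v + w) p = word_act v (word_act w p)"
  by (simp add: word_act_def plus_word_def)

lemma word_act_letter: "word_act (Word [x]) p = letter_act x p"
  by (simp add: word_act_def)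

definition alg_act ::
  "('i letter word \<Rightarrow>\<^sub>0 'k) \<Rightarrow> ('i op_key \<Rightarrow>\<^sub>0 'k::field_char_0) \<Rightarrow> ('i op_key \<Rightarrow>\<^sub>0 'k)" where
  "alg_act a p = lin_ext pscale (\<lambda>w. word_act w p) a"

lemma alg_act_linear_left:
  "alg_act 0 p = 0" "alg_act (a + b) p = alg_act a p + alg_act b p"
  "alg_act (a - b) p = alg_act a p - alg_act b p" "alg_act (pscale c a) p = pscale c (alg_act a p)"
  "alg_act (Poly_Mapping.single w c) p = pscale c (word_act w p)"
  by (simp_all add: alg_act_def pm.lin_ext_add pm.lin_ext_diff pm.lin_ext_pscale)

lemma alg_act_linear_right:
  "alg_act a 0 = 0" "alg_act a (p + q) = alg_act a p + alg_act a q"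
  "alg_act a (pscale c p) = pscale c (alg_act a p)"
  by (induction a rule: poly_mapping_single_induct;
      simp add: alg_act_linear_left word_act_linear pm.scale_right_distrib pm.scale_left_commute)+

lemma alg_act_mult: "alg_act (a * b) p = alg_act a (alg_act b p)"
proof (induction a rule: poly_mapping_single_induct)
  case (monom v c)
  show ?case
  proof (induction b rule: poly_mapping_single_induct)
    case (monom w d)
    show ?case by (simp add: mult_single alg_act_linear_left alg_act_linear_right word_act_add word_act_linear)
  qed (simp_all add: alg_act_linear_left alg_act_linear_right distrib_left)
qed (simp_all add: alg_act_linear_left distrib_right)

lemma alg_act_ideal:
  assumes "a \<in> ring_ideal op_relations"
  shows "alg_act a p = 0"
  using assms
proof (induction arbitrary: p rule: ring_ideal.induct)
  case (gen r a b)
  from gen have "alg_act r q = 0" for q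
    by (induction rule: op_relations.induct)
      (simp_all add: alg_act_linear_left alg_act_mult word_act_letter letter_act_Index_commute
        letter_act_Partial_commute letter_act_Partial_Index)
  then show ?case by (simp add: alg_act_mult alg_act_linear_right)
qed (simp_all add: alg_act_linear_left)

text \<open>Action on the key of the empty word, so that an ordered word is sent to its own
  key.\<close>

lift_definition op_coords :: "('i::finite, 'k::field_char_0) op_alg \<Rightarrow> ('i op_key \<Rightarrow>\<^sub>0 'k)"
  is "\<lambda>a. alg_act a (Poly_Mapping.single (\<lambda>_. 0, {#}) 1)"
  using alg_act_ideal by (metis alg_act_linear_left(3) eq_iff_diff_eq_0)

lemma op_coords_linear:
  "op_coords (op_scale c \<alpha> + op_scale d \<beta>) = pscale c (op_coords \<alpha>) + pscale d (op_coords \<beta>)"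
  by transfer (simp add: alg_act_linear_left)

abbreviation basis_word :: "'i mindex list \<Rightarrow> 'i list \<Rightarrow> 'i letter word" where
  "basis_word ns js \<equiv> Word (map Index ns @ map Partial js)"

lemma op_coords_basis_word:
  "op_coords (op_word (basis_word ns js)) = Poly_Mapping.single (count_list js, mset ns) 1"
proof -
  have *: "foldr letter_act (map Partial js) (Poly_Mapping.single (\<lambda>_. 0, {#}) 1) =
      Poly_Mapping.single (count_list js, {#}) (1 :: 'b)"
  proof (induction js)
    case Nil
    have "count_list [] = (\<lambda>_ :: 'a. 0 :: nat)" by (rule ext) simp
    then show ?case by (simp only: list.map foldr.simps id_apply)
  next
    case (Cons j js)
    have "(count_list js)(j := Suc (count_list js j)) = count_list (j # js)" by (rule ext) auto
    then show ?case using Cons by (simp only: list.map foldr.simps o_apply letter_act_Partial_empty)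
  qed
  have "foldr letter_act (map Index ns) (Poly_Mapping.single (q, M) c) =
      Poly_Mapping.single (q, mset ns + M) (c :: 'b)" for q :: "'a mindex" and M c
    by (induction ns) (simp_all add: letter_act_Index)
  then show ?thesis
    by (simp add: op_word.abs_eq op_coords.abs_eq alg_act_linear_left word_act_def *)
qed

section \<open>Coordinates on the symmetric algebra\<close>

text \<open>A monomial as the multiset of its factors. The bracketing of \<open>((q, l), M)\<close>
  reads the variable as the derivative D^M of the generator (q, l), so the same keys index the
  operators \<open>composite\<close>.\<close>

type_synonym ('i, 'l) sym_key = "(('i mindex \<times> 'l) \<times> 'i mindex multiset) multiset"

definition var_coords ::
  "'l \<times> ('i::finite, 'k::field_char_0) op_alg \<Rightarrow> (('i, 'l) sym_key \<Rightarrow>\<^sub>0 'k)" where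
  "var_coords v = lin_ext pscale (\<lambda>(q, M). Poly_Mapping.single {#((q, fst v), M)#} 1) (op_coords (snd v))"

definition monom_coords ::
  "('l \<times> ('i::finite, 'k::field_char_0) op_alg \<Rightarrow>\<^sub>0 nat) \<Rightarrow> (('i, 'l) sym_key \<Rightarrow>\<^sub>0 'k)" where
  "monom_coords \<beta> = (\<Prod>v\<in>Poly_Mapping.keys \<beta>. var_coords v ^ Poly_Mapping.lookup \<beta> v)"

lemma monom_coords_superset:
  assumes "finite K" "Poly_Mapping.keys \<beta> \<subseteq> K"
  shows "monom_coords \<beta> = (\<Prod>v\<in>K. var_coords v ^ Poly_Mapping.lookup \<beta> v)"
  unfolding monom_coords_def using assms
  by (intro prod.mono_neutral_left ballI) (auto simp del: split_paired_All simp: not_in_keys_iff_lookup_eq_zero)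

lemma monom_coords_add: "monom_coords (\<beta> + \<gamma>) = monom_coords \<beta> * monom_coords \<gamma>"
proof -
  define K where "K = Poly_Mapping.keys \<beta> \<union> Poly_Mapping.keys \<gamma>"
  have K: "finite K" "Poly_Mapping.keys \<beta> \<subseteq> K" "Poly_Mapping.keys \<gamma> \<subseteq> K"
      "Poly_Mapping.keys (\<beta> + \<gamma>) \<subseteq> K"
    using keys_add [of \<beta> \<gamma>] by (auto simp: K_def)
  show ?thesis
    by (simp only: monom_coords_superset [OF K(1) K(2)] monom_coords_superset [OF K(1) K(3)]
        monom_coords_superset [OF K(1) K(4)] lookup_add power_add prod.distrib)
qed

lemma monom_coords_var: "monom_coords (Poly_Mapping.single v 1) = var_coords v"
  by (simp add: monom_coords_def)

lemma lin_ext_monom_coords_mult: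
  fixes p q :: "('l \<times> ('i::finite, 'k::field_char_0) op_alg \<Rightarrow>\<^sub>0 nat) \<Rightarrow>\<^sub>0 'k"
  shows "lin_ext pscale monom_coords (p * q) = lin_ext pscale monom_coords p * lin_ext pscale monom_coords q"
proof (induction p rule: poly_mapping_single_induct)
  case (monom v c)
  show ?case
  proof (induction q rule: poly_mapping_single_induct)
    case (monom w d)
    have "pscale (c * d) (x * y) = pscale c x * pscale d y" for x y :: "('i, 'l) sym_key \<Rightarrow>\<^sub>0 'k"
    proof -
      have "pscale c x * pscale d y = pscale d (y * pscale c x)"
        by (simp only: pscale_mult_right mult.commute [of _ y])
      then show ?thesis by (simp add: pscale_mult_right mult.commute)
    qed
    then show ?case by (simp add: mult_single monom_coords_add)
  qed (simp_all add: pm.lin_ext_add distrib_left)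
qed (simp_all add: pm.lin_ext_add distrib_right)

lift_definition sym_coords :: "('l, 'i::finite, 'k::field_char_0) sym_alg \<Rightarrow> (('i, 'l) sym_key \<Rightarrow>\<^sub>0 'k)"
  is "lin_ext pscale monom_coords"
proof -
  fix p q :: "('l \<times> ('i, 'k) op_alg \<Rightarrow>\<^sub>0 nat) \<Rightarrow>\<^sub>0 'k"
  assume "p - q \<in> ring_ideal sym_relations"
  then have "lin_ext pscale monom_coords (p - q) = 0"
  proof (induction rule: ring_ideal.induct)
    case (gen r a b)
    then have "lin_ext pscale monom_coords r = 0"
    proof (induction rule: sym_relations.induct)
      case (1 l c1 \<alpha>1 c2 \<alpha>2)
      then show ?case
        by (simp add: pm.lin_ext_diff pm.lin_ext_add pm.lin_ext_pscale monom_coords_var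
            var_coords_def op_coords_linear del: One_nat_def)
    qed
    then show ?case by (simp add: lin_ext_monom_coords_mult)
  qed (simp_all add: pm.lin_ext_add)
  then show "lin_ext pscale monom_coords p = lin_ext pscale monom_coords q"
    by (simp add: pm.lin_ext_diff)
qed

lemma sym_coords_hom:
  "sym_coords (x + y) = sym_coords x + sym_coords y"
  "sym_coords (sym_scale c x) = pscale c (sym_coords x)"
  "sym_coords (x * y) = sym_coords x * sym_coords y"
  "sym_coords 0 = 0"
  "sym_coords 1 = 1"
  by (transfer; simp add: pm.lin_ext_add pm.lin_ext_pscale lin_ext_monom_coords_mult)+
    (transfer, simp add: monom_coords_def flip: single_one)

lemma sym_coords_zvar: "sym_coords (zvar (l, op_word (basis_word ns js))) =
    Poly_Mapping.single {#((count_list js, l), mset ns)#} 1"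
  by (simp add: zvar_def sym_coords.abs_eq monom_coords_var var_coords_def op_coords_basis_word
      del: One_nat_def)

section \<open>The multi-Novikov structure on multi-indices\<close>

lemma sym_D_simps:
  "sym_D n (x + y) = sym_D n x + sym_D n y"
  "sym_D n (sym_scale c x) = sym_scale c (sym_D n x)"
  "sym_D n (x * y) = sym_D n x * y + x * sym_D n y"
  using sym_D(1) [of n] by (auto simp: derivation_def Vector_Spaces.linear_iff)

lemma sym_D_consts: "sym_D n 0 = 0" "sym_D n 1 = 0"
  using sym_D_simps(1) [of n 0 0] sym_D_simps(3) [of n 1 1] by simp_all

lemma op_word_add: "op_word (v + w) = op_word v * op_word w"
  by (simp add: op_word.abs_eq times_op_alg.abs_eq mult_single)

lemma op_word_zero: "op_word 0 = 1"
  by (simp add: op_word.abs_eq one_op_alg.abs_eq)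

lemma op_word_Cons: "op_word (Word (x # xs)) = op_word (Word [x]) * op_word (Word xs)"
  using op_word_add [of "Word [x]" "Word xs"] by (simp add: plus_word_def)

lemma op_relation_eq: "a - b \<in> op_relations \<Longrightarrow> abs_op_alg a = abs_op_alg b"
  unfolding op_alg.abs_eq_iff by (rule ring_ideal_base)

lemma op_index_commute: "op_index n * op_index m = op_index m * op_index n"
  using op_relation_eq [OF op_relations.intros(2) [of n m]]
  by (simp add: op_word.abs_eq times_op_alg.abs_eq)

lemma op_partial_commute:
  "op_word (Word [Partial i]) * op_word (Word [Partial j]) =
    op_word (Word [Partial j]) * op_word (Word [Partial i])"
  using op_relation_eq [OF op_relations.intros(1) [of i j]]
  by (simp add: op_word.abs_eq times_op_alg.abs_eq)

lemma op_partial_index: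
  "op_word (Word [Partial i]) * op_index n =
    op_scale (of_nat (n i)) (op_index (n(i := n i - 1))) + op_index n * op_word (Word [Partial i])"
  using op_relation_eq [OF op_relations.intros(3) [of i n]]
  by (simp only: op_word.abs_eq times_op_alg.abs_eq plus_op_alg.abs_eq op_scale.abs_eq)

text \<open>The commutator of two derivations is a derivation, and it vanishes on the variables
  because indices commute.\<close>

lemma sym_D_commute:
  fixes x :: "('l, 'i::finite, 'k::field_char_0) sym_alg"
  shows "sym_D n (sym_D m x) = sym_D m (sym_D n x)"
proof -
  have "derivation (\<lambda>x :: ('l, 'i, 'k) sym_alg. sym_D n (sym_D m x) - sym_D m (sym_D n x))"
    unfolding derivation_def Vector_Spaces.linear_iff
    by (simp add: sym_D_simps sym.vector_space_axioms algebra_simps)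
  moreover have "derivation (\<lambda>x. 0)"
    unfolding derivation_def Vector_Spaces.linear_iff by (simp add: sym.vector_space_axioms)
  moreover have "sym_D n (sym_D m (zvar v)) - sym_D m (sym_D n (zvar v)) = (0 :: ('l, 'i, 'k) sym_alg)" for v
    by (cases v) (simp add: sym_D(2) op_index_commute flip: mult.assoc)
  ultimately have "(\<lambda>x. sym_D n (sym_D m x) - sym_D m (sym_D n x)) = (\<lambda>x :: ('l, 'i, 'k) sym_alg. 0)"
    by (rule derivation_unique)
  then show ?thesis by (meson eq_iff_diff_eq_0)
qed

interpretation symn: total_multi_novikov sym_scale sym_prod
proof (unfold_locales, goal_cases)
  case 1 show ?case by (rule sym.subspace_UNIV)
qed (simp_all add: sym_prod_def sym_D_simps sym_D_consts sym_scale_mult_left sym_scale_mult_right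
  sym_D_commute [of _ "_ :: 'c mindex"] algebra_simps)

interpretation fnt: total_multi_novikov fn_scale fn_prod
  by unfold_locales

lemma sym_D_prod_list:
  "sym_D a (prod_list us) = (\<Sum>i<length us. prod_list (us[i := sym_D a (us ! i)]))"
proof (induction us)
  case (Cons u us)
  then show ?case
    by (simp add: sym_D_simps sum.lessThan_Suc_shift sum_distrib_left del: sum.lessThan_Suc)
qed (simp add: sym_D_consts)

lemma prod_list_update_scale:
  "i < length us \<Longrightarrow> prod_list (us[i := u * x]) = u * prod_list (us[i := x])"
  for u :: "'a::comm_monoid_mult"
  by (induction us arbitrary: i) (auto simp: nth_Cons' ac_simps split: nat.splits)

text \<open>Here the brace is what it was meant to model: the correction sum removes exactly the
  Leibniz terms in which the derivative falls on the product of \<open>us\<close>.\<close>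

lemma sym_brace:
  "length us = length A \<Longrightarrow> symn.brace A z us = prod_list us * foldr sym_D A z"
proof (induction A arbitrary: us)
  case (Cons a A)
  then obtain u us' where us: "us = u # us'" "length us' = length A" by (cases us) auto
  have "(\<Sum>i<length us'. symn.brace A z (us'[i := sym_prod a u (us' ! i)])) =
      (\<Sum>i<length us'. u * prod_list (us'[i := sym_D a (us' ! i)]) * foldr sym_D A z)"
    by (intro sum.cong refl) (simp add: Cons.IH us sym_prod_def prod_list_update_scale)
  also have "\<dots> = u * sym_D a (prod_list us') * foldr sym_D A z"
    by (simp add: sym_D_prod_list sum_distrib_left sum_distrib_right)
  finally have sum: "(\<Sum>i<length us'. symn.brace A z (us'[i := sym_prod a u (us' ! i)])) =
      u * sym_D a (prod_list us') * foldr sym_D A z" .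
  have "symn.brace (a # A) z us = sym_prod a u (symn.brace A z us') -
      (\<Sum>i<length us'. symn.brace A z (us'[i := sym_prod a u (us' ! i)]))"
    by (simp add: us(1))
  also have "\<dots> = sym_prod a u (prod_list us' * foldr sym_D A z) - u * sym_D a (prod_list us') * foldr sym_D A z"
    by (simp only: sum Cons.IH [OF us(2)])
  also have "\<dots> = prod_list us * foldr sym_D (a # A) z"
    by (simp add: us(1) sym_prod_def sym_D_simps algebra_simps)
  finally show ?case .
qed simp

section \<open>Monomials in the basis variables\<close>

definition partials :: "'i mindex \<Rightarrow> 'i list" where
  "partials q = (SOME js. count_list js = q)"

lemma count_list_partials: "count_list (partials q) = (q :: 'i::finite mindex)"
proof -
  \<comment> \<open>Finiteness of the coordinate type makes every \<open>q\<close> a legitimate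
    multiset.\<close>
  obtain js where "mset js = Abs_multiset q" using ex_mset by blast
  then have "count_list js = q" by (auto simp: fun_eq_iff simp flip: count_mset)
  then show ?thesis unfolding partials_def by (rule someI)
qed

definition sym_gen :: "'i::finite mindex \<times> 'l \<Rightarrow> ('l, 'i, 'k::field_char_0) sym_alg" where
  "sym_gen g = zvar (snd g, op_word (basis_word [] (partials (fst g))))"

definition sym_var :: "('i::finite mindex \<times> 'l) \<times> 'i mindex multiset \<Rightarrow> ('l, 'i, 'k::field_char_0) sym_alg" where
  "sym_var v = foldr sym_D (SOME A. mset A = snd v) (sym_gen (fst v))"

lemma foldr_sym_D_gen: "foldr sym_D A (sym_gen g) = zvar (snd g, op_word (basis_word A (partials (fst g))))"
proof (induction A)
  case (Cons a A)
  then show ?case by (simp add: sym_D(2) op_word_Cons [of _ "_ @ _"])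
qed (simp add: sym_gen_def)

lemma prod_list_map_perm:
  fixes h :: "'a \<Rightarrow> 'b::monoid_mult"
  assumes "\<And>x y. h x * h y = h y * h x" "mset us = mset vs"
  shows "prod_list (map h us) = prod_list (map h vs)"
  using assms(2)
proof (induction us arbitrary: vs)
  case (Cons u us)
  then have "u \<in> set vs" by (metis list.set_intros(1) set_mset_mset)
  then obtain ys zs where vs: "vs = ys @ u # zs" by (meson split_list)
  have "prod_list (map h ys) * h u = h u * prod_list (map h ys)"
    by (induction ys) (simp_all add: mult.assoc, metis assms(1) mult.assoc)
  moreover have "mset us = mset (ys @ zs)" using Cons.prems vs by simp
  from Cons.IH [OF this] have "prod_list (map h us) = prod_list (map h (ys @ zs))" .
  ultimately show ?case by (simp add: vs flip: mult.assoc)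
qed simp

lemma op_word_map: "op_word (Word (map f xs)) = prod_list (map (\<lambda>x. op_word (Word [f x])) xs)"
proof (induction xs)
  case Nil
  show ?case using op_word_zero by (simp add: zero_word_def)
next
  case (Cons x xs)
  then show ?case by (simp add: op_word_Cons [of _ "map _ _"])
qed

lemma op_word_basis_perm:
  assumes "mset ns = mset ns'" "count_list js = count_list js'"
  shows "op_word (basis_word ns js) = op_word (basis_word ns' js')"
proof -
  have split: "op_word (basis_word ns js) = op_word (Word (map Index ns)) * op_word (Word (map Partial js))"
    for ns and js :: "'a list"
    using op_word_add [of "Word (map Index ns)" "Word (map Partial js)"] by (simp add: plus_word_def)
  have "mset js = mset js'" using assms(2) by (simp add: multiset_eq_iff count_mset)
  then show ?thesis
    unfolding split op_word_map using assms(1)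
    by (metis (no_types, lifting) prod_list_map_perm op_index_commute op_partial_commute)
qed

lemma sym_var_eq:
  assumes "mset A = M"
  shows "sym_var (g, M) = foldr sym_D A (sym_gen g)"
proof -
  have "mset (SOME A. mset A = M) = M" by (rule someI [of _ A]) (rule assms)
  then have *: "mset (SOME A. mset A = M) = mset A" by (simp only: assms)
  then show ?thesis
    by (simp only: sym_var_def foldr_sym_D_gen fst_conv snd_conv op_word_basis_perm [OF * refl])
qed

definition sym_monom ::
  "(('i::finite mindex \<times> 'l) \<times> 'i mindex multiset) multiset \<Rightarrow> ('l, 'i, 'k::field_char_0) sym_alg" where
  "sym_monom X = (\<Prod>v\<in>#X. sym_var v)"

lemma sym_monom_simps [simp]:
  "sym_monom {#} = 1" "sym_monom (add_mset v X) = sym_var v * sym_monom X"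
  "sym_monom (X + Y) = sym_monom X * sym_monom Y"
  by (simp_all add: sym_monom_def)

lemma sym_var_leaf: "sym_var (leaf g) = sym_gen g"
  by (simp add: sym_var_eq [of "[]"])

lemma sym_monom_leaves: "sym_monom (leaves hs) = prod_list (map sym_gen hs)"
  by (induction hs) (simp_all add: sym_var_leaf)

lemma sym_var_zvar:
  "zvar (l, op_word (basis_word ns js)) = sym_var ((count_list js, l), mset ns)"
  by (simp add: sym_var_eq [OF refl] foldr_sym_D_gen)
    (metis op_word_basis_perm count_list_partials)

lemma sym_coords_sym_var: "sym_coords (sym_var v) = Poly_Mapping.single {#v#} 1"
proof -
  obtain q l M where v: "v = ((q, l), M)" by (cases v) auto
  obtain A where "mset A = M" using ex_mset by blast
  then show ?thesis
    by (simp add: v sym_var_eq foldr_sym_D_gen sym_coords_zvar [of l A "partials q"] count_list_partials)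
qed

text \<open>This is the linear independence of distinct monomials in the basis variables.\<close>

lemma sym_coords_sym_monom: "sym_coords (sym_monom X) = Poly_Mapping.single X 1"
  by (induction X) (simp_all add: sym_coords_hom sym_coords_sym_var mult_single flip: single_one)

section \<open>Weight spaces\<close>

lemma op_graded_index: "\<alpha> \<in> op_graded k \<Longrightarrow> op_index n * \<alpha> \<in> op_graded (Suc k)"
  unfolding op_graded_def
proof (induction rule: op.span_induct_alt)
  case (step c x y)
  then obtain w where w: "x = op_word w" "index_count w = k" by auto
  have "op_index n * x = op_word (Word [Index n] + w)"
    by (simp add: w op_word_add)
  moreover have "index_count (Word [Index n] + w) = Suc k"
    by (simp add: index_count_add w) (simp add: index_count_def)
  ultimately have "op_index n * x \<in> op_word ` {w. index_count w = Suc k}" by blast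
  then show ?case using step
    by (simp add: distrib_left op_scale_mult_right op.span_add op.span_scale op.span_base)
qed (simp add: op.span_zero)

text \<open>Monomials built factor by factor, with the degree carried as data instead of through
  \<open>ell\<close>. Unlike \<open>populated\<close> it admits \<open>\<alpha> = 0\<close>, so
  differentiating a factor needs no case distinction.\<close>

inductive weighted :: "'l set \<Rightarrow> int \<Rightarrow> ('l, 'i::finite, 'k::field_char_0) sym_alg \<Rightarrow> bool" for L where
  one: "weighted L 0 1"
| var: "weighted L w x \<Longrightarrow> l \<in> L \<Longrightarrow> \<alpha> \<in> op_graded k \<Longrightarrow> weighted L (1 - int k + w) (zvar (l, \<alpha>) * x)"

definition weight_space :: "'l set \<Rightarrow> int \<Rightarrow> ('l, 'i::finite, 'k::field_char_0) sym_alg set" where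
  "weight_space L w = sym.span (Collect (weighted L w))"

lemma weighted_mult: "weighted L w x \<Longrightarrow> weighted L w' y \<Longrightarrow> weighted L (w + w') (x * y)"
  by (induction rule: weighted.induct) (auto simp: add.assoc mult.assoc intro: weighted.intros)

lemma weighted_zvar: "l \<in> L \<Longrightarrow> \<alpha> \<in> op_graded k \<Longrightarrow> weighted L (1 - int k) (zvar (l, \<alpha>))"
  using weighted.var [OF weighted.one, of l L \<alpha> k] by simp

lemma sym_span_mult:
  assumes "\<And>x y. x \<in> S \<Longrightarrow> y \<in> T \<Longrightarrow> x * y \<in> sym.span U" "x \<in> sym.span S" "y \<in> sym.span T"
  shows "x * y \<in> sym.span U"
proof -
  have 1: "x * y \<in> sym.span U" if "x \<in> S" for x
    using assms(3)
  proof (induction rule: sym.span_induct_alt)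
    case (step c z y)
    then show ?case using assms(1) that
      by (simp add: distrib_left sym_scale_mult_right sym.span_add sym.span_scale)
  qed (simp add: sym.span_zero)
  show ?thesis
    using assms(2)
  proof (induction rule: sym.span_induct_alt)
    case (step c z x)
    then show ?case using 1
      by (simp add: distrib_right sym_scale_mult_left sym.span_add sym.span_scale)
  qed (simp add: sym.span_zero)
qed

lemma weight_space_mult:
  "x \<in> weight_space L w \<Longrightarrow> y \<in> weight_space L w' \<Longrightarrow> x * y \<in> weight_space L (w + w')"
  unfolding weight_space_def
  by (rule sym_span_mult) (auto intro: sym.span_base weighted_mult)

text \<open>A derivation raises the degree of one factor by one. Hence the products map weights 1
  and 1 to 1 + (1 - 1) = 1.\<close>

lemma weight_space_sym_D:
  fixes x :: "('l, 'i::finite, 'k::field_char_0) sym_alg"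
  assumes "x \<in> weight_space L w"
  shows "sym_D n x \<in> weight_space L (w - 1)"
proof -
  have sub: "sym.subspace (weight_space L w :: ('l, 'i, 'k) sym_alg set)" for w by (simp add: weight_space_def)
  have "sym_D n x \<in> weight_space L (w - 1)" if "weighted L w x" for x :: "('l, 'i, 'k) sym_alg" and w
    using that
  proof (induction rule: weighted.induct)
    case one
    show ?case by (simp add: sym_D_consts sym.subspace_0 [OF sub])
  next
    case (var w x l \<alpha> k)
    have "zvar (l, op_index n * \<alpha>) * x \<in> weight_space L (1 - int (Suc k) + w)"
      unfolding weight_space_def
      using weighted.var [OF var(1,2) op_graded_index [OF var(3)]] by (simp add: sym.span_base)
    moreover have "zvar (l, \<alpha>) * sym_D n x \<in> weight_space L (1 - int k + (w - 1))"
      using var weighted_zvar [OF var(2,3)]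
      by (intro weight_space_mult) (simp_all add: weight_space_def sym.span_base)
    ultimately show ?case
      by (simp add: sym_D_simps sym_D(2) sym.subspace_add [OF sub] algebra_simps)
  qed
  note * = this
  show ?thesis
    using assms unfolding weight_space_def [of L w]
  proof (induction rule: sym.span_induct_alt)
    case (step c x y)
    then show ?case using *
      by (simp add: sym_D_simps sym.subspace_add [OF sub] sym.subspace_scale [OF sub])
  qed (simp add: sym_D_consts sym.subspace_0 [OF sub])
qed

lemma weight_space_sym_prod:
  "x \<in> weight_space L 1 \<Longrightarrow> y \<in> weight_space L 1 \<Longrightarrow> sym_prod n x y \<in> weight_space L 1"
  using weight_space_mult [OF _ weight_space_sym_D, of x L 1 y 1 n] by (simp add: sym_prod_def)

lemma zvar_zero: "zvar (l, 0) = 0"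
  using zvar_linear [of l 0 0 0 0] by simp

definition admissible :: "'l set \<Rightarrow> ('l \<times> ('i::finite, 'k::field_char_0) op_alg \<Rightarrow>\<^sub>0 nat) \<Rightarrow> bool" where
  "admissible L \<beta> \<longleftrightarrow> (\<forall>(l, \<alpha>) \<in> Poly_Mapping.keys \<beta>. l \<in> L \<and> \<alpha> \<noteq> 0 \<and> (\<exists>k. \<alpha> \<in> op_graded k))"

definition monom_weight :: "('l \<times> ('i::finite, 'k::field_char_0) op_alg \<Rightarrow>\<^sub>0 nat) \<Rightarrow> int" where
  "monom_weight \<beta> = (\<Sum>v\<in>Poly_Mapping.keys \<beta>. (1 - int (ell (snd v))) * int (Poly_Mapping.lookup \<beta> v))"

lemma populated_iff: "populated L \<beta> \<longleftrightarrow> admissible L \<beta> \<and> monom_weight \<beta> = 1"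
  by (simp add: populated_def admissible_def monom_weight_def case_prod_beta)

lemma monom_weight_add: "monom_weight (\<beta> + \<gamma>) = monom_weight \<beta> + monom_weight \<gamma>"
  unfolding monom_weight_def
  by (rule setsum_keys_plus_distrib) (simp_all add: algebra_simps)

lemma weighted_zmonom:
  fixes \<beta> :: "'l \<times> ('i::finite, 'k::field_char_0) op_alg \<Rightarrow>\<^sub>0 nat"
  assumes "admissible L \<beta>"
  shows "weighted L (monom_weight \<beta>) (zmonom \<beta>)"
proof -
  have pow: "weighted L (w * int n) (x ^ n)" if "weighted L w x"
    for w n and x :: "('l, 'i, 'k) sym_alg"
  proof (induction n)
    case (Suc n)
    then show ?case using weighted_mult [OF that Suc] by (simp add: algebra_simps)
  qed (simp add: weighted.one)
  have "weighted L (\<Sum>v\<in>K. (1 - int (ell (snd v))) * int (f v)) (\<Prod>v\<in>K. zvar v ^ f v)"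
    if "finite K" "K \<subseteq> Poly_Mapping.keys \<beta>" for K f
    using that
  proof (induction rule: finite_induct)
    case (insert v K)
    obtain l \<alpha> where v: "v = (l, \<alpha>)" by (cases v)
    with insert assms obtain k where "l \<in> L" "\<alpha> \<noteq> 0" "\<alpha> \<in> op_graded k"
      by (auto simp: admissible_def)
    then have "weighted L (1 - int (ell (snd v))) (zvar v)"
      using weighted_zvar [of l L \<alpha> k] by (simp add: v ell_eq)
    then show ?case using insert by (simp add: weighted_mult pow)
  qed (simp add: weighted.one)
  from this [of "Poly_Mapping.keys \<beta>" "Poly_Mapping.lookup \<beta>"] show ?thesis
    by (simp add: monom_weight_def zmonom_def)
qed

lemma weighted_cases_zmonom:
  assumes "weighted L w x"
  shows "x = 0 \<or> (\<exists>\<beta>. admissible L \<beta> \<and> monom_weight \<beta> = w \<and> x = zmonom \<beta>)"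
  using assms
proof (induction rule: weighted.induct)
  case one
  show ?case by (rule disjI2, rule exI [of _ 0]) (simp add: admissible_def monom_weight_def zmonom_def)
next
  case (var w x l \<alpha> k)
  show ?case
  proof (cases "x = 0 \<or> \<alpha> = 0")
    case True
    then show ?thesis by (auto simp: zvar_zero)
  next
    case False
    then obtain \<beta> where \<beta>: "admissible L \<beta>" "monom_weight \<beta> = w" "x = zmonom \<beta>" using var by blast
    let ?s = "Poly_Mapping.single (l, \<alpha>) (1 :: nat)"
    have "admissible L (?s + \<beta>)"
      using \<beta>(1) var False keys_add [of ?s \<beta>] by (fastforce simp: admissible_def)
    moreover have "monom_weight ?s = 1 - int k" using ell_eq [OF _ var(3)] False
      by (simp add: monom_weight_def)
    moreover have "zmonom ?s = zvar (l, \<alpha>)" by (simp add: zmonom_def)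
    ultimately show ?thesis using \<beta>
      by (intro disjI2 exI [of _ "?s + \<beta>"]) (simp add: monom_weight_add zmonom_add)
  qed
qed

lemma populated_space_eq: "populated_space L = weight_space L 1"
proof (rule subset_antisym)
  show "populated_space L \<subseteq> weight_space L 1"
    unfolding populated_space_def weight_space_def
    using weighted_zmonom by (intro sym.span_mono) (fastforce simp: populated_iff)
  have "Collect (weighted L 1) \<subseteq> sym.span (zmonom ` Collect (populated L))"
    using weighted_cases_zmonom [of L 1] sym.span_zero
    by (force simp: populated_iff intro: sym.span_base)
  then show "weight_space L 1 \<subseteq> populated_space L"
    unfolding populated_space_def weight_space_def by (intro sym.span_minimal) simp_all
qed

lemma multi_novikov_populated_space: "multi_novikov_algebra sym_scale (populated_space L) sym_prod"
  unfolding populated_space_eq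
proof (unfold_locales, goal_cases)
  case 1 show ?case by (simp add: weight_space_def)
next
  case 2 then show ?case by (rule weight_space_sym_prod)
qed (rule symn.add_left symn.add_right symn.scale_left symn.scale_right
  symn.left_symmetric symn.index_symmetric symn.right_commutative UNIV_I)+

section \<open>Homogeneous elements and weight spaces in terms of ordered words\<close>

lemma op_span_mult:
  assumes "\<And>\<beta>. \<beta> \<in> S \<Longrightarrow> \<alpha> * \<beta> \<in> op.span T" "\<beta> \<in> op.span S"
  shows "\<alpha> * \<beta> \<in> op.span T"
  using assms(2)
proof (induction rule: op.span_induct_alt)
  case (step c x y)
  then show ?case
    by (simp add: distrib_left op_scale_mult_right op.span_add op.span_scale assms(1))
qed (simp add: op.span_zero)

definition basis_words :: "nat \<Rightarrow> ('i::finite, 'k::field_char_0) op_alg set" where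
  "basis_words k = {op_word (basis_word ns js) | ns js. length ns = k}"

lemma basis_wordsI: "length ns = k \<Longrightarrow> op_word (basis_word ns js) \<in> basis_words k"
  unfolding basis_words_def by blast

lemma op_index_basis_words:
  assumes "\<alpha> \<in> op.span (basis_words k)"
  shows "op_index n * \<alpha> \<in> op.span (basis_words (Suc k))"
proof (rule op_span_mult [OF _ assms])
  fix \<beta> :: "('a, 'b) op_alg" assume "\<beta> \<in> basis_words k"
  then obtain ns js where "\<beta> = op_word (basis_word ns js)" "length ns = k"
    by (auto simp: basis_words_def)
  then have "op_index n * \<beta> = op_word (basis_word (n # ns) js)" "length (n # ns) = Suc k"
    by (simp_all add: op_word_Cons [of _ "_ @ _"])
  then show "op_index n * \<beta> \<in> op.span (basis_words (Suc k))"
    by (metis basis_wordsI op.span_base)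
qed

lemma op_scale_mult_left: "op_scale c \<alpha> * \<beta> = op_scale c (\<alpha> * \<beta>)"
  by transfer (simp add: pscale_mult mult.assoc ring_ideal.zero)

text \<open>Moving the derivative to the right either passes an index or lowers it, and in both
  cases the number of indices is preserved.\<close>

lemma op_partial_basis_word:
  "(op_word (Word [Partial i]) :: ('i::finite, 'k::field_char_0) op_alg) * op_word (basis_word ns js)
    \<in> op.span (basis_words (length ns))"
proof (induction ns)
  case Nil
  have "op_word (Word [Partial i]) * op_word (basis_word [] js) =
      (op_word (basis_word [] (i # js)) :: ('i, 'k) op_alg)"
    by (simp add: op_word_Cons [of _ "map _ _"])
  then show ?case by (metis basis_wordsI op.span_base)
next
  case (Cons n ns)
  have "op_word (Word [Partial i]) * op_word (basis_word (n # ns) js) =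
      ((op_word (Word [Partial i]) :: ('i, 'k) op_alg) * op_index n) * op_word (basis_word ns js)"
    by (simp add: op_word_Cons [of _ "_ @ _"] mult.assoc)
  also have "\<dots> = op_scale (of_nat (n i)) (op_index (n(i := n i - 1)) * op_word (basis_word ns js))
      + op_index n * (op_word (Word [Partial i]) * op_word (basis_word ns js))"
    unfolding op_partial_index distrib_right op_scale_mult_left mult.assoc ..
  also have "\<dots> \<in> op.span (basis_words (Suc (length ns)))"
  proof (intro op.span_add op.span_scale op_index_basis_words)
    show "op_word (basis_word ns js) \<in> op.span (basis_words (length ns) :: ('i, 'k) op_alg set)"
      by (intro op.span_base basis_wordsI refl)
  qed (rule Cons)
  finally show ?case by simp
qed

lemma op_word_basis_words: "op_word (Word xs) \<in> op.span (basis_words (index_count (Word xs)))"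
proof (induction xs)
  case Nil
  have "(op_word (Word []) :: ('a, 'b) op_alg) \<in> basis_words 0"
    using basis_wordsI [of "[]" 0 "[]"] by simp
  then show ?case by (simp add: index_count_def op.span_base)
next
  case (Cons x xs)
  show ?case
  proof (cases x)
    case (Index n)
    then have "index_count (Word (x # xs)) = Suc (index_count (Word xs))"
      by (simp add: index_count_def)
    then show ?thesis
      using op_index_basis_words [OF Cons] op_word_Cons [of x xs] Index by metis
  next
    case (Partial i)
    then have "index_count (Word (x # xs)) = index_count (Word xs)"
      by (simp add: index_count_def)
    moreover have "op_word (Word [Partial i]) * \<beta> \<in> op.span (basis_words k)"
      if "\<beta> \<in> basis_words k" for \<beta> :: "('a, 'b) op_alg" and k
      using that op_partial_basis_word by (auto simp: basis_words_def)
    ultimately show ?thesis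
      using op_span_mult [OF _ Cons, of "op_word (Word [Partial i])"] op_word_Cons [of x xs] Partial
      by metis
  qed
qed

lemma op_graded_basis_words: "\<alpha> \<in> op_graded k \<Longrightarrow> \<alpha> \<in> op.span (basis_words k)"
  unfolding op_graded_def
proof (rule subsetD [OF op.span_minimal])
  show "op_word ` {w. index_count w = k} \<subseteq> op.span (basis_words k :: ('a, 'b) op_alg set)"
  proof (rule image_subsetI)
    fix w :: "'a letter word" assume "w \<in> {w. index_count w = k}"
    then show "op_word w \<in> op.span (basis_words k :: ('a, 'b) op_alg set)"
      using op_word_basis_words [of "letters w"] by simp
  qed
qed simp_all

definition labels :: "(('i \<times> 'l) \<times> 'a) multiset \<Rightarrow> 'l set" where
  "labels X = (\<lambda>v. snd (fst v)) ` set_mset X"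

definition basis_monoms :: "'l set \<Rightarrow> int \<Rightarrow> ('l, 'i::finite, 'k::field_char_0) sym_alg set" where
  "basis_monoms L w = {sym_monom X | X. weight X = w \<and> labels X \<subseteq> L}"

lemma basis_monomsI: "weight X = w \<Longrightarrow> labels X \<subseteq> L \<Longrightarrow> sym_monom X \<in> basis_monoms L w"
  unfolding basis_monoms_def by blast

lemma zvar_basis_monoms:
  assumes "\<alpha> \<in> op_graded k" "l \<in> L"
  shows "zvar (l, \<alpha>) \<in> sym.span (basis_monoms L (1 - int k))"
proof -
  have "\<alpha> \<in> op.span (basis_words k)" using assms(1) by (rule op_graded_basis_words)
  then show ?thesis
  proof (induction rule: op.span_induct_alt)
    case base
    show ?case by (simp add: zvar_zero sym.span_zero)
  next
    case (step c \<beta> \<gamma>)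
    then obtain ns js where \<beta>: "\<beta> = op_word (basis_word ns js)" "length ns = k"
      by (auto simp: basis_words_def)
    have "zvar (l, \<beta>) = sym_monom {#((count_list js, l), mset ns)#}"
      by (simp add: \<beta> sym_var_zvar)
    also have "\<dots> \<in> basis_monoms L (1 - int k)"
      using assms(2) by (intro basis_monomsI) (simp_all add: \<beta> labels_def)
    finally have "zvar (l, \<beta>) \<in> sym.span (basis_monoms L (1 - int k))" by (rule sym.span_base)
    moreover have "zvar (l, op_scale c \<beta> + \<gamma>) = sym_scale c (zvar (l, \<beta>)) + zvar (l, \<gamma>)"
      using zvar_linear [of l c \<beta> 1 \<gamma>] by simp
    ultimately show ?case using step by (simp add: sym.span_add sym.span_scale)
  qed
qed

lemma weight_space_basis_monoms: "weight_space L w \<subseteq> sym.span (basis_monoms L w)"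
proof -
  have "x \<in> sym.span (basis_monoms L w)" if "weighted L w x" for w and x :: "('a, 'b, 'c) sym_alg"
    using that
  proof (induction rule: weighted.induct)
    case one
    have "(1 :: ('a, 'b, 'c) sym_alg) \<in> basis_monoms L 0"
      using basis_monomsI [of "{#}" 0 L] by (simp add: labels_def)
    then show ?case by (rule sym.span_base)
  next
    case (var w x l \<alpha> k)
    show ?case
    proof (rule sym_span_mult [OF _ zvar_basis_monoms [OF var(3,2)] var.IH])
      fix y z :: "('a, 'b, 'c) sym_alg"
      assume "y \<in> basis_monoms L (1 - int k)" "z \<in> basis_monoms L w"
      then obtain X Y where "y = sym_monom X" "weight X = 1 - int k" "labels X \<subseteq> L"
        "z = sym_monom Y" "weight Y = w" "labels Y \<subseteq> L"
        by (auto simp: basis_monoms_def)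
      then have "y * z = sym_monom (X + Y)" "weight (X + Y) = 1 - int k + w" "labels (X + Y) \<subseteq> L"
        by (auto simp: labels_def)
      then show "y * z \<in> sym.span (basis_monoms L (1 - int k + w))"
        by (metis basis_monomsI sym.span_base)
    qed
  qed
  then show ?thesis unfolding weight_space_def by (intro sym.span_minimal) auto
qed

section \<open>The isomorphism\<close>

lemma free_novikov_on_UNIV: "free_novikov_on UNIV = (UNIV :: ('a, 'g, 'k::field) free_novikov set)"
proof (rule UNIV_eq_I [symmetric])
  fix x :: "('a, 'g, 'k) free_novikov"
  obtain p where p: "x = abs_free_novikov p"
    using Quotient3_abs_rep [OF Quotient3_free_novikov, of x] by metis
  have "abs_free_novikov p \<in> free_novikov_on UNIV" for p :: "('a, 'g) mterm \<Rightarrow>\<^sub>0 'k"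
  proof (induction p rule: poly_mapping_single_induct)
    case zero
    show ?case using fn.subspace_0 [OF free_novikov_on_subspace] by (simp add: zero_free_novikov.abs_eq)
  next
    case (monom t c)
    have "fn_scale c (fn_term t) \<in> free_novikov_on UNIV"
      by (rule fn.subspace_scale [OF free_novikov_on_subspace fn_term_in]) simp
    then show ?case by (simp add: fn_term.abs_eq fn_scale.abs_eq)
  next
    case (add p q)
    then show ?case
      using fn.subspace_add [OF free_novikov_on_subspace add] by (simp add: plus_free_novikov.abs_eq)
  qed
  then show "x \<in> free_novikov_on UNIV" by (simp add: p)
qed

abbreviation fn_gen :: "'g \<Rightarrow> ('a, 'g, 'k::field) free_novikov" where
  "fn_gen g \<equiv> fn_term (Gen g)"

lemma fn_term_eval: "fn_term t = mterm_eval fn_prod fn_gen t"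
  by (induction t) (simp_all add: fn_term_Prod [symmetric])

lemma fn_span_normal_forms:
  "fn.span (fnt.normal_forms fn_gen) = (UNIV :: ('a, 'g, 'k::field) free_novikov set)"
proof -
  have "(fn_term t :: ('a, 'g, 'k) free_novikov) \<in> fn.span (fnt.normal_forms fn_gen)" for t
    by (subst fn_term_eval) (rule fnt.mterm_eval_normal_forms)
  then have "(free_novikov_on UNIV :: ('a, 'g, 'k) free_novikov set) \<subseteq> fn.span (fnt.normal_forms fn_gen)"
    unfolding free_novikov_on_def by (intro fn.span_minimal) auto
  then show ?thesis by (auto simp: free_novikov_on_UNIV)
qed

section \<open>The canonical morphism: injectivity and image\<close>

context
  fixes \<phi> :: "('i::finite mindex, 'i mindex \<times> 'l, 'k::field_char_0) free_novikov \<Rightarrow> ('l, 'i, 'k) sym_alg"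
  assumes hom: "mn_hom fn_scale UNIV fn_prod sym_scale UNIV sym_prod \<phi>"
    and gen: "\<And>g. \<phi> (fn_gen g) = sym_gen g"
begin

lemma hom_simps:
  "\<phi> (x + y) = \<phi> x + \<phi> y" "\<phi> (fn_scale c x) = sym_scale c (\<phi> x)"
  "\<phi> (fn_prod a x y) = sym_prod a (\<phi> x) (\<phi> y)" "\<phi> 0 = 0" "\<phi> (x - y) = \<phi> x - \<phi> y"
proof -
  show *: "\<phi> (x + y) = \<phi> x + \<phi> y" "\<phi> (fn_scale c x) = sym_scale c (\<phi> x)"
    "\<phi> (fn_prod a x y) = sym_prod a (\<phi> x) (\<phi> y)" for x y c a
    using hom by (auto simp: mn_hom_def)
  show "\<phi> 0 = 0" using *(1) [of 0 0] by simp
  show "\<phi> (x - y) = \<phi> x - \<phi> y" using *(1) [of "x - y" y] by simp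
qed

lemma hom_brace: "length us = length A \<Longrightarrow> \<phi> (fnt.brace A z us) = symn.brace A (\<phi> z) (map \<phi> us)"
proof (induction A arbitrary: us)
  case (Cons a A)
  then obtain u us' where us: "us = u # us'" "length us' = length A" by (cases us) auto
  have sum: "\<phi> (sum f I) = (\<Sum>i\<in>I. \<phi> (f i))" for f :: "nat \<Rightarrow> _" and I
    by (induction I rule: infinite_finite_induct) (simp_all add: hom_simps)
  have "\<phi> (fnt.brace A z (us'[i := fn_prod a u (us' ! i)])) =
      symn.brace A (\<phi> z) ((map \<phi> us')[i := sym_prod a (\<phi> u) (map \<phi> us' ! i)])" if "i < length us'" for i
    using that us(2) by (simp add: Cons.IH map_update hom_simps)
  then show ?case by (simp add: us(1) hom_simps sum Cons.IH us(2))
qed simp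

text \<open>The morphism turns the operator into genuine multiplication by the monomial it stands
  for.\<close>

lemma hom_composite:
  "fnt.composite fn_gen Y c \<Longrightarrow> \<phi> (c x) = \<phi> x * sym_monom Y"
proof (induction rule: fnt.composite.induct)
  case (step Y c A hs g)
  have "\<phi> (fnt.brace A (fn_gen g) (c x # map fn_gen hs)) =
      symn.brace A (sym_gen g) (\<phi> (c x) # map sym_gen hs)"
    using step(2) by (subst hom_brace) (simp_all add: gen o_def)
  then show ?case
    using step(2) by (simp add: sym_brace step.IH sym_monom_leaves sym_var_eq ac_simps)
qed simp

lemma hom_normal_form:
  "fnt.composite fn_gen Y c \<Longrightarrow> \<phi> (c (fn_gen h)) = sym_monom (add_mset (leaf h) Y)"
  by (simp add: hom_composite gen sym_var_leaf)

lemma hom_inj: "inj \<phi>"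
proof -
  \<comment> \<open>The left inverse on monomials, well defined by \<open>composite_unique\<close>;
    keys that have no arrangement get an arbitrary value and do not arise from the images of normal
    forms.\<close>
  define nf :: "('i, 'l) sym_key \<Rightarrow> ('i mindex, 'i mindex \<times> 'l, 'k) free_novikov"
    where "nf X = (THE x. \<exists>h Y c. X = add_mset (leaf h) Y \<and> fnt.composite fn_gen Y c \<and> x = c (fn_gen h))"
    for X
  define \<psi> where "\<psi> x = lin_ext fn_scale nf (sym_coords x)" for x
  have nf: "nf (add_mset (leaf h) Y) = c (fn_gen h)" if "fnt.composite fn_gen Y c" for h Y c
    unfolding nf_def
  proof (rule the_equality)
    show "\<exists>h' Y' c'. add_mset (leaf h) Y = add_mset (leaf h') Y' \<and> fnt.composite fn_gen Y' c' \<and>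
        c (fn_gen h) = c' (fn_gen h')"
      using that by (intro exI conjI) (rule refl, assumption, rule refl)
  next
    fix x :: "('i mindex, 'i mindex \<times> 'l, 'k) free_novikov"
    assume "\<exists>h' Y' c'. add_mset (leaf h) Y = add_mset (leaf h') Y' \<and> fnt.composite fn_gen Y' c' \<and>
        x = c' (fn_gen h')"
    then show "x = c (fn_gen h)"
      by (elim exE conjE) (simp add: fnt.composite_unique [OF _ that sym])
  qed
  have "\<psi> (\<phi> x) = x" for x
  proof -
    have "x \<in> fn.span (fnt.normal_forms fn_gen)" by (simp add: fn_span_normal_forms)
    then show ?thesis
    proof (induction rule: fn.span_induct_alt)
      case base
      show ?case by (simp add: \<psi>_def hom_simps sym_coords_hom)
    next
      case (step k x y)
      then obtain Y c h where x: "x = c (fn_gen h)" "fnt.composite fn_gen Y c"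
        by (auto simp: fnt.normal_forms_def)
      have "\<psi> (\<phi> x) = x"
        using nf [OF x(2)] unfolding x(1) \<psi>_def hom_normal_form [OF x(2)] sym_coords_sym_monom by simp
      then show ?case
        using step by (simp add: \<psi>_def hom_simps sym_coords_hom fn.lin_ext_add fn.lin_ext_pscale)
    qed
  qed
  then show ?thesis by (metis injI)
qed

text \<open>Generators have weight 1 and products preserve it. Conversely a basis monomial of weight
  1 has an arrangement using only the generators in its own factors, so its value stays in the
  subalgebra belonging to \<open>L\<close>.\<close>

lemma hom_image: "\<phi> ` free_novikov_on (UNIV \<times> L) = populated_space L"
proof (rule subset_antisym)
  have sub: "sym.subspace (populated_space L)" by (simp add: populated_space_def)
  have eval: "\<phi> (fn_term t) \<in> populated_space L" if "gens t \<subseteq> UNIV \<times> L" for t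
    using that
  proof (induction t)
    case (Gen g)
    have "(op_word (basis_word [] js) :: ('i, 'k) op_alg) \<in> op_graded 0" for js :: "'i list"
      unfolding op_graded_def by (rule op.span_base) (auto simp: index_count_def)
    from weighted_zvar [OF _ this, of "snd g" L] Gen show ?case
      by (auto simp: gen sym_gen_def populated_space_eq weight_space_def intro: sym.span_base)
  next
    case (Prod a s t)
    then show ?case
      by (simp add: hom_simps populated_space_eq weight_space_sym_prod flip: fn_term_Prod)
  qed
  show "\<phi> ` free_novikov_on (UNIV \<times> L) \<subseteq> populated_space L"
  proof (rule image_subsetI)
    fix x :: "('i mindex, 'i mindex \<times> 'l, 'k) free_novikov"
    assume "x \<in> free_novikov_on (UNIV \<times> L)"
    then show "\<phi> x \<in> populated_space L"
    proof (induction rule: free_novikov_on_induct)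
      case zero
      show ?case by (simp add: hom_simps sym.subspace_0 [OF sub])
    next
      case (step c t y)
      then show ?case
        using eval by (simp add: hom_simps sym.subspace_add [OF sub] sym.subspace_scale [OF sub])
    qed
  qed
next
  let ?F = "free_novikov_on (UNIV \<times> L) :: ('i mindex, 'i mindex \<times> 'l, 'k) free_novikov set"
  have "sym.subspace (\<phi> ` ?F)"
    unfolding sym.subspace_def
  proof (intro conjI ballI allI)
    show "0 \<in> \<phi> ` ?F"
      using fn.subspace_0 [OF free_novikov_on_subspace] hom_simps(4) by (metis imageI)
  next
    fix x y assume "x \<in> \<phi> ` ?F" "y \<in> \<phi> ` ?F"
    then show "x + y \<in> \<phi> ` ?F"
      by (auto simp: hom_simps(1) [symmetric] intro!: imageI fn.subspace_add [OF free_novikov_on_subspace])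
  next
    fix c x assume "x \<in> \<phi> ` ?F"
    then show "sym_scale c x \<in> \<phi> ` ?F"
      by (auto simp: hom_simps(2) [symmetric] intro!: imageI fn.subspace_scale [OF free_novikov_on_subspace])
  qed
  moreover have "basis_monoms L 1 \<subseteq> \<phi> ` ?F"
  proof
    fix x :: "('l, 'i, 'k) sym_alg" assume "x \<in> basis_monoms L 1"
    then obtain X where X: "x = sym_monom X" "weight X = 1" "labels X \<subseteq> L"
      by (auto simp: basis_monoms_def)
    obtain h Y and c :: "('i mindex, 'i mindex \<times> 'l, 'k) free_novikov \<Rightarrow> _"
      where Y: "X = add_mset (leaf h) Y" "fnt.composite fn_gen Y c"
      using fnt.composite_exists [OF X(2)] by blast
    have h: "snd h \<in> L" and Ylab: "\<forall>v\<in>#Y. snd (fst v) \<in> L"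
      using X(3) by (auto simp: Y(1) labels_def)
    have gens: "fn_gen g \<in> ?F" if "snd g \<in> L" for g
      by (rule fn_term_in) (use that in \<open>cases g; simp\<close>)
    have "c (fn_gen h) \<in> ?F"
      using gens h Ylab
      by (intro fnt.composite_closed [OF free_novikov_on_subspace free_novikov_on_closed Y(2)]) auto
    then show "x \<in> \<phi> ` ?F"
      using hom_normal_form [OF Y(2), of h] by (metis X(1) Y(1) imageI)
  qed
  ultimately have "sym.span (basis_monoms L 1) \<subseteq> \<phi> ` ?F" by (intro sym.span_minimal)
  then show "populated_space L \<subseteq> \<phi> ` ?F"
    using weight_space_basis_monoms unfolding populated_space_eq by blast
qed

end

lemma mn_isomorphic_sym:
  assumes "mn_isomorphic scale V pr scale' V' pr'"
  shows "mn_isomorphic scale' V' pr' scale V pr"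
proof -
  obtain \<phi> where alg: "multi_novikov_algebra scale V pr" "multi_novikov_algebra scale' V' pr'"
    and \<phi>: "mn_hom scale V pr scale' V' pr' \<phi>" "bij_betw \<phi> V V'"
    using assms by (auto simp: mn_isomorphic_def)
  interpret V: multi_novikov_algebra scale V pr by (rule alg)
  define \<psi> where "\<psi> = the_inv_into V \<phi>"
  have inv: "\<psi> y \<in> V" "\<phi> (\<psi> y) = y" if "y \<in> V'" for y
    using \<phi>(2) that unfolding \<psi>_def
    by (auto simp: bij_betw_def f_the_inv_into_f intro: the_inv_into_into)
  have eq: "\<psi> y = x" if "x \<in> V" "\<phi> x = y" for x y
    using \<phi>(2) that unfolding \<psi>_def by (auto simp: bij_betw_def the_inv_into_f_f)
  have "mn_hom scale' V' pr' scale V pr \<psi>"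
    unfolding mn_hom_def
    by (intro conjI ballI allI inv(1) eq; (intro V.closed V.subspace_add V.subspace_scale V.subspace inv(1))?)
      (use \<phi>(1) inv in \<open>simp_all add: mn_hom_def\<close>)
  moreover have "bij_betw \<psi> V' V" unfolding \<psi>_def by (rule bij_betw_the_inv_into [OF \<phi>(2)])
  ultimately show ?thesis using alg by (auto simp: mn_isomorphic_def)
qed

theorem theorem1p3:
  fixes L :: "'l set"
  assumes "finite L"
  shows "mn_isomorphic
    sym_scale (populated_space L :: ('l, 'i::finite, 'k::field_char_0) sym_alg set) sym_prod
    fn_scale
    (free_novikov_on ((UNIV :: 'i mindex set) \<times> L) :: ('i mindex, 'i mindex \<times> 'l, 'k) free_novikov set)
    fn_prod"
proof (rule mn_isomorphic_sym)
  let ?F = "free_novikov_on (UNIV \<times> L) :: ('i mindex, 'i mindex \<times> 'l, 'k) free_novikov set"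
  obtain \<phi> :: "('i mindex, 'i mindex \<times> 'l, 'k) free_novikov \<Rightarrow> ('l, 'i, 'k) sym_alg"
    where \<phi>: "mn_hom fn_scale UNIV fn_prod sym_scale UNIV sym_prod \<phi>" "\<And>g. \<phi> (fn_gen g) = sym_gen g"
    \<comment> \<open>The morphism is taken on the free algebra over all noise types and restricted
      afterwards, so injectivity on the subalgebra is inherited.\<close>
    using symn.free_novikov_exists [of UNIV sym_gen] unfolding free_novikov_on_UNIV by auto
  have "mn_hom fn_scale ?F fn_prod sym_scale (populated_space L) sym_prod \<phi>"
    using \<phi>(1) hom_image [OF \<phi>, of L] by (auto simp: mn_hom_def)
  moreover have "bij_betw \<phi> ?F (populated_space L)"
    using hom_image [OF \<phi>, of L] inj_on_subset [OF hom_inj [OF \<phi>]] by (simp add: bij_betw_def)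
  ultimately show "mn_isomorphic fn_scale ?F fn_prod sym_scale (populated_space L) sym_prod"
    using multi_novikov_free_novikov_on multi_novikov_populated_space
    by (auto simp: mn_isomorphic_def)
qed

end
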